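(* Let $m\ge1$, $1\le k\le m$, and let $a,c\in\mathbb{C}$, $b\in\mathbb{C}^m$ satisfy $a\notin\mathbb{Z}$, $c-a\notin\mathbb{Z}$, $b_l\notin\mathbb{Z}$ $(1\le l\le m)$, $c-\sum_{l=1}^m b_l\notin\mathbb{Z}$ and $c-\sum_{l=1}^{k-1}b_l\notin\mathbb{Z}$. Let $x$ be in a small neighborhood of the point $x^{(k)}$, and let $F^{(k)}(a,b,c;x)$, $C(a,b,c)$, $Q_j(a,b,c;x)$ $(0\le j\le m+1)$ be as defined in the context. Then \begin{align*} F^{(k)}(a-1,b,c;x)&=D_a^{(k)}(a,b,c;x)F^{(k)}(a,b,c;x),\\ F^{(k)}(a,b,c-1;x)&=D_c^{(k)}(a,b,c;x)F^{(k)}(a,b,c;x),\\ F^{(k)}(a,b-e_l,c;x)&=D_l^{(k)}(a,b,c;x)F^{(k)}(a,b,c;x)\qquad(1\le l\le m), \end{align*} where $e_l$ is the $l$-th unit vector of $\mathbb{C}^m$ and \begin{align*} D_a^{(k)}(a,b,c;x)&:=\frac{1}{a-c}\;Q_{m+1}(a,b,c;x)\;C(a,b,c)^{-1},\\ D_c^{(k)}(a,b,c;x)&:=(c-a-1)\;Q_0(a+1,b,c;x)\;Q_{m+1}(a+1,b,c;x)^{-1},\\ D_l^{(k)}(a,b,c;x)&:=\frac{1}{1-b_l}\;Q_l(a+1,b,c+1;x)\;Q_0(a+1,b,c+1;x)^{-1}. \end{align*} (In particular these matrices do not depend on $k$.)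
   Context: Series: $$f^{(k)}(a,b,c;x)=\prod_{l=1}^{k-1}x_l^{-b_l}\cdot x_k^{\sum_{l=1}^{k-1}b_l-c+1}\sum_{n_1,\dots,n_m\ge0}\frac{1}{\Gamma^{(k)}_{n_1,\dots,n_m}(a,b,c)}\prod_{l=1}^{k-1}\Big(\frac{x_k}{x_l}\Big)^{n_l}x_k^{n_k}\prod_{l=k+1}^m\Big(\frac{x_l}{x_k}\Big)^{n_l},$$ $\Gamma^{(k)}_{n_1,\dots,n_m}(a,b,c)=\Gamma(c-a-n_k)\prod_{1\le l\le m,\,l\ne k}\Gamma(1-b_l-n_l)\prod_{l=1}^m\Gamma(1+n_l)\cdot\Gamma\big(-\sum_{l=1}^kb_l+c-\sum_{l=1}^kn_l+\sum_{l=k+1}^mn_l\big)\cdot\Gamma\big(2+\sum_{l=1}^{k-1}b_l-c+\sum_{l=1}^kn_l-\sum_{l=k+1}^mn_l\big)$ (with $1/\Gamma$ understood as an entire function). The vector is $$F^{(k)}(a,b,c;x)={}^t\Big(f^{(k)}(a,b,c;x),\tfrac{x_1-1}{-b_1}\tfrac{\partial f^{(k)}}{\partial x_1}(a,b,c;x),\dots,\tfrac{x_m-1}{-b_m}\tfrac{\partial f^{(k)}}{\partial x_m}(a,b,c;x)\Big).$$ The base point is $x^{(k)}=(\xi,\xi^2,\dots,\xi^{k-1},e^{-\pi\sqrt{-1}}\xi^k,\xi^{k+1},\dots,\xi^m)$ with real $\varepsilon,\xi$, $0<\varepsilon<\frac12$, $0<\xi<\min\{\varepsilon,\frac{1}{1+\varepsilon}\}$;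 powers use $\arg x_k=-\pi$ and $\arg x_l=0$ $(l\ne k)$ at $x^{(k)}$, extended continuously. Intersection matrices: put $x_0=0$, $x_{m+1}=1$, $\alpha_0=-c+\sum_{j=1}^m b_j$, $\alpha_j=-b_j$ $(1\le j\le m)$, $\alpha_{m+1}=c-a$, $\alpha_{m+2}=a$; $T_x=\mathbb{C}\setminus\{x_0,\dots,x_{m+1}\}$, $u_x(t)=\prod_{i=0}^{m+1}(t-x_i)^{\alpha_i}$, $\omega=d\log u_x$, $\nabla_{\pm\omega}=d\pm\omega\wedge$ ($d$ with respect to $t$). $H^1(T_x,\nabla_{\pm\omega})=\ker(\nabla_{\pm\omega}:\mathcal{E}^1\to\mathcal{E}^2)/\nabla_{\pm\omega}(\mathcal{E}^0)$ for smooth forms on $T_x$; $H^1_c(T_x,\nabla_\omega)$ is the analogous group for compactly supported forms. There is a canonical isomorphism $\jmath:H^1(T_x,\nabla_\omega)\to H^1_c(T_x,\nabla_\omega)$ (inverse of the natural map), and $I_c(\psi,\psi')=\int_{T_x}\jmath(\psi)\wedge\psi'$ for $\psi\in H^1(T_x,\nabla_\omega)$, $\psi'\in H^1(T_x,\nabla_{-\omega})$. Let $\varphi_0=\frac{dt}{t-1}$, $\varphi_j=\frac{dt}{t-1}-\frac{dt}{t-x_j}$ $(1\le j\le m)$. The $(m+1)\times(m+1)$ matrices (indices $0,\dots,m$) are $C(a,b,c)=(I_c(\varphi_i,\varphi_j))_{i,j}$ and $Q_l(a,b,c;x)=(I_c((t-x_l)\varphi_i,\varphi_j))_{i,j}$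 for $0\le l\le m+1$; for shifted parameters one substitutes the shifted $(a,b,c)$. Known fact: writing $\varphi_{i,m+2}=\frac{dt}{t-x_i}$, $\varphi_{i,j}=\varphi_{i,m+2}-\varphi_{j,m+2}$, one has $I_c(\varphi_{i,j},\varphi_{p,q})=2\pi\sqrt{-1}\big(\frac{\delta_{i,p}-\delta_{i,q}}{\alpha_i}-\frac{\delta_{j,p}-\delta_{j,q}}{\alpha_j}\big)$. *)

theory Defs
  imports
    "HOL-Complex_Analysis.Complex_Analysis"
    "Jordan_Normal_Form.Gauss_Jordan_Elimination"
begin

text \<open>
  The tuples \<open>b\<close> and \<open>x\<close> are functions on \<open>nat\<close> of which only the values at \<open>1, \<dots>, m\<close> are used.
  Vectors and matrices have indices \<open>0, \<dots>, m\<close>.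
\<close>

subsection \<open>The series\<close>

definition base_point :: "nat \<Rightarrow> real \<Rightarrow> nat \<Rightarrow> complex" where
  "base_point k \<xi> l =
     (if l = k then exp (- (of_real pi * \<i>)) * of_real (\<xi> ^ k) else of_real (\<xi> ^ l))"

text \<open>
  The branch of the logarithm of the coordinate \<open>x\<^sub>l\<close> near the base point: the argument is \<open>0\<close> at
  the base point for \<open>l \<noteq> k\<close> and \<open>- pi\<close> for \<open>l = k\<close>. It is continuous as long as \<open>- x\<^sub>k\<close> and the
  other coordinates avoid the nonpositive real axis, in particular in a small polydisc.
\<close>

definition log_branch :: "nat \<Rightarrow> nat \<Rightarrow> complex \<Rightarrow> complex" where
  "log_branch k l z = (if l = k then Ln (- z) - of_real pi * \<i> else Ln z)"

definition pow_branch :: "nat \<Rightarrow> nat \<Rightarrow> complex \<Rightarrow> complex \<Rightarrow> complex" where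
  "pow_branch k l z s = exp (s * log_branch k l z)"

text \<open>\<open>1 / \<Gamma>\<^sup>(\<^sup>k\<^sup>)\<close>, a product of values of the entire function \<open>rGamma = 1 / Gamma\<close>.\<close>

definition rGamma_k ::
  "nat \<Rightarrow> nat \<Rightarrow> complex \<Rightarrow> (nat \<Rightarrow> complex) \<Rightarrow> complex \<Rightarrow> (nat \<Rightarrow> nat) \<Rightarrow> complex" where
  "rGamma_k m k a b c n =
     rGamma (c - a - of_nat (n k))
     * (\<Prod>l\<in>{1..m} - {k}. rGamma (1 - b l - of_nat (n l)))
     * (\<Prod>l\<in>{1..m}. rGamma (1 + of_nat (n l)))
     * rGamma (- (\<Sum>l\<in>{1..k}. b l) + c
               - (\<Sum>l\<in>{1..k}. of_nat (n l)) + (\<Sum>l\<in>{k+1..m}. of_nat (n l)))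
     * rGamma (2 + (\<Sum>l\<in>{1..<k}. b l) - c
               + (\<Sum>l\<in>{1..k}. of_nat (n l)) - (\<Sum>l\<in>{k+1..m}. of_nat (n l)))"

definition f_ser ::
  "nat \<Rightarrow> nat \<Rightarrow> complex \<Rightarrow> (nat \<Rightarrow> complex) \<Rightarrow> complex \<Rightarrow> (nat \<Rightarrow> complex) \<Rightarrow> complex" where
  "f_ser m k a b c x =
     (\<Prod>l\<in>{1..<k}. pow_branch k l (x l) (- b l))
     * pow_branch k k (x k) ((\<Sum>l\<in>{1..<k}. b l) - c + 1)
     * (\<Sum>\<^sub>\<infinity>n\<in>({1..m} \<rightarrow>\<^sub>E (UNIV :: nat set)).
          rGamma_k m k a b c n
          * (\<Prod>l\<in>{1..<k}. (x k / x l) ^ n l) * x k ^ n k * (\<Prod>l\<in>{k+1..m}. (x l / x k) ^ n l))"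

definition F_vec ::
  "nat \<Rightarrow> nat \<Rightarrow> complex \<Rightarrow> (nat \<Rightarrow> complex) \<Rightarrow> complex \<Rightarrow> (nat \<Rightarrow> complex) \<Rightarrow> complex vec" where
  "F_vec m k a b c x = vec (m + 1) (\<lambda>i.
     if i = 0 then f_ser m k a b c x
     else (x i - 1) / (- b i) * deriv (\<lambda>z. f_ser m k a b c (x(i := z))) (x i))"

subsection \<open>Twisted de Rham cohomology of an open subset of the plane\<close>

text \<open>Real differentiability classes of complex-valued functions on an open set.\<close>

primrec Ck_on :: "nat \<Rightarrow> complex set \<Rightarrow> (complex \<Rightarrow> complex) \<Rightarrow> bool" where
  "Ck_on 0 S f \<longleftrightarrow> continuous_on S f"
| "Ck_on (Suc n) S f \<longleftrightarrow>
     (\<forall>z\<in>S. f differentiable (at z)) \<and>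
     (\<forall>v\<in>{1, \<i>}. Ck_on n S (\<lambda>z. frechet_derivative f (at z) v))"

definition smooth_on :: "complex set \<Rightarrow> (complex \<Rightarrow> complex) \<Rightarrow> bool" where
  "smooth_on S f \<longleftrightarrow> (\<forall>n. Ck_on n S f)"

text \<open>
  A complex-valued 1-form assigns to each point a real-linear map from tangent vectors to \<open>\<complex>\<close>; its
  \<open>dx\<close> and \<open>dy\<close> coefficients are its values at the tangent vectors \<open>1\<close> and \<open>\<i>\<close>. A 2-form is
  represented by its coefficient with respect to \<open>dx \<and> dy\<close>.
\<close>

type_synonym form1 = "complex \<Rightarrow> complex \<Rightarrow> complex"

definition E0 :: "complex set \<Rightarrow> (complex \<Rightarrow> complex) set" where
  "E0 T = {g. smooth_on T g}"

definition E1 :: "complex set \<Rightarrow> form1 set" where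
  "E1 T = {\<eta>. (\<forall>z\<in>T. linear (\<eta> z)) \<and> (\<forall>v\<in>{1, \<i>}. smooth_on T (\<lambda>z. \<eta> z v))}"

definition compactly_supported :: "complex set \<Rightarrow> (complex \<Rightarrow> 'b::zero) \<Rightarrow> bool" where
  "compactly_supported T h \<longleftrightarrow> (\<exists>K. compact K \<and> K \<subseteq> T \<and> (\<forall>z\<in>T - K. h z = 0))"

definition E0c :: "complex set \<Rightarrow> (complex \<Rightarrow> complex) set" where
  "E0c T = {g \<in> E0 T. compactly_supported T g}"

definition E1c :: "complex set \<Rightarrow> form1 set" where
  "E1c T = {\<eta> \<in> E1 T. \<forall>v. compactly_supported T (\<lambda>z. \<eta> z v)}"

definition wedge :: "form1 \<Rightarrow> form1 \<Rightarrow> complex \<Rightarrow> complex" where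
  "wedge \<eta> \<theta> z = \<eta> z 1 * \<theta> z \<i> - \<eta> z \<i> * \<theta> z 1"

text \<open>The form \<open>h(t) dt\<close>; recall that \<open>dt\<close> is the identity on tangent vectors.\<close>

definition times_dt :: "(complex \<Rightarrow> complex) \<Rightarrow> form1" where
  "times_dt h = (\<lambda>z v. h z * v)"

text \<open>The twisted differentials \<open>d + \<omega> \<and>\<close> on functions and on 1-forms, where \<open>\<omega> = w(t) dt\<close>.\<close>

definition nabla0 :: "(complex \<Rightarrow> complex) \<Rightarrow> (complex \<Rightarrow> complex) \<Rightarrow> form1" where
  "nabla0 w g = (\<lambda>z v. frechet_derivative g (at z) v + times_dt w z v * g z)"

definition nabla1 :: "(complex \<Rightarrow> complex) \<Rightarrow> form1 \<Rightarrow> complex \<Rightarrow> complex" where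
  "nabla1 w \<eta> = (\<lambda>z. frechet_derivative (\<lambda>y. \<eta> y \<i>) (at z) 1
                     - frechet_derivative (\<lambda>y. \<eta> y 1) (at z) \<i>
                     + wedge (times_dt w) \<eta> z)"

definition Z1 :: "complex set \<Rightarrow> (complex \<Rightarrow> complex) \<Rightarrow> form1 set" where
  "Z1 T w = {\<eta> \<in> E1 T. \<forall>z\<in>T. nabla1 w \<eta> z = 0}"

definition Z1c :: "complex set \<Rightarrow> (complex \<Rightarrow> complex) \<Rightarrow> form1 set" where
  "Z1c T w = {\<eta> \<in> E1c T. \<forall>z\<in>T. nabla1 w \<eta> z = 0}"

text \<open>Cohomologous cocycles. Equality of forms is only required on \<open>T\<close>.\<close>

definition cohom :: "complex set \<Rightarrow> (complex \<Rightarrow> complex) \<Rightarrow> (form1 \<times> form1) set" where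
  "cohom T w = {(\<eta>, \<theta>). \<eta> \<in> Z1 T w \<and> \<theta> \<in> Z1 T w \<and>
     (\<exists>g\<in>E0 T. \<forall>z\<in>T. \<forall>v. \<eta> z v - \<theta> z v = nabla0 w g z v)}"

definition cohomc :: "complex set \<Rightarrow> (complex \<Rightarrow> complex) \<Rightarrow> (form1 \<times> form1) set" where
  "cohomc T w = {(\<eta>, \<theta>). \<eta> \<in> Z1c T w \<and> \<theta> \<in> Z1c T w \<and>
     (\<exists>g\<in>E0c T. \<forall>z\<in>T. \<forall>v. \<eta> z v - \<theta> z v = nabla0 w g z v)}"

definition H1 :: "complex set \<Rightarrow> (complex \<Rightarrow> complex) \<Rightarrow> form1 set set" where
  "H1 T w = Z1 T w // cohom T w"

definition H1c :: "complex set \<Rightarrow> (complex \<Rightarrow> complex) \<Rightarrow> form1 set set" where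
  "H1c T w = Z1c T w // cohomc T w"

definition cohom_class :: "complex set \<Rightarrow> (complex \<Rightarrow> complex) \<Rightarrow> form1 \<Rightarrow> form1 set" where
  "cohom_class T w \<eta> = cohom T w `` {\<eta>}"

text \<open>The natural map sends the class of a compactly supported cocycle to its class in \<open>H1\<close>.\<close>

definition natural_map ::
  "complex set \<Rightarrow> (complex \<Rightarrow> complex) \<Rightarrow> form1 set \<Rightarrow> form1 set" where
  "natural_map T w X = cohom T w `` X"

definition jmath :: "complex set \<Rightarrow> (complex \<Rightarrow> complex) \<Rightarrow> form1 set \<Rightarrow> form1 set" where
  "jmath T w = inv_into (H1c T w) (natural_map T w)"

text \<open>
  The intersection form of a class for \<open>w\<close> and a class for \<open>- w\<close>. By Stokes' theorem the integral
  does not depend on the representatives. The plane has its standard orientation, so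
  \<open>dx \<and> dy\<close> integrates as Lebesgue measure.
\<close>

definition intersection_form ::
  "complex set \<Rightarrow> (complex \<Rightarrow> complex) \<Rightarrow> form1 set \<Rightarrow> form1 set \<Rightarrow> complex" where
  "intersection_form T w \<Psi> \<Psi>' =
     (LINT z:T|lborel. wedge (SOME \<eta>. \<eta> \<in> jmath T w \<Psi>) (SOME \<theta>. \<theta> \<in> \<Psi>') z)"

subsection \<open>Intersection matrices\<close>

definition pt :: "nat \<Rightarrow> (nat \<Rightarrow> complex) \<Rightarrow> nat \<Rightarrow> complex" where
  "pt m x i = (if i = 0 then 0 else if i = m + 1 then 1 else x i)"

definition expo ::
  "nat \<Rightarrow> complex \<Rightarrow> (nat \<Rightarrow> complex) \<Rightarrow> complex \<Rightarrow> nat \<Rightarrow> complex" where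
  "expo m a b c i =
     (if i = 0 then - c + (\<Sum>j\<in>{1..m}. b j)
      else if i \<le> m then - b i
      else if i = m + 1 then c - a
      else a)"

definition Tx :: "nat \<Rightarrow> (nat \<Rightarrow> complex) \<Rightarrow> complex set" where
  "Tx m x = - (pt m x ` {0..m + 1})"

text \<open>
  The coefficient of \<open>dt\<close> in \<open>\<omega> = d log u\<^sub>x\<close>, where \<open>u\<^sub>x(t) = \<Prod>i\<le>m+1. (t - x\<^sub>i) ^ expo i\<close> is
  multivalued but \<open>\<omega>\<close> is single-valued.
\<close>

definition omega_x ::
  "nat \<Rightarrow> complex \<Rightarrow> (nat \<Rightarrow> complex) \<Rightarrow> complex \<Rightarrow> (nat \<Rightarrow> complex) \<Rightarrow> complex \<Rightarrow> complex" where
  "omega_x m a b c x t = (\<Sum>i\<in>{0..m + 1}. expo m a b c i / (t - pt m x i))"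

text \<open>\<open>I_c\<close> of the classes of the forms \<open>g(t) dt\<close> and \<open>h(t) dt\<close>.\<close>

definition Ic ::
  "nat \<Rightarrow> complex \<Rightarrow> (nat \<Rightarrow> complex) \<Rightarrow> complex \<Rightarrow> (nat \<Rightarrow> complex) \<Rightarrow>
   (complex \<Rightarrow> complex) \<Rightarrow> (complex \<Rightarrow> complex) \<Rightarrow> complex" where
  "Ic m a b c x g h = intersection_form (Tx m x) (omega_x m a b c x)
     (cohom_class (Tx m x) (omega_x m a b c x) (times_dt g))
     (cohom_class (Tx m x) (\<lambda>t. - omega_x m a b c x t) (times_dt h))"

definition phi :: "(nat \<Rightarrow> complex) \<Rightarrow> nat \<Rightarrow> complex \<Rightarrow> complex" where
  "phi x j t = (if j = 0 then 1 / (t - 1) else 1 / (t - 1) - 1 / (t - x j))"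

definition C_mat ::
  "nat \<Rightarrow> complex \<Rightarrow> (nat \<Rightarrow> complex) \<Rightarrow> complex \<Rightarrow> (nat \<Rightarrow> complex) \<Rightarrow> complex mat" where
  "C_mat m a b c x = mat (m + 1) (m + 1) (\<lambda>(i, j). Ic m a b c x (phi x i) (phi x j))"

definition Q_mat ::
  "nat \<Rightarrow> nat \<Rightarrow> complex \<Rightarrow> (nat \<Rightarrow> complex) \<Rightarrow> complex \<Rightarrow> (nat \<Rightarrow> complex) \<Rightarrow> complex mat" where
  "Q_mat m l a b c x = mat (m + 1) (m + 1)
     (\<lambda>(i, j). Ic m a b c x (\<lambda>t. (t - pt m x l) * phi x i t) (phi x j))"

text \<open>Unspecified for singular matrices.\<close>

definition inv_mat :: "complex mat \<Rightarrow> complex mat" where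
  "inv_mat A = the (mat_inverse A)"

definition D_a ::
  "nat \<Rightarrow> complex \<Rightarrow> (nat \<Rightarrow> complex) \<Rightarrow> complex \<Rightarrow> (nat \<Rightarrow> complex) \<Rightarrow> complex mat" where
  "D_a m a b c x = (1 / (a - c)) \<cdot>\<^sub>m (Q_mat m (m + 1) a b c x * inv_mat (C_mat m a b c x))"

definition D_c ::
  "nat \<Rightarrow> complex \<Rightarrow> (nat \<Rightarrow> complex) \<Rightarrow> complex \<Rightarrow> (nat \<Rightarrow> complex) \<Rightarrow> complex mat" where
  "D_c m a b c x =
     (c - a - 1) \<cdot>\<^sub>m (Q_mat m 0 (a + 1) b c x * inv_mat (Q_mat m (m + 1) (a + 1) b c x))"

definition D_b ::
  "nat \<Rightarrow> nat \<Rightarrow> complex \<Rightarrow> (nat \<Rightarrow> complex) \<Rightarrow> complex \<Rightarrow> (nat \<Rightarrow> complex) \<Rightarrow> complex mat" where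
  "D_b m l a b c x = (1 / (1 - b l)) \<cdot>\<^sub>m
     (Q_mat m l (a + 1) b (c + 1) x * inv_mat (Q_mat m 0 (a + 1) b (c + 1) x))"

end

theory Submission
  imports Defs "Jordan_Normal_Form.Determinant"
begin

text \<open>
  Intersection numbers. Near a puncture \<open>p\<close>, and near infinity, \<open>\<nabla> \<psi> = \<phi>\<close> has a unique holomorphic
  solution for a logarithmic form \<open>\<phi>\<close>, because the exponent is not an integer; its value at \<open>p\<close> is the
  residue of \<open>\<phi>\<close> divided by the exponent. Gluing these solutions with cutoff functions gives a
  compactly supported representative \<open>\<eta>\<close> of the class of \<open>\<phi>\<close>. Any primitive of \<open>\<phi> - \<eta>\<close> agrees with
  the local solutions away from the support of \<open>\<eta>\<close>, so Stokes' theorem with cutoffs that shrink to the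
  punctures turns \<open>\<integral> \<eta> \<and> \<phi>'\<close> into
  \<open>2 \<pi> \<i> (\<Sum>\<^sub>p r\<^sub>p \<rho>\<^sub>p / \<alpha>\<^sub>p - (\<Sum>\<^sub>p r\<^sub>p) (\<Sum>\<^sub>p \<rho>\<^sub>p) / \<Sum>\<^sub>p \<alpha>\<^sub>p)\<close>, where \<open>r\<close> and \<open>\<rho>\<close> are the residues.
  In cohomology, multiplication by \<open>t - x\<^sub>l\<close> acts on the basis \<open>\<phi>\<^sub>0, \<dots>, \<phi>\<^sub>m\<close> through an explicit matrix
  \<open>N\<^sub>l\<close>, hence \<open>Q\<^sub>l = N\<^sub>l C\<close>, and the matrices of the theorem are quotients of the \<open>N\<^sub>l\<close>.

  Series. Indexed by the exponent vector \<open>e\<close> of the monomial instead of \<open>n\<close>, the coefficient becomes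
  \<open>1 / (\<Gamma>(1 - a - \<bar>e\<bar>) \<Gamma>(c + \<bar>e\<bar>) \<Prod>\<^sub>l \<Gamma>(1 + e\<^sub>l) \<Gamma>(1 - b\<^sub>l - e\<^sub>l))\<close>
  for every \<open>k\<close>, and it vanishes on the rest of the coset \<open>e + \<int>\<^sup>m\<close>. Recurrences of the coefficients
  therefore become relations between the series without boundary terms, and these give the action
  of \<open>N\<^sub>l\<close> on \<open>F\<^sup>(\<^sup>k\<^sup>)\<close>.
\<close>

text \<open>The matrices \<open>N_l\<close> come from a single exact form. Multiplying \<phi>_i with
  i \<ge> 1 by t - x_l leaves it logarithmic, because \<phi>_i has no pole at infinity; but (t -
  x_l) \<phi>_0 contains dt, which has a double pole there. Since t w(t) tends to -a at infinity,
  where \<omega> = w dt, the exact form (1 + t w) dt, the twisted differential of t, equals (1 - a)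
  dt plus a logarithmic form. Subtracting it divided by 1 - a removes the double pole, and this is
  the source of every division by 1 - a. On the series side, with F = F(a, b, c), the matrices act
  by N_{m+1} F = (a - c) F(a-1, b, c), N_0 F = - F(a-1, b, c-1) and N_l F = - (1 - b_l) F(a-1, b -
  e_l, c-1). Each lowers a by one. A step in a alone is therefore one of these formulas, while a
  step in c or b_l alone is a quotient of two of them taken at a + 1, for b_l also at c + 1; this
  explains the shifted arguments in the last two matrices.\<close>

section \<open>Smooth functions on open subsets of the plane\<close>

lemma Ck_on_Suc_D:
  assumes "Ck_on (Suc n) S f"
  shows "Ck_on n S f"
  using assms
proof (induction n arbitrary: f)
  case 0
  have "f differentiable_on S"
    using 0 unfolding Ck_on.simps differentiable_on_def by (meson differentiable_at_withinI)
  then show ?case unfolding Ck_on.simps by (rule differentiable_imp_continuous_on)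
next
  case (Suc n)
  note P = Suc.prems[unfolded Ck_on.simps(2)[of "Suc n"]]
  have "Ck_on n S (\<lambda>z. frechet_derivative f (at z) v)" if "v \<in> {1, \<i>}" for v
    by (rule Suc.IH) (use P that in blast)
  with P show ?case unfolding Ck_on.simps(2)[of n] by blast
qed

text \<open>\<open>frechet_derivative\<close> is a choice among all derivatives at the point, so it
  suffices that both functions admit the same ones; points without a derivative are covered as
  well.\<close>

lemma frechet_derivative_cong_open:
  assumes "open S" "z \<in> S" "\<And>y. y \<in> S \<Longrightarrow> f y = g y"
  shows "frechet_derivative f (at z) = frechet_derivative g (at z)"
proof -
  have "(f has_derivative D) (at z) \<longleftrightarrow> (g has_derivative D) (at z)" for D
    using has_derivative_transform_within_open[OF _ assms(1,2), of f D UNIV g]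
      has_derivative_transform_within_open[OF _ assms(1,2), of g D UNIV f] assms(3) by metis
  then show ?thesis unfolding frechet_derivative_def by presburger
qed

lemma Ck_on_cong:
  assumes "open S" "\<And>y. y \<in> S \<Longrightarrow> f y = g y"
  shows "Ck_on n S f \<longleftrightarrow> Ck_on n S g"
  using assms(2)
proof (induction n arbitrary: f g)
  case 0
  then show ?case by (simp cong: continuous_on_cong)
next
  case (Suc n)
  have d: "(f has_derivative D) (at z) \<longleftrightarrow> (g has_derivative D) (at z)" if "z \<in> S" for z D
    using has_derivative_transform_within_open[OF _ assms(1) that, of f D UNIV g]
      has_derivative_transform_within_open[OF _ assms(1) that, of g D UNIV f] Suc.prems by metis
  have "Ck_on n S (\<lambda>z. frechet_derivative f (at z) v) \<longleftrightarrow> Ck_on n S (\<lambda>z. frechet_derivative g (at z) v)" for v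
    by (rule Suc.IH, subst frechet_derivative_cong_open[OF assms(1) _ Suc.prems]) auto
  with d show ?case unfolding Ck_on.simps(2) differentiable_def by blast
qed

lemma Ck_on_subset: "Ck_on n S f \<Longrightarrow> T \<subseteq> S \<Longrightarrow> Ck_on n T f"
  by (induction n arbitrary: f) (auto intro: continuous_on_subset)

lemma Ck_on_Un:
  assumes "open S" "open T" "Ck_on n S f" "Ck_on n T f"
  shows "Ck_on n (S \<union> T) f"
  using assms(3,4) by (induction n arbitrary: f) (auto intro: continuous_on_open_Un assms)

lemma frechet_derivative_unique: "(f has_derivative f') (at z) \<Longrightarrow> frechet_derivative f (at z) = f'"
  using frechet_derivative_at by fastforce

text \<open>The derivative enters as an explicit family \<open>D\<close>, so that the rules for
  products, inverses and compositions apply before any \<open>frechet_derivative\<close> has to be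
  evaluated.\<close>

lemma Ck_on_SucI:
  assumes "open S" "\<And>z. z \<in> S \<Longrightarrow> (f has_derivative D z) (at z)"
    and "Ck_on n S (\<lambda>z. D z 1)" "Ck_on n S (\<lambda>z. D z \<i>)"
  shows "Ck_on (Suc n) S f"
proof -
  have "Ck_on n S (\<lambda>z. frechet_derivative f (at z) v) \<longleftrightarrow> Ck_on n S (\<lambda>z. D z v)" for v
    by (rule Ck_on_cong) (auto simp: assms(1) frechet_derivative_unique[OF assms(2)])
  with assms show ?thesis by (auto simp: differentiable_def)
qed

lemma Ck_on_has_derivative:
  assumes "Ck_on (Suc n) S f" "z \<in> S"
  shows "(f has_derivative frechet_derivative f (at z)) (at z)"
  using assms by (simp add: frechet_derivative_works)

lemma Ck_on_const [simp]: "Ck_on n S (\<lambda>z. c)"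
proof (induction n arbitrary: c)
  case (Suc n)
  then show ?case by simp
qed simp

lemma Ck_on_add:
  assumes "open S" "Ck_on n S f" "Ck_on n S g"
  shows "Ck_on n S (\<lambda>z. f z + g z)"
  using assms(2,3)
proof (induction n arbitrary: f g)
  case 0
  then show ?case by (simp add: continuous_on_add)
next
  case (Suc n)
  show ?case
    by (rule Ck_on_SucI[OF assms(1) has_derivative_add[OF Ck_on_has_derivative Ck_on_has_derivative]])
       (use Suc in auto)
qed

lemma Ck_on_mult:
  assumes "open S" "Ck_on n S f" "Ck_on n S g"
  shows "Ck_on n S (\<lambda>z. f z * g z)"
  using assms(2,3)
proof (induction n arbitrary: f g)
  case 0
  then show ?case by (simp add: continuous_on_mult)
next
  case (Suc n)
  note D = Suc.prems[THEN Ck_on_Suc_D]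
  show ?case
    by (rule Ck_on_SucI[OF assms(1) has_derivative_mult[OF Ck_on_has_derivative Ck_on_has_derivative]])
       (use Suc.prems D in \<open>auto intro!: Ck_on_add[OF assms(1)] Suc.IH\<close>)
qed

lemma smooth_on_const [simp]: "smooth_on S (\<lambda>z. c)"
  by (simp add: smooth_on_def)

lemma smooth_on_add: "open S \<Longrightarrow> smooth_on S f \<Longrightarrow> smooth_on S g \<Longrightarrow> smooth_on S (\<lambda>z. f z + g z)"
  by (simp add: smooth_on_def Ck_on_add)

lemma smooth_on_mult: "open S \<Longrightarrow> smooth_on S f \<Longrightarrow> smooth_on S g \<Longrightarrow> smooth_on S (\<lambda>z. f z * g z)"
  by (simp add: smooth_on_def Ck_on_mult)

lemma smooth_on_diff: "open S \<Longrightarrow> smooth_on S f \<Longrightarrow> smooth_on S g \<Longrightarrow> smooth_on S (\<lambda>z. f z - g z)"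
  using smooth_on_add[of S f "\<lambda>z. (-1) * g z"] smooth_on_mult[of S "\<lambda>_. -1" g] by simp

lemma smooth_on_sum:
  assumes "open S" "\<And>i. i \<in> I \<Longrightarrow> smooth_on S (f i)"
  shows "smooth_on S (\<lambda>z. \<Sum>i\<in>I. f i z)"
  using assms(2) by (induction I rule: infinite_finite_induct) (auto intro: smooth_on_add assms(1))

lemma smooth_on_cong:
  assumes "open S" "\<And>y. y \<in> S \<Longrightarrow> f y = g y"
  shows "smooth_on S f \<longleftrightarrow> smooth_on S g"
  using Ck_on_cong[OF assms] by (simp add: smooth_on_def)

lemma smooth_on_subset: "smooth_on S f \<Longrightarrow> T \<subseteq> S \<Longrightarrow> smooth_on T f"
  by (auto simp: smooth_on_def intro: Ck_on_subset)

lemma smooth_on_Un: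
  "open S \<Longrightarrow> open T \<Longrightarrow> smooth_on S f \<Longrightarrow> smooth_on T f \<Longrightarrow> smooth_on (S \<union> T) f"
  by (auto simp: smooth_on_def intro: Ck_on_Un)

lemma smooth_on_differentiable: "smooth_on S f \<Longrightarrow> z \<in> S \<Longrightarrow> f differentiable (at z)"
  unfolding smooth_on_def by (metis Ck_on.simps(2))

lemma smooth_on_has_derivative:
  "smooth_on S f \<Longrightarrow> z \<in> S \<Longrightarrow> (f has_derivative frechet_derivative f (at z)) (at z)"
  using smooth_on_differentiable frechet_derivative_works by blast

lemma smooth_on_continuous: "smooth_on S f \<Longrightarrow> continuous_on S f"
  unfolding smooth_on_def by (metis Ck_on.simps(1))

lemma smooth_on_frechet_derivative:
  "smooth_on S f \<Longrightarrow> v \<in> {1, \<i>} \<Longrightarrow> smooth_on S (\<lambda>z. frechet_derivative f (at z) v)"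
  unfolding smooth_on_def by (metis Ck_on.simps(2))

lemma Ck_on_holomorphic:
  assumes "open S" "f holomorphic_on S"
  shows "Ck_on n S f"
  using assms(2)
proof (induction n arbitrary: f)
  case 0
  then show ?case by (simp add: holomorphic_on_imp_continuous_on)
next
  case (Suc n)
  show ?case
  proof (rule Ck_on_SucI[OF assms(1)])
    show "(f has_derivative (*) (deriv f z)) (at z)" if "z \<in> S" for z
      using holomorphic_derivI[OF Suc.prems assms(1) that] by (simp add: has_field_derivative_def)
    have "deriv f holomorphic_on S" using Suc.prems assms(1) by (rule holomorphic_deriv)
    then show "Ck_on n S (\<lambda>z. deriv f z * 1)" "Ck_on n S (\<lambda>z. deriv f z * \<i>)"
      by (auto intro!: Suc.IH holomorphic_intros)
  qed
qed

lemma smooth_on_holomorphic: "open S \<Longrightarrow> f holomorphic_on S \<Longrightarrow> smooth_on S f"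
  by (simp add: smooth_on_def Ck_on_holomorphic)

lemma smooth_on_of_real_linear:
  assumes "bounded_linear L"
  shows "smooth_on UNIV (\<lambda>z. of_real (L z))"
proof -
  have "Ck_on n UNIV (\<lambda>z. of_real (L z))" for n
  proof (cases n)
    case 0
    then show ?thesis using assms by (auto intro!: continuous_intros linear_continuous_on)
  next
    case (Suc k)
    have "((\<lambda>z. complex_of_real (L z)) has_derivative (\<lambda>z. of_real (L z))) (at z)" for z
      by (intro has_derivative_of_real bounded_linear_imp_has_derivative assms)
    then show ?thesis unfolding Suc by (intro Ck_on_SucI) auto
  qed
  then show ?thesis by (simp add: smooth_on_def)
qed

text \<open>The norm is not smooth at \<open>p\<close>, but its square is a polynomial in the real
  and imaginary parts.\<close>

lemma smooth_on_norm_square: "smooth_on UNIV (\<lambda>z. of_real ((norm (z - p))\<^sup>2))"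
proof -
  have *: "(\<lambda>z. complex_of_real ((norm (z - p))\<^sup>2)) = (\<lambda>z. (of_real (Re z) - of_real (Re p)) * (of_real (Re z) - of_real (Re p))
     + (of_real (Im z) - of_real (Im p)) * (of_real (Im z) - of_real (Im p)))"
    unfolding cmod_power2 by (auto simp: power2_eq_square)
  then show ?thesis
    unfolding * by (intro smooth_on_add smooth_on_mult smooth_on_diff smooth_on_of_real_linear bounded_linear_Re bounded_linear_Im open_UNIV smooth_on_const)
qed

lemma Ck_on_inverse:
  assumes "open S" "Ck_on n S f" "\<And>z. z \<in> S \<Longrightarrow> f z \<noteq> 0"
  shows "Ck_on n S (\<lambda>z. inverse (f z))"
  using assms(2)
proof (induction n)
  case 0
  then show ?case using assms by (auto intro: continuous_on_inverse)
next
  case (Suc n)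
  have 1: "Ck_on n S (\<lambda>z. inverse (f z))"
    using Suc Ck_on_Suc_D by blast
  have 2: "Ck_on n S (\<lambda>z. (-1) * (inverse (f z) * frechet_derivative f (at z) v * inverse (f z)))" if "v \<in> {1, \<i>}" for v
    using Suc.prems that by (intro Ck_on_mult assms(1) Ck_on_const 1) auto
  show ?case
  proof (rule Ck_on_SucI[OF assms(1)])
    show "((\<lambda>z. inverse (f z)) has_derivative (\<lambda>h. - (inverse (f z) * frechet_derivative f (at z) h * inverse (f z)))) (at z)"
      if "z \<in> S" for z
      using Deriv.has_derivative_inverse[OF assms(3)[OF that] Ck_on_has_derivative[OF Suc.prems that]] .
  qed (use 2 in auto)
qed

lemma smooth_on_inverse:
  "open S \<Longrightarrow> smooth_on S f \<Longrightarrow> (\<And>z. z \<in> S \<Longrightarrow> f z \<noteq> 0) \<Longrightarrow> smooth_on S (\<lambda>z. inverse (f z))"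
  by (simp add: smooth_on_def Ck_on_inverse)

section \<open>A smooth cutoff function\<close>

text \<open>The function exp(-1/x), continued by 0. The polynomial factor in 1/x makes the family
  closed under differentiation, so that smoothness becomes an induction with \<open>P\<close>
  arbitrary.\<close>

definition flat :: "real poly \<Rightarrow> real \<Rightarrow> real" where
  "flat P x = (if x > 0 then poly P (1 / x) * exp (- (1 / x)) else 0)"

text \<open>The derivative of P(1/x) exp(-1/x) is x^(-2) (P - P')(1/x) exp(-1/x); the monomial
  stands for x^(-2).\<close>

definition flat_deriv :: "real poly \<Rightarrow> real poly" where
  "flat_deriv P = monom 1 2 * (P - pderiv P)"

lemma poly_mult_exp_minus_tendsto_0: "((\<lambda>y. poly P y * exp (- y)) \<longlongrightarrow> (0::real)) at_top"
proof (induction P)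
  case (pCons a P)
  have "((\<lambda>y. a * exp (- y) + (y * poly P y * exp(-y))) \<longlongrightarrow> a * 0 + 0) at_top"
  proof (intro tendsto_add tendsto_mult tendsto_const)
    show "((\<lambda>y::real. exp (- y)) \<longlongrightarrow> 0) at_top"
      by (rule filterlim_compose[OF exp_at_bot filterlim_uminus_at_bot_at_top])
    have "((\<lambda>y. \<Sum>i\<le>degree P. coeff P i * (y ^ Suc i / exp y)) \<longlongrightarrow> (\<Sum>i\<le>degree P. coeff P i * 0)) at_top"
      by (intro tendsto_sum tendsto_mult tendsto_const tendsto_power_div_exp_0)
    then show "((\<lambda>y. y * poly P y * exp (- y)) \<longlongrightarrow> 0) at_top"
      by (simp add: poly_altdef sum_distrib_left sum_distrib_right exp_minus divide_inverse mult_ac)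
  qed
  then show ?case by (simp add: algebra_simps)
qed simp

lemma flat_tendsto_0: "((\<lambda>x. poly P (1 / x) * exp (- (1 / x))) \<longlongrightarrow> (0::real)) (at_right 0)"
  using filterlim_compose[OF poly_mult_exp_minus_tendsto_0 filterlim_inverse_at_top_right]
  by (simp add: divide_inverse)

lemma flat_has_derivative: "(flat P has_real_derivative flat (flat_deriv P) x) (at x)"
proof -
  consider "x > 0" | "x < 0" | "x = 0" by linarith
  then show ?thesis
  proof cases
    case 1
    have inv: "((\<lambda>x. 1 / x) has_real_derivative - 1 / x\<^sup>2) (at x)"
      using 1 by (auto intro!: derivative_eq_intros simp: power2_eq_square)
    have "((\<lambda>x. poly P (1 / x)) has_real_derivative poly (pderiv P) (1/x) * (- 1 / x\<^sup>2)) (at x)"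
      by (rule DERIV_chain2[OF poly_DERIV inv])
    moreover have "((\<lambda>x. exp (- (1 / x))) has_real_derivative exp (-(1/x)) * (1 / x\<^sup>2)) (at x)"
      using DERIV_chain2[OF DERIV_exp DERIV_minus[OF inv]] by simp
    ultimately have "((\<lambda>x. poly P (1 / x) * exp (- (1 / x))) has_real_derivative
       poly (pderiv P) (1/x) * (- 1 / x\<^sup>2) * exp (-(1/x)) + exp (-(1/x)) * (1 / x\<^sup>2) * poly P (1/x)) (at x)"
      by (rule DERIV_mult)
    moreover have "flat (flat_deriv P) x = poly (pderiv P) (1/x) * (- 1 / x\<^sup>2) * exp (-(1/x)) + exp (-(1/x)) * (1 / x\<^sup>2) * poly P (1/x)"
      using 1 by (simp add: flat_def flat_deriv_def poly_monom power_divide algebra_simps)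
    ultimately have "((\<lambda>x. poly P (1 / x) * exp (- (1 / x))) has_real_derivative flat (flat_deriv P) x) (at x)" by simp
    then show ?thesis
      by (rule has_field_derivative_transform_within_open[of _ _ _ "{0<..}"]) (use 1 in \<open>auto simp: flat_def\<close>)
  next
    case 2
    have "((\<lambda>x. 0) has_real_derivative 0) (at x)" by simp
    then show ?thesis
      using has_field_derivative_transform_within_open[of "\<lambda>x. 0" 0 x "{..<0}" "flat P"] 2
      by (auto simp: flat_def)
  next
    case 3
    have "((\<lambda>h. flat P h / h) \<longlongrightarrow> 0) (at 0)"
      unfolding filterlim_at_split
    proof
      have "((\<lambda>h::real. 0) \<longlongrightarrow> (0::real)) (at_left 0)" by simp
      then show "((\<lambda>h. flat P h / h) \<longlongrightarrow> 0) (at_left 0)"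
        by (rule Lim_transform_eventually) (auto simp: flat_def eventually_at_filter)
      \<comment> \<open>Division by h multiplies the polynomial in 1/h by its variable, that is,
        replaces \<open>P\<close> by \<open>pCons 0 P\<close>.\<close>
      show "((\<lambda>h. flat P h / h) \<longlongrightarrow> 0) (at_right 0)"
        using flat_tendsto_0[of "pCons 0 P"]
        by (rule Lim_transform_eventually) (auto simp: flat_def eventually_at_filter)
    qed
    then show ?thesis using 3 by (simp add: DERIV_def flat_def)
  qed
qed

lemma smooth_on_flat:
  assumes "smooth_on UNIV (\<lambda>z. of_real (\<rho> z))"
  shows "smooth_on UNIV (\<lambda>z. of_real (flat P (\<rho> z)))"
proof -
  let ?r = "\<lambda>z. complex_of_real (\<rho> z)"
  have rd: "(\<rho> has_derivative (\<lambda>v. Re (frechet_derivative ?r (at z) v))) (at z)" for z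
    using has_derivative_Re[OF smooth_on_has_derivative[OF assms, of z]] by simp
  \<comment> \<open>The derivative of the complex copy of a real function has real values. This
    passes between the chain rule over the reals and \<open>Ck_on\<close>, which is stated for
    complex values.\<close>
  have fr: "frechet_derivative ?r (at z) v = of_real (Re (frechet_derivative ?r (at z) v))" for z v
  proof -
    have "(?r has_derivative (\<lambda>v. of_real (Re (frechet_derivative ?r (at z) v)))) (at z)"
      by (rule has_derivative_of_real[OF rd])
    from fun_cong[OF frechet_derivative_unique[OF this], of v] show ?thesis .
  qed
  have "Ck_on n UNIV (\<lambda>z. of_real (flat P (\<rho> z)))" for n
  proof (induction n arbitrary: P)
    case 0
    have "continuous_on UNIV \<rho>" by (rule continuous_at_imp_continuous_on) (use has_derivative_continuous[OF rd] in auto)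
    moreover have "continuous_on UNIV (flat P)"
      by (rule continuous_at_imp_continuous_on) (use DERIV_isCont[OF flat_has_derivative] in auto)
    ultimately have "continuous_on UNIV (\<lambda>z. flat P (\<rho> z))" using continuous_on_compose2[of UNIV "flat P" UNIV \<rho>] by simp
    then show ?case by (simp add: continuous_on_of_real)
  next
    case (Suc n)
    have d: "((\<lambda>z. complex_of_real (flat P (\<rho> z))) has_derivative
      (\<lambda>v. of_real (flat (flat_deriv P) (\<rho> z)) * frechet_derivative ?r (at z) v)) (at z)" for z
    proof -
      have "((\<lambda>z. flat P (\<rho> z)) has_derivative (\<lambda>v. flat (flat_deriv P) (\<rho> z) * Re (frechet_derivative ?r (at z) v))) (at z)"
        using has_derivative_compose[OF rd, of "flat P"] flat_has_derivative[of P "\<rho> z"] by (simp add: has_field_derivative_def)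
      from has_derivative_of_real[OF this] have *: "((\<lambda>z. complex_of_real (flat P (\<rho> z))) has_derivative
          (\<lambda>v. of_real (flat (flat_deriv P) (\<rho> z)) * of_real (Re (frechet_derivative ?r (at z) v)))) (at z)"
        by simp
      have "(\<lambda>v. of_real (flat (flat_deriv P) (\<rho> z)) * complex_of_real (Re (frechet_derivative ?r (at z) v)))
          = (\<lambda>v. of_real (flat (flat_deriv P) (\<rho> z)) * frechet_derivative ?r (at z) v)"
        by (rule ext) (simp only: fr[symmetric])
      from *[unfolded this] show ?thesis .
    qed
    have "Ck_on n UNIV (\<lambda>z. of_real (flat (flat_deriv P) (\<rho> z)) * frechet_derivative ?r (at z) v)" if "v \<in> {1, \<i>}" for v
      by (rule Ck_on_mult[OF open_UNIV Suc.IH])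
        (use smooth_on_frechet_derivative[OF assms that] in \<open>simp add: smooth_on_def\<close>)
    then show ?case
      by (intro Ck_on_SucI[OF open_UNIV d]) blast+
  qed
  then show ?thesis by (simp add: smooth_on_def)
qed

definition step_den :: "real \<Rightarrow> real" where
  "step_den x = flat 1 (2 - x) + flat 1 (x - 1)"

text \<open>The usual smooth transition: 1 up to 1 and 0 from 2 on.\<close>

definition step :: "real \<Rightarrow> real" where
  "step x = flat 1 (2 - x) * inverse (step_den x)"

text \<open>The numbers 2 - x and x - 1 have sum 1, so at least one of them is positive.\<close>

lemma step_den_pos: "step_den x > 0"
  by (auto simp: step_den_def flat_def add_pos_pos add_pos_nonneg add_nonneg_pos)

lemma step_eq_1: "x \<le> 1 \<Longrightarrow> step x = 1"
  using step_den_pos[of x] by (simp add: step_def step_den_def flat_def)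

lemma step_eq_0: "x \<ge> 2 \<Longrightarrow> step x = 0"
  by (simp add: step_def flat_def)

lemma smooth_on_step:
  assumes "smooth_on UNIV (\<lambda>z. of_real (\<rho> z))"
  shows "smooth_on UNIV (\<lambda>z. of_real (step (\<rho> z)))"
proof -
  have *: "smooth_on UNIV (\<lambda>z. of_real (2 - \<rho> z))" "smooth_on UNIV (\<lambda>z. of_real (\<rho> z - 1))"
    using smooth_on_diff[OF open_UNIV smooth_on_const assms, of 2] smooth_on_diff[OF open_UNIV assms smooth_on_const, of 1]
    by auto
  have "smooth_on UNIV (\<lambda>z. of_real (step_den (\<rho> z)))"
    unfolding step_den_def of_real_add
    by (rule smooth_on_add[OF open_UNIV smooth_on_flat[OF *(1)] smooth_on_flat[OF *(2)]])
  moreover have "complex_of_real (step_den (\<rho> z)) \<noteq> 0" for z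
    using step_den_pos[of "\<rho> z"] by simp
  ultimately have "smooth_on UNIV (\<lambda>z. inverse (of_real (step_den (\<rho> z))))"
    by (intro smooth_on_inverse) auto
  from smooth_on_mult[OF open_UNIV smooth_on_flat[OF *(1)] this] show ?thesis
    unfolding step_def of_real_mult of_real_inverse .
qed

definition step' :: "real \<Rightarrow> real" where
  "step' x = (- flat (flat_deriv 1) (2 - x) * step_den x
     - flat 1 (2 - x) * (- flat (flat_deriv 1) (2 - x) + flat (flat_deriv 1) (x - 1))) / (step_den x * step_den x)"

lemma step_has_derivative: "(step has_real_derivative step' x) (at x)"
proof -
  have d1: "((\<lambda>x. flat 1 (2 - x)) has_real_derivative - flat (flat_deriv 1) (2 - x)) (at x)" for x
  proof -
    have "((\<lambda>x. 2 - x) has_real_derivative -1) (at x)" by (auto intro!: derivative_eq_intros)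
    from DERIV_chain2[OF flat_has_derivative this] show ?thesis by simp
  qed
  have d2: "((\<lambda>x. flat 1 (x - 1)) has_real_derivative flat (flat_deriv 1) (x - 1)) (at x)" for x
  proof -
    have "((\<lambda>x. x - 1) has_real_derivative 1) (at x)" by (auto intro!: derivative_eq_intros)
    from DERIV_chain2[OF flat_has_derivative this] show ?thesis by simp
  qed
  have "step_den x \<noteq> 0" using step_den_pos[of x] by simp
  from DERIV_divide[OF d1 DERIV_add[OF d1 d2] this[unfolded step_den_def]]
  show ?thesis
    unfolding step_def step'_def step_den_def divide_inverse[symmetric] .
qed

lemma continuous_on_step': "continuous_on UNIV step'"
proof -
  have c: "continuous_on UNIV (flat P)" for P
    by (rule continuous_at_imp_continuous_on) (use DERIV_isCont[OF flat_has_derivative] in auto)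
  have "continuous_on UNIV (\<lambda>x. flat P (2 - x))" "continuous_on UNIV (\<lambda>x. flat P (x - 1))" for P
    by (rule continuous_on_compose2[OF c]; auto intro!: continuous_intros)+
  moreover have "step_den x \<noteq> 0" for x using step_den_pos[of x] by simp
  ultimately show ?thesis unfolding step'_def [abs_def] step_den_def
    by (intro continuous_intros) auto
qed

lemma step'_eq_0: "x < 1 \<or> x > 2 \<Longrightarrow> step' x = 0"
proof -
  assume *: "x < 1 \<or> x > 2"
  have "(step has_real_derivative 0) (at x)"
  proof (cases "x < 1")
    case True
    then show ?thesis
      using has_field_derivative_transform_within_open[of "\<lambda>x. 1" 0 x "{..<1}" step] by (auto simp: step_eq_1)
  next
    case False
    then show ?thesis
      using has_field_derivative_transform_within_open[of "\<lambda>x. 0" 0 x "{2<..}" step] * by (auto simp: step_eq_0)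
  qed
  with step_has_derivative show ?thesis using DERIV_unique by blast
qed

lemma has_vector_derivative_along_line:
  fixes f :: "complex \<Rightarrow> complex"
  assumes "(f has_derivative D) (at (z + of_real t * v))"
  shows "((\<lambda>t. f (z + of_real t * v)) has_vector_derivative D v) (at t)"
proof -
  have "((\<lambda>t. z + of_real t * v) has_derivative (\<lambda>s. s *\<^sub>R v)) (at t)"
    by (auto intro!: derivative_eq_intros simp: scaleR_conv_of_real)
  from has_derivative_compose[OF this assms] show ?thesis
    using linear_scale[OF has_derivative_linear[OF assms]] by (simp add: has_vector_derivative_def)
qed

text \<open>The mean value inequality along a real parameter; with \<open>B = 0\<close> it says that
  \<phi> has the same value at both ends.\<close>

lemma vector_mvt_bound:
  fixes \<phi> :: "real \<Rightarrow> complex"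
  assumes "0 \<le> h" "\<And>t. 0 \<le> t \<Longrightarrow> t \<le> h \<Longrightarrow> (\<phi> has_vector_derivative \<phi>' t) (at t)"
    and "\<And>t. 0 \<le> t \<Longrightarrow> t \<le> h \<Longrightarrow> norm (\<phi>' t) \<le> B"
  shows "norm (\<phi> h - \<phi> 0) \<le> B * h"
proof -
  have "norm (\<phi> h - \<phi> 0) \<le> B * norm (h - 0)"
  proof (rule differentiable_bound[of "{0..h}" \<phi> "\<lambda>t s. s *\<^sub>R \<phi>' t"])
    show "(\<phi> has_derivative (\<lambda>s. s *\<^sub>R \<phi>' t)) (at t within {0..h})" if "t \<in> {0..h}" for t
      using assms(2)[of t] that by (auto simp: has_vector_derivative_def intro: has_derivative_at_withinI)
    show "onorm (\<lambda>s. s *\<^sub>R \<phi>' t) \<le> B" if "t \<in> {0..h}" for t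
      by (intro onorm_le) (use assms(3)[of t] that in \<open>auto simp: mult.commute[of B] intro!: mult_left_mono\<close>)
  qed (use assms(1) in auto)
  then show ?thesis using assms(1) by simp
qed

section \<open>Symmetry of second derivatives\<close>

text \<open>The mean value inequality is applied twice: \<open>inner\<close> controls the increment
  of the u-derivative over a step h v, and integrating this in direction u gives the second
  difference. The error comes from the continuity at z of the mixed derivative.\<close>

lemma second_difference:
  assumes S: "open S" "z \<in> S" and f: "smooth_on S f" and uv: "u \<in> {1, \<i>}" "v \<in> {1, \<i>}" and "\<epsilon> > 0"
  defines "D \<equiv> frechet_derivative (\<lambda>y. frechet_derivative f (at y) u) (at z) v"
  shows "\<exists>\<delta>>0. \<forall>h. 0 < h \<longrightarrow> h < \<delta> \<longrightarrow>
    norm (f (z + of_real h * u + of_real h * v) - f (z + of_real h * u) - f (z + of_real h * v) + f z - of_real (h\<^sup>2) * D) \<le> \<epsilon> * h\<^sup>2"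
proof -
  define A where "A = (\<lambda>y. frechet_derivative f (at y) u)"
  define B where "B = (\<lambda>y. frechet_derivative A (at y) v)"
  have sA: "smooth_on S A" unfolding A_def by (rule smooth_on_frechet_derivative[OF f uv(1)])
  have sB: "smooth_on S B" unfolding B_def by (rule smooth_on_frechet_derivative[OF sA uv(2)])
  have nuv: "norm u = 1" "norm v = 1" using uv by auto
  have BD: "B z = D" by (simp add: B_def A_def D_def)
  have "isCont B z" using smooth_on_continuous[OF sB] S by (simp add: continuous_on_eq_continuous_at)
  then obtain d1 where d1: "d1 > 0" "\<And>y. dist y z < d1 \<Longrightarrow> dist (B y) (B z) < \<epsilon>"
    using \<open>\<epsilon> > 0\<close> unfolding continuous_at_eps_delta by (metis dist_commute)
  obtain d2 where d2: "d2 > 0" "ball z d2 \<subseteq> S" using S openE by blast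
  \<comment> \<open>All points used have distance at most 2 h from z, which stays below
    \<open>min d1 d2\<close>.\<close>
  define \<delta> where "\<delta> = min d1 d2 / 3"
  have "\<delta> > 0" using d1 d2 by (simp add: \<delta>_def)
  have near: "z + of_real s * u + of_real t * v \<in> S" "norm (B (z + of_real s * u + of_real t * v) - D) \<le> \<epsilon>"
    if "0 \<le> s" "s \<le> h" "0 \<le> t" "t \<le> h" "h < \<delta>" for s t h
  proof -
    have "dist (z + of_real s * u + of_real t * v) z \<le> norm (of_real s * u) + norm (of_real t * v)"
      unfolding dist_norm by (metis add_diff_cancel_left' add.assoc norm_triangle_ineq)
    also have "\<dots> = s + t" using that nuv by (simp add: norm_mult)
    also have "\<dots> < min d1 d2" using that \<open>\<delta> > 0\<close> by (simp add: \<delta>_def)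
    finally have *: "dist (z + of_real s * u + of_real t * v) z < min d1 d2" .
    show "z + of_real s * u + of_real t * v \<in> S" using * d2 by (auto simp: dist_commute subset_iff)
    show "norm (B (z + of_real s * u + of_real t * v) - D) \<le> \<epsilon>" using d1(2)[of "z + of_real s * u + of_real t * v"] * BD by (simp add: dist_norm less_imp_le)
  qed
  show ?thesis
  proof (intro exI[of _ \<delta>] conjI allI impI \<open>\<delta> > 0\<close>)
    fix h :: real assume h: "0 < h" "h < \<delta>"
    have inner: "norm (A (z + of_real s * u + of_real h * v) - A (z + of_real s * u) - of_real h * D) \<le> \<epsilon> * h"
      if s: "0 \<le> s" "s \<le> h" for s
    proof -
      have "norm ((A (z + of_real s * u + of_real h * v) - of_real h * D) - (A (z + of_real s * u + of_real 0 * v) - of_real 0 * D)) \<le> \<epsilon> * h"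
      proof (rule vector_mvt_bound[where \<phi> = "\<lambda>t. A (z + of_real s * u + of_real t * v) - of_real t * D"
            and \<phi>' = "\<lambda>t. B (z + of_real s * u + of_real t * v) - D"])
        fix t :: real assume t: "0 \<le> t" "t \<le> h"
        have "((\<lambda>t. A (z + of_real s * u + of_real t * v)) has_vector_derivative B (z + of_real s * u + of_real t * v)) (at t)"
          unfolding B_def
          by (rule has_vector_derivative_along_line) (rule smooth_on_has_derivative[OF sA near(1)[OF s t h(2)]])
        moreover have "((\<lambda>t. complex_of_real t * D) has_vector_derivative D) (at t)"
          by (auto intro!: derivative_eq_intros simp: has_vector_derivative_def scaleR_conv_of_real)
        ultimately show "((\<lambda>t. A (z + of_real s * u + of_real t * v) - of_real t * D) has_vector_derivative B (z + of_real s * u + of_real t * v) - D) (at t)"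
          by (rule has_vector_derivative_diff)
        show "norm (B (z + of_real s * u + of_real t * v) - D) \<le> \<epsilon>" by (rule near(2)[OF s t h(2)])
      qed (use h in simp)
      then show ?thesis by (simp add: algebra_simps)
    qed
    have "norm ((f (z + of_real h * v + of_real h * u) - f (z + of_real h * u) - of_real h * (of_real h * D)) -
       (f (z + of_real h * v + of_real 0 * u) - f (z + of_real 0 * u) - of_real 0 * (of_real h * D))) \<le> (\<epsilon> * h) * h"
    proof (rule vector_mvt_bound[where \<phi> = "\<lambda>t. f (z + of_real h * v + of_real t * u) - f (z + of_real t * u) - of_real t * (of_real h * D)"
          and \<phi>' = "\<lambda>t. A (z + of_real h * v + of_real t * u) - A (z + of_real t * u) - of_real h * D"])
      fix t :: real assume t: "0 \<le> t" "t \<le> h"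
      have "((\<lambda>t. f (z + of_real h * v + of_real t * u)) has_vector_derivative A (z + of_real h * v + of_real t * u)) (at t)"
        unfolding A_def
        by (rule has_vector_derivative_along_line, rule smooth_on_has_derivative[OF f])
           (use near(1)[OF t, of h] h in \<open>simp add: algebra_simps\<close>)
      moreover have "((\<lambda>t. f (z + of_real t * u)) has_vector_derivative A (z + of_real t * u)) (at t)"
        unfolding A_def
        by (rule has_vector_derivative_along_line, rule smooth_on_has_derivative[OF f])
           (use near(1)[OF t, of 0] h in \<open>simp add: algebra_simps\<close>)
      moreover have "((\<lambda>t. complex_of_real t * (of_real h * D)) has_vector_derivative (of_real h * D)) (at t)"
        by (auto intro!: derivative_eq_intros simp: has_vector_derivative_def scaleR_conv_of_real)
      ultimately show "((\<lambda>t. f (z + of_real h * v + of_real t * u) - f (z + of_real t * u) - of_real t * (of_real h * D))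
          has_vector_derivative A (z + of_real h * v + of_real t * u) - A (z + of_real t * u) - of_real h * D) (at t)"
        by (intro has_vector_derivative_diff)
      show "norm (A (z + of_real h * v + of_real t * u) - A (z + of_real t * u) - of_real h * D) \<le> \<epsilon> * h"
        using inner[OF t] by (simp add: algebra_simps)
    qed (use h in simp)
    then show "norm (f (z + of_real h * u + of_real h * v) - f (z + of_real h * u) - f (z + of_real h * v) + f z - of_real (h\<^sup>2) * D) \<le> \<epsilon> * h\<^sup>2"
      by (simp add: algebra_simps power2_eq_square)
  qed
qed

text \<open>The second difference is symmetric in the two directions, and h^2 times either mixed
  derivative approximates it up to an arbitrarily small multiple of h^2.\<close>

lemma frechet_derivative_symmetric:
  assumes S: "open S" "z \<in> S" and f: "smooth_on S f"
  shows "frechet_derivative (\<lambda>y. frechet_derivative f (at y) 1) (at z) \<i> =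
         frechet_derivative (\<lambda>y. frechet_derivative f (at y) \<i>) (at z) 1" (is "?D = ?E")
proof (rule ccontr)
  assume "?D \<noteq> ?E"
  \<comment> \<open>The two approximations bound the gap by 2 \<epsilon>, which is less than the gap
    itself.\<close>
  define \<epsilon> where "\<epsilon> = norm (?D - ?E) / 3"
  have e: "\<epsilon> > 0" using \<open>?D \<noteq> ?E\<close> by (simp add: \<epsilon>_def)
  obtain d1 where d1: "d1 > 0" "\<And>h. 0 < h \<Longrightarrow> h < d1 \<Longrightarrow>
    norm (f (z + of_real h * 1 + of_real h * \<i>) - f (z + of_real h * 1) - f (z + of_real h * \<i>) + f z - of_real (h\<^sup>2) * ?D) \<le> \<epsilon> * h\<^sup>2"
    using second_difference[OF S f _ _ e, of 1 \<i>] by auto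
  obtain d2 where d2: "d2 > 0" "\<And>h. 0 < h \<Longrightarrow> h < d2 \<Longrightarrow>
    norm (f (z + of_real h * \<i> + of_real h * 1) - f (z + of_real h * \<i>) - f (z + of_real h * 1) + f z - of_real (h\<^sup>2) * ?E) \<le> \<epsilon> * h\<^sup>2"
    using second_difference[OF S f _ _ e, of \<i> 1] by auto
  define h where "h = min d1 d2 / 2"
  have h: "0 < h" "h < d1" "h < d2" using d1 d2 by (auto simp: h_def)
  define X where "X = f (z + of_real h * 1 + of_real h * \<i>) - f (z + of_real h * 1) - f (z + of_real h * \<i>) + f z"
  have 1: "norm (X - of_real (h\<^sup>2) * ?D) \<le> \<epsilon> * h\<^sup>2" using d1(2)[OF h(1,2)] by (simp add: X_def)
  have 2: "norm (X - of_real (h\<^sup>2) * ?E) \<le> \<epsilon> * h\<^sup>2" using d2(2)[OF h(1,3)] by (simp add: X_def algebra_simps)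
  have "norm (of_real (h\<^sup>2) * (?D - ?E)) = norm ((X - of_real (h\<^sup>2) * ?E) - (X - of_real (h\<^sup>2) * ?D))"
    by (simp add: algebra_simps)
  also have "\<dots> \<le> 2 * \<epsilon> * h\<^sup>2" using norm_triangle_ineq4[of "X - of_real (h\<^sup>2) * ?E" "X - of_real (h\<^sup>2) * ?D"] 1 2 by simp
  finally have "h\<^sup>2 * norm (?D - ?E) \<le> h\<^sup>2 * (2 * \<epsilon>)" by (simp add: norm_mult norm_power mult_ac)
  then have "norm (?D - ?E) \<le> 2 * \<epsilon>" using h by (simp add: mult_le_cancel_left)
  then show False using e by (simp add: \<epsilon>_def)
qed

section \<open>Stokes' theorem\<close>

lemma continuous_compact_support_bounded:
  fixes F :: "complex \<Rightarrow> complex"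
  assumes "continuous_on UNIV F" "\<And>z. norm z > R \<Longrightarrow> F z = 0"
  shows "\<exists>M\<ge>0. \<forall>z. norm (F z) \<le> M"
proof -
  have "bounded (F ` cball 0 R)"
    by (intro compact_imp_bounded compact_continuous_image continuous_on_subset[OF assms(1)]) auto
  then obtain M where "\<forall>x\<in>F ` cball 0 R. norm x \<le> M" unfolding bounded_iff by blast
  then have M: "\<And>z. norm z \<le> R \<Longrightarrow> norm (F z) \<le> M" by simp
  have "norm (F z) \<le> max M 0" for z
    using M[of z] assms(2)[of z] by (cases "norm z \<le> R") auto
  then show ?thesis by (intro exI[of _ "max M 0"]) auto
qed

lemma integrable_compact_support:
  fixes F :: "complex \<Rightarrow> complex"
  assumes "continuous_on UNIV F" "\<And>z. norm z > R \<Longrightarrow> F z = 0"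
  shows "integrable lborel F"
proof -
  have "integrable lborel (\<lambda>z. indicator (cball 0 R) z *\<^sub>R F z)"
    by (rule borel_integrable_compact) (auto intro: continuous_on_subset[OF assms(1)])
  moreover have "(\<lambda>z. indicator (cball 0 R) z *\<^sub>R F z) = F" using assms(2) by (auto simp: indicator_def fun_eq_iff)
  ultimately show ?thesis by simp
qed

lemma integral_translate:
  fixes F :: "complex \<Rightarrow> complex"
  assumes "continuous_on UNIV F"
  shows "(LINT z|lborel. F (z + w)) = (LINT z|lborel. F z)"
proof -
  have m: "F \<in> borel_measurable borel" using assms by (rule borel_measurable_continuous_onI)
  have "(LINT z|lborel. F z) = (LINT z|distr lborel borel ((+) w). F z)" by (simp add: lborel_distr_plus)
  also have "\<dots> = (LINT z|lborel. F (w + z))" using m by (subst integral_distr) auto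
  finally show ?thesis by (simp add: add.commute)
qed

text \<open>By translation invariance every difference quotient of \<open>F\<close> has integral 0.
  The quotients converge pointwise to the derivative and are dominated by a constant on a ball, so
  the limit has integral 0 too.\<close>

lemma integral_derivative_eq_0:
  assumes F: "Ck_on 1 UNIV F" "\<And>z. norm z > R \<Longrightarrow> F z = 0" and v: "v \<in> {1, \<i>}"
  shows "integrable lborel (\<lambda>z. frechet_derivative F (at z) v)" "(LINT z|lborel. frechet_derivative F (at z) v) = 0"
proof -
  define G where "G = (\<lambda>z. frechet_derivative F (at z) v)"
  have F1: "Ck_on (Suc 0) UNIV F" using F(1) by simp
  have cG: "continuous_on UNIV G" using F1 v unfolding G_def Ck_on.simps by blast
  have dF: "(F has_derivative frechet_derivative F (at z)) (at z)" for z using F1 by (rule Ck_on_has_derivative) simp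
  have cF: "continuous_on UNIV F" using Ck_on_Suc_D[OF F1] by simp
  have nv: "norm v = 1" using v by auto
  have G0: "G z = 0" if "norm z > R" for z
  proof -
    have "frechet_derivative F (at z) = frechet_derivative (\<lambda>_. 0) (at z)"
      by (rule frechet_derivative_cong_open[of "- cball 0 R"]) (use that F(2) in auto)
    then show ?thesis by (simp add: G_def)
  qed
  show int: "integrable lborel (\<lambda>z. frechet_derivative F (at z) v)"
    using integrable_compact_support[OF cG G0] by (simp add: G_def)
  obtain M where M: "M \<ge> 0" "\<And>z. norm (G z) \<le> M"
    using continuous_compact_support_bounded[OF cG G0] by auto
  \<comment> \<open>The step 1/(n+1) is at most 1, so all quotients vanish outside the ball of
    radius R + 1.\<close>
  define s where "s = (\<lambda>n z. of_nat (Suc n) * (F (z + v / of_nat (Suc n)) - F z))"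
  have mean: "norm (F (z + of_real h * v) - F z) \<le> M * h" if "h \<ge> 0" for z h
  proof -
    have "norm (F (z + of_real h * v) - F (z + of_real 0 * v)) \<le> M * h"
      by (rule vector_mvt_bound[where \<phi> = "\<lambda>t. F (z + of_real t * v)" and \<phi>' = "\<lambda>t. G (z + of_real t * v)"])
        (use that M(2) has_vector_derivative_along_line[where f = F and z = z and v = v, OF dF] in \<open>auto simp: G_def\<close>)
    then show ?thesis by (simp only: of_real_0 mult_zero_left add_0_right)
  qed
  have lim: "(\<lambda>n. s n z) \<longlonglongrightarrow> G z" for z
  proof -
    have "((\<lambda>t. F (z + of_real t * v)) has_vector_derivative G z) (at 0)"
      using has_vector_derivative_along_line[of F "frechet_derivative F (at z)" z 0 v] dF[of z] by (simp add: G_def)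
    then have "((\<lambda>t. norm (F (z + of_real t * v) - F z - t *\<^sub>R G z) / norm t) \<longlongrightarrow> 0) (at 0)"
      by (simp add: has_vector_derivative_def has_derivative_iff_norm)
    then have "((\<lambda>t. norm ((F (z + of_real t * v) - F z) /\<^sub>R t - G z)) \<longlongrightarrow> 0) (at 0)"
    proof (rule Lim_transform_eventually)
      have "norm (a - t *\<^sub>R b) / norm t = norm (a /\<^sub>R t - b)" if "t \<noteq> 0" for t :: real and a b :: complex
      proof -
        have "a /\<^sub>R t - b = (a - t *\<^sub>R b) /\<^sub>R t" using that by (simp add: algebra_simps)
        then show ?thesis by (simp add: divide_inverse mult.commute)
      qed
      then show "\<forall>\<^sub>F t in at 0. norm (F (z + of_real t * v) - F z - t *\<^sub>R G z) / norm t = norm ((F (z + of_real t * v) - F z) /\<^sub>R t - G z)"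
        by (simp add: eventually_at_filter)
    qed
    then have "((\<lambda>t. (F (z + of_real t * v) - F z) /\<^sub>R t) \<longlongrightarrow> G z) (at 0)"
      by (rule LIM_zero_cancel[OF tendsto_norm_zero_cancel])
    moreover have "filterlim (\<lambda>n. 1 / real (Suc n)) (at 0) sequentially"
      using LIMSEQ_inverse_real_of_nat by (simp add: filterlim_at divide_inverse del: of_nat_Suc)
    ultimately have "(\<lambda>n. (F (z + of_real (1 / real (Suc n)) * v) - F z) /\<^sub>R (1 / real (Suc n))) \<longlonglongrightarrow> G z"
      by (rule filterlim_compose)
    then show ?thesis by (simp add: s_def scaleR_conv_of_real)
  qed
  have bd: "norm (s n z) \<le> indicator (cball 0 (R + 1)) z * M" for n z
  proof (cases "norm z \<le> R + 1")
    case True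
    have "norm (s n z) = real (Suc n) * norm (F (z + of_real (1 / real (Suc n)) * v) - F z)"
      by (simp add: s_def norm_mult del: of_nat_Suc)
    also have "\<dots> \<le> real (Suc n) * (M * (1 / real (Suc n)))"
      by (intro mult_left_mono mean) auto
    finally show ?thesis using True by simp
  next
    case False
    have "norm z \<le> norm (z + v / of_nat (Suc n)) + norm (v / of_nat (Suc n))"
      using norm_triangle_ineq4[of "z + v / of_nat (Suc n)" "v / of_nat (Suc n)"] by (simp del: of_nat_Suc)
    moreover have "norm (v / of_nat (Suc n)) \<le> 1" using nv by (simp add: norm_divide del: of_nat_Suc)
    ultimately have "norm (z + v / of_nat (Suc n)) > R" using False by linarith
    then show ?thesis using False F(2) by (simp add: s_def)
  qed
  have contF: "continuous_on UNIV (\<lambda>z. F (z + w))" for w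
    by (rule continuous_on_compose2[OF cF]) (auto intro!: continuous_intros)
  have intF: "integrable lborel (\<lambda>z. F (z + w))" for w
  proof (rule integrable_compact_support[OF contF])
    show "F (z + w) = 0" if "norm z > R + norm w" for z
      using that norm_triangle_ineq4[of "z + w" w] by (intro F(2)) auto
  qed
  have s0: "(LINT z|lborel. s n z) = 0" for n
    unfolding s_def using intF[of 0] intF[of "v / of_nat (Suc n)"] integral_translate[OF cF, of "v / of_nat (Suc n)"]
    by (simp del: of_nat_Suc)
  have "(\<lambda>n. LINT z|lborel. s n z) \<longlonglongrightarrow> (LINT z|lborel. G z)"
  proof (rule integral_dominated_convergence[where w = "\<lambda>z. indicator (cball 0 (R + 1)) z * M"])
    show "integrable lborel (\<lambda>z::complex. indicator (cball 0 (R + 1)) z * M :: real)"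
      by (intro integrable_mult_left integrable_real_indicator) (use emeasure_lborel_cball_finite[of "0::complex" "R + 1"] in auto)
    show "G \<in> borel_measurable lborel" using cG by (simp add: borel_measurable_continuous_onI)
    show "s n \<in> borel_measurable lborel" for n
      unfolding s_def using borel_measurable_continuous_onI[OF contF] borel_measurable_continuous_onI[OF cF] by measurable
  qed (use lim bd in auto)
  then show "(LINT z|lborel. frechet_derivative F (at z) v) = 0"
    using s0 by (simp add: G_def LIMSEQ_const_iff)
qed

text \<open>The extension of \<open>f\<close> by 0 is continuously differentiable on the plane,
  because \<open>T\<close> and the complement of \<open>K\<close> are open, cover the plane, and the
  extension is regular on each.\<close>

lemma stokes:
  assumes T: "open T" and f: "Ck_on 1 T f" and K: "compact K" "K \<subseteq> T" "\<And>z. z \<in> T - K \<Longrightarrow> f z = 0" and v: "v \<in> {1, \<i>}"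
  shows "set_integrable lborel T (\<lambda>z. frechet_derivative f (at z) v)"
    "(LINT z:T|lborel. frechet_derivative f (at z) v) = 0"
proof -
  define F where "F = (\<lambda>z. if z \<in> T then f z else 0)"
  have oK: "open (- K)" using K(1) by (simp add: compact_imp_closed open_Compl)
  have "Ck_on 1 T F" using Ck_on_cong[OF T, of F f] f by (auto simp: F_def)
  moreover have "Ck_on 1 (- K) F"
    using Ck_on_cong[OF oK, of F "\<lambda>_. 0" 1] K(3) by (auto simp: F_def simp del: One_nat_def)
  ultimately have "Ck_on 1 (T \<union> - K) F" by (rule Ck_on_Un[OF T oK])
  moreover have "T \<union> - K = UNIV" using K(2) by auto
  ultimately have F1: "Ck_on 1 UNIV F" by simp
  obtain R where R: "\<And>z. z \<in> K \<Longrightarrow> norm z \<le> R" using compact_imp_bounded[OF K(1)] by (auto simp: bounded_iff)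
  have F0: "F z = 0" if "norm z > R" for z using R[of z] K(3)[of z] that by (auto simp: F_def)
  have eq: "indicator T z *\<^sub>R frechet_derivative f (at z) v = frechet_derivative F (at z) v" for z
  proof (cases "z \<in> T")
    case True
    have "frechet_derivative f (at z) = frechet_derivative F (at z)"
      by (rule frechet_derivative_cong_open[OF T True]) (simp add: F_def)
    then show ?thesis using True by simp
  next
    case False
    then have "z \<in> - K" using K(2) by auto
    have "frechet_derivative F (at z) = frechet_derivative (\<lambda>_. 0) (at z)"
      by (rule frechet_derivative_cong_open[OF oK \<open>z \<in> - K\<close>]) (use K(3) in \<open>auto simp: F_def\<close>)
    then show ?thesis using False by simp
  qed
  show "set_integrable lborel T (\<lambda>z. frechet_derivative f (at z) v)"
    "(LINT z:T|lborel. frechet_derivative f (at z) v) = 0"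
    unfolding set_integrable_def set_lebesgue_integral_def eq
    using integral_derivative_eq_0[OF _ F0 v] F1 by auto
qed

text \<open>The map z \<mapsto> |z|^2 carries area to \<pi> times length on the half-line, so the
  integral is \<pi> (step(3) - step(0)) = - \<pi>. This replaces polar coordinates.\<close>

lemma integral_step'_norm_square:
  "integrable lborel (\<lambda>z::complex. step' ((norm z)\<^sup>2))"
  "(LINT z::complex|lborel. step' ((norm z)\<^sup>2)) = - pi"
proof -
  \<comment> \<open>The integrand vanishes for |z|^2 > 2; cutting off at |z|^2 < 3 makes the
    transported measure finite.\<close>
  define S where "S = ball (0::complex) (sqrt 3)"
  have mstep: "step' \<in> borel_measurable borel" by (rule borel_measurable_continuous_onI[OF continuous_on_step'])
  have mS [measurable]: "S \<in> sets borel" "indicat_real S \<in> borel_measurable borel"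
    by (auto simp: S_def intro!: borel_measurable_indicator)
  define M where "M = distr (density lborel (\<lambda>z. ennreal (indicator S z))) borel (\<lambda>z::complex. (norm z)\<^sup>2)"
  define N where "N = density lborel (\<lambda>x::real. ennreal (pi * indicator {0..3} x))"
  have eS: "emeasure lborel (cball (0::complex) r) = ennreal (pi * r\<^sup>2)" "emeasure lborel (ball (0::complex) r) = ennreal (pi * r\<^sup>2)" if "r \<ge> 0" for r
    using that by (simp_all add: emeasure_cball emeasure_ball unit_ball_vol_2)
  have M: "emeasure M {x<..} = ennreal (pi * (3 - max 0 (min 3 x)))" for x
  proof -
    have "emeasure M {x<..} = emeasure (density lborel (\<lambda>z. ennreal (indicator S z))) {z. x < (norm z)\<^sup>2}"
      unfolding M_def by (subst emeasure_distr) (auto simp: vimage_def)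
    also have "\<dots> = emeasure lborel (S \<inter> {z. x < (norm z)\<^sup>2})"
    proof -
      have A: "{z::complex. x < (norm z)\<^sup>2} \<in> sets borel" by measurable
      have "emeasure (density lborel (\<lambda>z. ennreal (indicator S z))) {z. x < (norm z)\<^sup>2}
          = (\<integral>\<^sup>+ z. ennreal (indicator S z) * indicator {z. x < (norm z)\<^sup>2} z \<partial>lborel)"
        by (rule emeasure_density) (use mS A in auto)
      also have "\<dots> = (\<integral>\<^sup>+ z. indicator (S \<inter> {z. x < (norm z)\<^sup>2}) z \<partial>lborel)"
        by (intro nn_integral_cong) (auto split: split_indicator)
      also have "\<dots> = emeasure lborel (S \<inter> {z. x < (norm z)\<^sup>2})"
        by (rule nn_integral_indicator) (use mS A in auto)
      finally show ?thesis .
    qed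
    also have "\<dots> = ennreal (pi * (3 - max 0 (min 3 x)))"
    proof -
      consider "x < 0" | "0 \<le> x" "x < 3" | "x \<ge> 3" by linarith
      then show ?thesis
      proof cases
        case 1
        then have "S \<inter> {z. x < (norm z)\<^sup>2} = S" by (auto intro: less_le_trans)
        then show ?thesis using 1 eS(2)[of "sqrt 3"] by (simp add: S_def)
      next
        case 2
        have lt: "sqrt x < sqrt 3" using 2 by simp
        have iff: "x < (norm z)\<^sup>2 \<longleftrightarrow> sqrt x < norm z" for z :: complex
          using real_sqrt_less_iff[of x "(norm z)\<^sup>2"] by simp
        have "S \<inter> {z. x < (norm z)\<^sup>2} = S - cball 0 (sqrt x)"
          unfolding iff by auto
        moreover have "cball 0 (sqrt x) \<subseteq> S"
          using order_le_less_trans[OF _ lt] by (auto simp: S_def)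
        then have "emeasure lborel (S - cball 0 (sqrt x)) = emeasure lborel S - emeasure lborel (cball (0::complex) (sqrt x))"
          using 2 by (intro emeasure_Diff) (auto simp: S_def eS)
        ultimately show ?thesis using 2 eS(2)[of "sqrt 3"] eS(1)[of "sqrt x"]
          by (simp add: S_def ennreal_minus algebra_simps)
      next
        case 3
        have "(norm z)\<^sup>2 < 3" if "z \<in> S" for z
          using that real_sqrt_less_iff[of "(norm z)\<^sup>2" 3] by (simp add: S_def)
        then have "S \<inter> {z. x < (norm z)\<^sup>2} = {}" using 3 by force
        then show ?thesis using 3 by simp
      qed
    qed
    finally show ?thesis .
  qed
  have N: "emeasure N {x<..} = ennreal (pi * (3 - max 0 (min 3 x)))" for x
  proof -
    have "emeasure N {x<..} = (\<integral>\<^sup>+ y. ennreal pi * indicator ({0..3} \<inter> {x<..}) y \<partial>lborel)"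
      unfolding N_def by (subst emeasure_density) (auto intro!: nn_integral_cong split: split_indicator)
    also have "\<dots> = ennreal pi * emeasure lborel ({0..3} \<inter> {x<..})"
      by (subst nn_integral_cmult_indicator) auto
    also have "{0..3} \<inter> {x<..} = (if x < 0 then {0..3} else {x<..3})" by auto
    also have "ennreal pi * emeasure lborel (if x < 0 then {0..3} else {x<..3}) = ennreal (pi * (3 - max 0 (min 3 x)))"
          proof (cases "x < 0")
      case True
      then show ?thesis by (simp add: ennreal_mult)
    next
      case False
      then show ?thesis by (cases "x \<le> 3") (auto simp: ennreal_mult[symmetric] min_def)
    qed
    finally show ?thesis .
  qed
  \<comment> \<open>Both are Borel measures on the line with finite mass on the half-lines (x,
    \<infinity>), so agreement there determines them.\<close>
  have MN: "M = N"
    by (rule measure_eqI_lessThan) (auto simp: M N, auto simp: M_def N_def)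
  have ind: "step' ((norm z)\<^sup>2) = indicator S z * step' ((norm z)\<^sup>2)" for z :: complex
  proof (cases "z \<in> S")
    case False
    then have "norm z \<ge> sqrt 3" by (simp add: S_def)
    then have "(norm z)\<^sup>2 \<ge> (sqrt 3)\<^sup>2" by (intro power_mono) auto
    then show ?thesis using False step'_eq_0[of "(norm z)\<^sup>2"] by simp
  qed simp
  have cont: "continuous_on UNIV (\<lambda>z::complex. complex_of_real (step' ((norm z)\<^sup>2)))"
    by (intro continuous_on_of_real continuous_on_compose2[OF continuous_on_step'] continuous_intros) auto
  have "integrable lborel (\<lambda>z::complex. complex_of_real (step' ((norm z)\<^sup>2)))"
  proof (rule integrable_compact_support[OF cont, of "sqrt 3"])
    show "complex_of_real (step' ((norm z)\<^sup>2)) = 0" if "norm z > sqrt 3" for z :: complex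
      using ind[of z] that by (simp add: S_def indicator_def split: if_splits)
  qed
  then show "integrable lborel (\<lambda>z::complex. step' ((norm z)\<^sup>2))"
    by (simp only: complex_of_real_integrable_eq)
  have "(LINT z::complex|lborel. step' ((norm z)\<^sup>2)) = (LINT z|lborel. indicator S z *\<^sub>R step' ((norm z)\<^sup>2))"
    by (intro Bochner_Integration.integral_cong refl, subst ind) simp
  also have "\<dots> = (LINT z|density lborel (\<lambda>z. ennreal (indicator S z)). step' ((norm z)\<^sup>2))"
    by (rule integral_density[symmetric]) (use mstep mS in auto)
  also have "\<dots> = (LINT x|M. step' x)"
    unfolding M_def by (rule integral_distr[symmetric]) (use mstep in auto)
  also have "\<dots> = (LINT x|lborel. (pi * indicator {0..3} x) *\<^sub>R step' x)"
    unfolding MN N_def by (rule integral_density) (use mstep in auto)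
  also have "\<dots> = (LINT x|lborel. pi * (step' x * indicator {0..3} x))"
    by (simp add: mult_ac)
  also have "\<dots> = pi * (LINT x|lborel. step' x * indicator {0..3} x)"
    by simp
  also have "(LINT x|lborel. step' x * indicator {0..3} x) = step 3 - step 0"
    by (rule integral_FTC_Icc_real) (use step_has_derivative continuous_on_step' in \<open>auto simp: continuous_on_eq_continuous_at\<close>)
  finally show "(LINT z::complex|lborel. step' ((norm z)\<^sup>2)) = - pi" by (simp add: step_eq_0 step_eq_1)
qed

section \<open>Local solutions at regular singular points\<close>

lemma holomorphic_onI_DERIV:
  assumes "open S" "\<And>z. z \<in> S \<Longrightarrow> (f has_field_derivative f' z) (at z)"
  shows "f holomorphic_on S"
  using assms by (meson holomorphic_on_open)

text \<open>Comparing power series, the n-th coefficient of the solution is that of \<open>F\<close>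
  divided by \<alpha> + n. No denominator vanishes, as \<alpha> is not an integer, and the
  reciprocals are bounded, so the disc of convergence does not shrink.\<close>

lemma euler_equation:
  fixes F :: "complex \<Rightarrow> complex"
  assumes F: "F holomorphic_on ball 0 r" and \<alpha>: "\<alpha> \<notin> \<int>"
  obtains \<kappa> \<kappa>' where "\<And>s. norm s < r \<Longrightarrow> (\<kappa> has_field_derivative \<kappa>' s) (at s)"
    "\<And>s. norm s < r \<Longrightarrow> s * \<kappa>' s + \<alpha> * \<kappa> s = F s"
proof -
  define a where "a = (\<lambda>n. (deriv ^^ n) F 0 / fact n)"
  have a: "(\<lambda>n. a n * s ^ n) sums F s" if "norm s < r" for s
    using holomorphic_power_series[OF F, of s] that by (simp add: a_def)
  have nz: "\<alpha> + of_nat n \<noteq> 0" for n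
  proof
    assume "\<alpha> + of_nat n = 0"
    then have "\<alpha> = - of_nat n" by (simp add: eq_neg_iff_add_eq_0)
    then show False using \<alpha> by simp
  qed
  have "(\<lambda>n. inverse (\<alpha> + of_nat n)) \<longlonglongrightarrow> 0"
    by (rule filterlim_compose[OF tendsto_inverse_0 tendsto_add_filterlim_at_infinity[OF tendsto_const tendsto_of_nat]])
  then have "Bseq (\<lambda>n. inverse (\<alpha> + of_nat n))" by (intro convergent_imp_Bseq convergentI)
  then obtain K where K: "\<And>n. norm (inverse (\<alpha> + of_nat n)) \<le> K" by (auto simp: Bseq_def)
  define c where "c = (\<lambda>n. a n * inverse (\<alpha> + of_nat n))"
  define \<kappa> where "\<kappa> = (\<lambda>s. \<Sum>n. c n * s ^ n)"
  define \<kappa>' where "\<kappa>' = (\<lambda>s. \<Sum>n. of_nat n * c n * s ^ (n - 1))"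
  have main: "(\<kappa> has_field_derivative \<kappa>' s) (at s) \<and> s * \<kappa>' s + \<alpha> * \<kappa> s = F s" if s: "norm s < r" for s
  proof -
    \<comment> \<open>Two intermediate radii: convergence at \<rho>' gives absolute convergence at
      \<rho>, and this survives multiplication by the bounded reciprocals.\<close>
    obtain \<rho> where \<rho>: "norm s < \<rho>" "\<rho> < r" using dense s by blast
    obtain \<rho>' where \<rho>': "\<rho> < \<rho>'" "\<rho>' < r" using dense \<rho> by blast
    have p0: "0 < \<rho>" using \<rho> by (meson norm_ge_zero le_less_trans)
    have "summable (\<lambda>n. norm (a n * of_real \<rho> ^ n))"
      using powser_insidea[of a "of_real \<rho>'" "of_real \<rho>"] sums_summable[OF a[of "of_real \<rho>'"]] \<rho>' p0 by simp
    then have "summable (\<lambda>n. K * norm (a n * of_real \<rho> ^ n))" by (rule summable_mult)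
    then have "summable (\<lambda>n. c n * of_real \<rho> ^ n)"
    proof (rule summable_comparison_test'[where N = 0])
      fix n
      have "norm (c n * of_real \<rho> ^ n) = norm (inverse (\<alpha> + of_nat n)) * norm (a n * of_real \<rho> ^ n)"
        by (simp add: c_def norm_mult mult_ac)
      also have "\<dots> \<le> K * norm (a n * of_real \<rho> ^ n)" by (intro mult_right_mono K) simp
      finally show "norm (c n * of_real \<rho> ^ n) \<le> K * norm (a n * of_real \<rho> ^ n)" .
    qed
    from power_series_and_derivative_0[OF this[folded of_real_power]] obtain g g' where
      g: "\<forall>z. cmod z < \<rho> \<longrightarrow> ((\<lambda>n. c n * z^n) sums g z) \<and> ((\<lambda>n. of_nat n * c n * z^(n-1)) sums g' z) \<and> (g has_field_derivative g' z) (at z)"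
      by blast
    have gs: "(\<lambda>n. c n * s ^ n) sums g s" "(\<lambda>n. of_nat n * c n * s^(n-1)) sums g' s" "(g has_field_derivative g' s) (at s)"
      using g \<rho>(1) by auto
    have eq: "\<kappa> s = g s" "\<kappa>' s = g' s" using gs by (simp_all add: \<kappa>_def \<kappa>'_def sums_iff)
    have "(\<kappa> has_field_derivative g' s) (at s)"
      using gs(3)
    proof (rule has_field_derivative_transform_within_open)
      show "open (ball 0 \<rho>)" "s \<in> ball 0 \<rho>" using \<rho> by auto
      show "g z = \<kappa> z" if "z \<in> ball 0 \<rho>" for z
        using g that unfolding \<kappa>_def by (simp add: sums_iff)
    qed
    moreover have "(\<lambda>n. s * (of_nat n * c n * s^(n-1)) + \<alpha> * (c n * s ^ n)) sums (s * g' s + \<alpha> * g s)"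
      by (intro sums_add sums_mult gs)
    then have "(\<lambda>n. a n * s ^ n) sums (s * g' s + \<alpha> * g s)"
    proof (rule sums_cong[THEN iffD1, rotated])
      fix n
      have "s * (of_nat n * c n * s^(n-1)) = of_nat n * c n * s ^ n"
        by (cases n) (simp_all add: mult_ac)
      then have "s * (of_nat n * c n * s^(n-1)) + \<alpha> * (c n * s ^ n) = (\<alpha> + of_nat n) * c n * s ^ n"
        by (simp add: algebra_simps)
      also have "\<dots> = a n * s ^ n" using nz[of n] by (simp add: c_def)
      finally show "s * (of_nat n * c n * s^(n-1)) + \<alpha> * (c n * s ^ n) = a n * s ^ n" .
    qed
    ultimately show ?thesis using a[OF s] sums_unique2 by (simp add: eq)
  qed
  show ?thesis by (rule that[of \<kappa> \<kappa>']) (use main in auto)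
qed

text \<open>On a circle a solution is a constant multiple of \<open>s powr - \<alpha>\<close>, which is not single-valued.\<close>

lemma multivalued_solution_eq_0:
  fixes D :: "complex \<Rightarrow> complex"
  assumes D: "\<And>s. 0 < norm s \<Longrightarrow> norm s < r \<Longrightarrow> (D has_field_derivative D' s) (at s)"
    and eq: "\<And>s. 0 < norm s \<Longrightarrow> norm s < r \<Longrightarrow> s * D' s = - \<alpha> * D s"
    and \<alpha>: "\<alpha> \<notin> \<int>" and s: "0 < norm s" "norm s < r"
  shows "D s = 0"
proof -
  \<comment> \<open>The second factor compensates the multivalued power along the circle, so this
    product is constant. After a full turn it compares \<open>D s\<close> with exp(2 \<pi> i
    \<alpha>) \<open>D s\<close>.\<close>
  define \<phi> where "\<phi> = (\<lambda>\<theta>. D (s * exp (\<i> * of_real \<theta>)) * exp (\<i> * \<alpha> * of_real \<theta>))"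
  have "norm (\<phi> (2 * pi) - \<phi> 0) \<le> 0 * (2 * pi)"
  proof (rule vector_mvt_bound[where \<phi>' = "\<lambda>_. 0"])
    fix \<theta> :: real
    define z where "z = s * exp (\<i> * of_real \<theta>)"
    have n: "0 < norm z" "norm z < r" using s by (simp_all add: z_def norm_mult)
    have 1: "((\<lambda>\<theta>. s * exp (\<i> * of_real \<theta>)) has_vector_derivative \<i> * z) (at \<theta>)"
      unfolding z_def by (auto intro!: derivative_eq_intros has_vector_derivative_real_field)
    have 2: "((\<lambda>\<theta>. D (s * exp (\<i> * of_real \<theta>))) has_vector_derivative (\<i> * z * D' z)) (at \<theta>)"
      using field_vector_diff_chain_at[OF 1, of D "D' z"] D[OF n] by (simp add: o_def z_def)
    have 3: "((\<lambda>\<theta>. exp (\<i> * \<alpha> * of_real \<theta>)) has_vector_derivative \<i> * \<alpha> * exp (\<i> * \<alpha> * of_real \<theta>)) (at \<theta>)"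
      by (auto intro!: derivative_eq_intros has_vector_derivative_real_field)
    have "D z * (\<i> * \<alpha> * exp (\<i> * \<alpha> * of_real \<theta>)) + \<i> * z * D' z * exp (\<i> * \<alpha> * of_real \<theta>)
       = \<i> * exp (\<i> * \<alpha> * of_real \<theta>) * (\<alpha> * D z + z * D' z)"
      by (simp add: algebra_simps)
    also have "\<dots> = 0" using eq[OF n] by simp
    finally show "(\<phi> has_vector_derivative 0) (at \<theta>)"
      using has_vector_derivative_mult[OF 2 3] unfolding \<phi>_def by (simp add: z_def)
  qed auto
  then have "D s * exp (\<i> * \<alpha> * (2 * of_real pi)) = D s" by (simp add: \<phi>_def exp_eq_polar)
  then have "D s = 0 \<or> exp (\<i> * \<alpha> * (2 * of_real pi)) = 1" by (metis mult_cancel_left1)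
  moreover have "exp (\<i> * \<alpha> * (2 * of_real pi)) \<noteq> 1"
  proof
    assume "exp (\<i> * \<alpha> * (2 * of_real pi)) = 1"
    then obtain n :: int where "Im \<alpha> = 0" "Re \<alpha> * (2 * pi) = of_int (2 * n) * pi"
      by (auto simp: exp_eq_1)
    then have "\<alpha> = of_int n" by (auto simp: complex_eq_iff)
    then show False using \<alpha> by simp
  qed
  ultimately show ?thesis by blast
qed

text \<open>The integrating factor exp(H), with H' = (p - p(0))/s holomorphic at 0, turns the
  equation into one with the constant coefficient p(0). Uniqueness concerns solutions on a punctured
  disc only: the difference of two, times exp(H), solves the homogeneous equation and is
  single-valued, hence 0.\<close>

lemma regular_singular_solution:
  fixes p q :: "complex \<Rightarrow> complex"
  assumes r: "r > 0" and p: "p holomorphic_on ball 0 r" and q: "q holomorphic_on ball 0 r" and p0: "p 0 \<notin> \<int>"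
  obtains \<kappa> \<kappa>' where "\<And>s. norm s < r \<Longrightarrow> (\<kappa> has_field_derivative \<kappa>' s) (at s)"
    "\<And>s. norm s < r \<Longrightarrow> s * \<kappa>' s + p s * \<kappa> s = q s"
    "\<And>G G' r' s. r' \<le> r \<Longrightarrow> (\<And>s. 0 < norm s \<Longrightarrow> norm s < r' \<Longrightarrow> (G has_field_derivative G' s) (at s)) \<Longrightarrow>
       (\<And>s. 0 < norm s \<Longrightarrow> norm s < r' \<Longrightarrow> s * G' s + p s * G s = q s) \<Longrightarrow> 0 < norm s \<Longrightarrow> norm s < r' \<Longrightarrow> G s = \<kappa> s"
proof -
  define h where "h = (\<lambda>z. if z = 0 then deriv p 0 else (p z - p 0) / (z - 0))"
  have h: "h holomorphic_on ball 0 r" unfolding h_def by (rule pole_lemma[OF p]) (use r in \<open>simp add: interior_open\<close>)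
  have ph: "p s = p 0 + s * h s" for s by (simp add: h_def)
  obtain H where H: "\<And>s. s \<in> ball 0 r \<Longrightarrow> (H has_field_derivative h s) (at s within ball 0 r)"
    using holomorphic_convex_primitive'[OF convex_ball open_ball h] by blast
  have H: "(H has_field_derivative h s) (at s)" if "norm s < r" for s
    using H[of s] that by (simp add: at_within_open[of s "ball 0 r"])
  have "H holomorphic_on ball 0 r"
    by (rule holomorphic_onI_DERIV[of _ _ h]) (use H in auto)
  then have Eq: "(\<lambda>s. exp (H s) * q s) holomorphic_on ball 0 r" by (intro holomorphic_intros q)
  obtain \<kappa>0 \<kappa>0' where c0: "\<And>s. norm s < r \<Longrightarrow> (\<kappa>0 has_field_derivative \<kappa>0' s) (at s)"
    "\<And>s. norm s < r \<Longrightarrow> s * \<kappa>0' s + p 0 * \<kappa>0 s = exp (H s) * q s"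
    using euler_equation[OF Eq p0] by blast
  define \<kappa> where "\<kappa> = (\<lambda>s. \<kappa>0 s * exp (- H s))"
  define \<kappa>' where "\<kappa>' = (\<lambda>s. \<kappa>0' s * exp (- H s) + - h s * exp (- H s) * \<kappa>0 s)"
  have ex: "exp (- H s) * exp (H s) = 1" for s by (simp add: exp_minus)
  have d: "(\<kappa> has_field_derivative \<kappa>' s) (at s)" if "norm s < r" for s
    unfolding \<kappa>_def \<kappa>'_def
    by (rule DERIV_cong[OF DERIV_mult[OF c0(1)[OF that] DERIV_chain2[OF DERIV_exp DERIV_minus[OF H[OF that]]]]]) simp
  have e: "s * \<kappa>' s + p s * \<kappa> s = q s" if "norm s < r" for s
  proof -
    have "s * \<kappa>' s + p s * \<kappa> s = (s * \<kappa>0' s + p 0 * \<kappa>0 s) * exp (- H s)"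
      by (simp add: \<kappa>_def \<kappa>'_def ph[of s] algebra_simps)
    also have "\<dots> = q s * (exp (- H s) * exp (H s))" unfolding c0(2)[OF that] by (simp add: mult_ac)
    finally show ?thesis by (simp add: ex)
  qed
  have u: "G s = \<kappa> s" if r': "r' \<le> r" and G: "\<And>s. 0 < norm s \<Longrightarrow> norm s < r' \<Longrightarrow> (G has_field_derivative G' s) (at s)"
    and Ge: "\<And>s. 0 < norm s \<Longrightarrow> norm s < r' \<Longrightarrow> s * G' s + p s * G s = q s" and s: "0 < norm s" "norm s < r'" for G G' r' s
  proof -
    have "(G s - \<kappa> s) * exp (H s) = 0"
    proof (rule multivalued_solution_eq_0[where D' = "\<lambda>s. (G' s - \<kappa>' s) * exp (H s) + h s * exp (H s) * (G s - \<kappa> s)" and r = r', OF _ _ p0 s])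
      fix s :: complex assume s: "0 < norm s" "norm s < r'"
      then have sr: "norm s < r" using r' by simp
      show "((\<lambda>s. (G s - \<kappa> s) * exp (H s)) has_field_derivative (G' s - \<kappa>' s) * exp (H s) + h s * exp (H s) * (G s - \<kappa> s)) (at s)"
        by (rule DERIV_cong[OF DERIV_mult[OF DERIV_diff[OF G[OF s] d[OF sr]] DERIV_chain2[OF DERIV_exp H[OF sr]]]]) simp
      have "s * ((G' s - \<kappa>' s) * exp (H s) + h s * exp (H s) * (G s - \<kappa> s))
          = ((s * G' s + p s * G s) - (s * \<kappa>' s + p s * \<kappa> s)) * exp (H s) - p 0 * ((G s - \<kappa> s) * exp (H s))"
        by (simp add: ph[of s] algebra_simps)
      then show "s * ((G' s - \<kappa>' s) * exp (H s) + h s * exp (H s) * (G s - \<kappa> s)) = - p 0 * ((G s - \<kappa> s) * exp (H s))"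
        unfolding Ge[OF s] e[OF sr] by simp
    qed
    then show ?thesis by simp
  qed
  show ?thesis by (rule that[of \<kappa> \<kappa>']) (use d e u in blast)+
qed

text \<open>The coefficient of dt in the logarithmic form with residue \<open>r p\<close> at each p
  in \<open>P\<close>; with exponents in place of residues it is that of d log u.\<close>

definition logf :: "complex set \<Rightarrow> (complex \<Rightarrow> complex) \<Rightarrow> complex \<Rightarrow> complex" where
  "logf P r t = (\<Sum>p\<in>P. r p / (t - p))"

lemma holomorphic_logf: "finite P \<Longrightarrow> logf P r holomorphic_on - P"
  unfolding logf_def [abs_def] by (intro holomorphic_intros) auto

text \<open>Multiplication by z - p turns both logarithmic coefficients into holomorphic functions,
  the two instances of \<open>ext\<close>, whose values at p are the residues. At s = 0 the equation
  reads \<alpha>_p \<psi>(p) = r_p.\<close>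

lemma local_solution_at_puncture:
  assumes P: "finite P" "p \<in> P" and \<alpha>: "\<alpha> p \<notin> \<int>"
    and R: "R > 0" "\<And>q. q \<in> P \<Longrightarrow> q \<noteq> p \<Longrightarrow> R \<le> dist p q"
  obtains \<psi> where "\<psi> holomorphic_on ball p R" "\<psi> p = r p / \<alpha> p"
    "\<And>z. 0 < dist p z \<Longrightarrow> dist p z < R \<Longrightarrow> (\<psi> has_field_derivative (logf P r z - logf P \<alpha> z * \<psi> z)) (at z)"
    "\<And>G e z. e \<le> R \<Longrightarrow> (\<And>z. 0 < dist p z \<Longrightarrow> dist p z < e \<Longrightarrow> (G has_field_derivative (logf P r z - logf P \<alpha> z * G z)) (at z)) \<Longrightarrow>
       0 < dist p z \<Longrightarrow> dist p z < e \<Longrightarrow> G z = \<psi> z"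
proof -
  define ext where "ext = (\<lambda>f s. f p + s * (\<Sum>q\<in>P - {p}. f q / (p + s - q)))" for f :: "complex \<Rightarrow> complex"
  have hol: "ext f holomorphic_on ball 0 R" for f
  proof -
    have "p + s - q \<noteq> 0" if "norm s < R" "q \<in> P" "q \<noteq> p" for s q
    proof
      assume "p + s - q = 0"
      then have "s = q - p" by (simp add: algebra_simps)
      then show False using that R(2)[of q] by (simp add: dist_norm norm_minus_commute)
    qed
    then show ?thesis unfolding ext_def by (intro holomorphic_intros) auto
  qed
  have ext: "ext f (z - p) = (z - p) * logf P f z" if "z \<noteq> p" for f z
    using that P by (simp add: ext_def logf_def sum.remove[OF P] field_simps)
  have e0: "ext f 0 = f p" for f by (simp add: ext_def)
  obtain \<kappa> \<kappa>' where c: "\<And>s. norm s < R \<Longrightarrow> (\<kappa> has_field_derivative \<kappa>' s) (at s)"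
    "\<And>s. norm s < R \<Longrightarrow> s * \<kappa>' s + ext \<alpha> s * \<kappa> s = ext r s"
    "\<And>G G' r' s. r' \<le> R \<Longrightarrow> (\<And>s. 0 < norm s \<Longrightarrow> norm s < r' \<Longrightarrow> (G has_field_derivative G' s) (at s)) \<Longrightarrow>
       (\<And>s. 0 < norm s \<Longrightarrow> norm s < r' \<Longrightarrow> s * G' s + ext \<alpha> s * G s = ext r s) \<Longrightarrow> 0 < norm s \<Longrightarrow> norm s < r' \<Longrightarrow> G s = \<kappa> s"
    using regular_singular_solution[OF R(1) hol[of \<alpha>] hol[of r]] \<alpha> unfolding e0 by blast
  define \<psi> where "\<psi> = (\<lambda>z. \<kappa> (z - p))"
  have d: "(\<psi> has_field_derivative \<kappa>' (z - p)) (at z)" if "dist p z < R" for z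
  proof -
    have "norm (z - p) < R" using that by (simp add: dist_norm norm_minus_commute)
    moreover have "((\<lambda>z. z - p) has_field_derivative 1) (at z)" by (auto intro!: derivative_eq_intros)
    ultimately show ?thesis
      using DERIV_chain2[of \<kappa> _ "\<lambda>z. z - p" z 1 UNIV] c(1) unfolding \<psi>_def by force
  qed
  show ?thesis
  proof (rule that[of \<psi>])
    show "\<psi> holomorphic_on ball p R"
      by (rule holomorphic_onI_DERIV[of _ _ "\<lambda>z. \<kappa>' (z - p)"]) (use d in auto)
    have "\<alpha> p \<noteq> 0" using \<alpha> by auto
    then show "\<psi> p = r p / \<alpha> p" using c(2)[of 0] R(1) by (simp add: \<psi>_def e0 field_simps)
    show "(\<psi> has_field_derivative (logf P r z - logf P \<alpha> z * \<psi> z)) (at z)" if z: "0 < dist p z" "dist p z < R" for z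
    proof -
      have z': "z \<noteq> p" "norm (z - p) < R" using z by (auto simp: dist_norm norm_minus_commute)
      have "(z - p) * (\<kappa>' (z - p) + logf P \<alpha> z * \<psi> z) = (z - p) * logf P r z"
        using c(2)[OF z'(2)] unfolding ext[OF z'(1)] by (simp add: \<psi>_def algebra_simps)
      then have "\<kappa>' (z - p) + logf P \<alpha> z * \<psi> z = logf P r z" using z'(1) by simp
      then have "\<kappa>' (z - p) = logf P r z - logf P \<alpha> z * \<psi> z" by (simp add: algebra_simps)
      with d[OF z(2)] show ?thesis by simp
    qed
    show "G z = \<psi> z" if e: "e \<le> R"
      and G: "\<And>z. 0 < dist p z \<Longrightarrow> dist p z < e \<Longrightarrow> (G has_field_derivative (logf P r z - logf P \<alpha> z * G z)) (at z)"
      and z: "0 < dist p z" "dist p z < e" for G e z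
    proof -
      have "(\<lambda>s. G (s + p)) (z - p) = \<kappa> (z - p)"
      proof (rule c(3)[OF e, where G' = "\<lambda>s. logf P r (s + p) - logf P \<alpha> (s + p) * G (s + p)"])
        fix s :: complex assume s: "0 < norm s" "norm s < e"
        then have "dist p (s + p) = norm s" by (simp add: dist_norm norm_minus_commute)
        from G[of "s + p", unfolded this, OF s]
        show "((\<lambda>s. G (s + p)) has_field_derivative logf P r (s + p) - logf P \<alpha> (s + p) * G (s + p)) (at s)"
          by (simp add: DERIV_shift)
        have "s + p \<noteq> p" using s by auto
        from ext[OF this, of \<alpha>] ext[OF this, of r]
        show "s * (logf P r (s + p) - logf P \<alpha> (s + p) * G (s + p)) + ext \<alpha> s * G (s + p) = ext r s"
          by (simp add: algebra_simps)
      qed (use z in \<open>auto simp: dist_norm norm_minus_commute\<close>)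
      then show ?thesis by (simp add: \<psi>_def)
    qed
  qed
qed

text \<open>In the coordinate s = 1/z one has s d/ds = - z d/dz, so the equation is again regular
  singular, now with coefficients - z times the logarithmic ones. Residue and exponent at infinity
  are minus the respective sums; the signs cancel in the quotient.\<close>

lemma local_solution_at_infinity:
  assumes P: "finite P" and \<alpha>: "(\<Sum>p\<in>P. \<alpha> p) \<notin> \<int>"
    and R: "R > 0" "\<And>q. q \<in> P \<Longrightarrow> norm q \<le> R"
  obtains \<psi> where "\<psi> holomorphic_on - cball 0 R" "(\<psi> \<longlongrightarrow> (\<Sum>p\<in>P. r p) / (\<Sum>p\<in>P. \<alpha> p)) at_infinity"
    "\<And>z. norm z > R \<Longrightarrow> (\<psi> has_field_derivative (logf P r z - logf P \<alpha> z * \<psi> z)) (at z)"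
    "\<And>G e z. e \<ge> R \<Longrightarrow> (\<And>z. norm z > e \<Longrightarrow> (G has_field_derivative (logf P r z - logf P \<alpha> z * G z)) (at z)) \<Longrightarrow>
       norm z > e \<Longrightarrow> G z = \<psi> z"
proof -
  define ext where "ext = (\<lambda>f s. - (\<Sum>q\<in>P. f q / (1 - q * s)))" for f :: "complex \<Rightarrow> complex"
  have R': "1 / R > 0" using R by simp
  have nz: "1 - q * s \<noteq> 0" if "norm s < 1 / R" "q \<in> P" for s q
  proof
    assume "1 - q * s = 0"
    then have "norm q * norm s = 1" by (metis eq_iff_diff_eq_0 norm_mult norm_one)
    moreover have "norm q * norm s \<le> R * norm s" using R(2)[OF that(2)] by (intro mult_right_mono) auto
    ultimately show False using that(1) R(1) by (simp add: field_simps)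
  qed
  have hol: "ext f holomorphic_on ball 0 (1 / R)" for f
    unfolding ext_def using nz by (intro holomorphic_intros) auto
  have ext: "ext f (1 / z) = - z * logf P f z" if "norm z > R" for f z
  proof -
    have z: "z \<noteq> 0" using that R(1) by auto
    have "f q / (1 - q * (1 / z)) = z * (f q / (z - q))" if "q \<in> P" for q
    proof -
      have "1 - q * (1 / z) = (z - q) / z" using z by (simp add: field_simps)
      then show ?thesis by (simp add: mult.commute)
    qed
    then show ?thesis by (simp add: ext_def logf_def sum_distrib_left sum_negf)
  qed
  have e0: "ext f 0 = - (\<Sum>q\<in>P. f q)" for f by (simp add: ext_def)
  have "ext \<alpha> 0 \<notin> \<int>" unfolding e0 using \<alpha> by simp
  then obtain \<kappa> \<kappa>' where c: "\<And>s. norm s < 1 / R \<Longrightarrow> (\<kappa> has_field_derivative \<kappa>' s) (at s)"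
    "\<And>s. norm s < 1 / R \<Longrightarrow> s * \<kappa>' s + ext \<alpha> s * \<kappa> s = ext r s"
    "\<And>G G' r' s. r' \<le> 1 / R \<Longrightarrow> (\<And>s. 0 < norm s \<Longrightarrow> norm s < r' \<Longrightarrow> (G has_field_derivative G' s) (at s)) \<Longrightarrow>
       (\<And>s. 0 < norm s \<Longrightarrow> norm s < r' \<Longrightarrow> s * G' s + ext \<alpha> s * G s = ext r s) \<Longrightarrow> 0 < norm s \<Longrightarrow> norm s < r' \<Longrightarrow> G s = \<kappa> s"
    using regular_singular_solution[OF R' hol[of \<alpha>] hol[of r]] by blast
  define \<psi> where "\<psi> = (\<lambda>z. \<kappa> (1 / z))"
  have small: "norm (1 / z) < 1 / R" if "norm z > R" for z :: complex
    using that R(1) by (simp add: norm_divide frac_less2)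
  have inv: "((\<lambda>z. 1 / z) has_field_derivative - 1 / z\<^sup>2) (at z)" if "z \<noteq> 0" for z :: complex
    using that by (auto intro!: derivative_eq_intros simp: power2_eq_square)
  have d: "(\<psi> has_field_derivative (logf P r z - logf P \<alpha> z * \<psi> z)) (at z)" if z: "norm z > R" for z
  proof -
    have z0: "z \<noteq> 0" using z R(1) by auto
    have "\<kappa>' (1 / z) * (- 1 / z\<^sup>2) = logf P r z - logf P \<alpha> z * \<psi> z"
    proof -
      have "\<kappa>' (1 / z) / z = - z * logf P r z + z * logf P \<alpha> z * \<kappa> (1 / z)"
        using c(2)[OF small[OF z]] unfolding ext[OF z] by (simp add: algebra_simps)
      then have "\<kappa>' (1 / z) / z * (- 1 / z) = logf P r z - logf P \<alpha> z * \<kappa> (1 / z)"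
        using z0 by (simp add: field_simps)
      then show ?thesis by (simp add: \<psi>_def power2_eq_square)
    qed
    with DERIV_chain2[OF c(1)[OF small[OF z]] inv[OF z0]] show ?thesis by (simp add: \<psi>_def)
  qed
  show ?thesis
  proof (rule that[of \<psi>])
    show "\<psi> holomorphic_on - cball 0 R"
      by (rule holomorphic_onI_DERIV[of _ _ "\<lambda>z. logf P r z - logf P \<alpha> z * \<psi> z"]) (use d in \<open>auto simp: not_le\<close>)
    show "(\<psi> has_field_derivative (logf P r z - logf P \<alpha> z * \<psi> z)) (at z)" if "norm z > R" for z by (rule d[OF that])
    have "(\<Sum>q\<in>P. \<alpha> q) \<noteq> 0" using \<alpha> by auto
    then have "\<kappa> 0 = (\<Sum>p\<in>P. r p) / (\<Sum>p\<in>P. \<alpha> p)" using c(2)[of 0] R' by (simp add: e0 field_simps)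
    moreover have "(\<kappa> \<longlongrightarrow> \<kappa> 0) (at 0)" using DERIV_isCont[OF c(1)[of 0]] R' by (simp add: isCont_def)
    moreover have "filterlim (\<lambda>z::complex. 1 / z) (at 0) at_infinity"
    proof -
      have "\<forall>\<^sub>F z::complex in at_infinity. z \<noteq> 0"
        unfolding eventually_at_infinity by (intro exI[of _ 1]) auto
      then show ?thesis using tendsto_inverse_0 by (simp add: filterlim_at divide_inverse)
    qed
    ultimately show "(\<psi> \<longlongrightarrow> (\<Sum>p\<in>P. r p) / (\<Sum>p\<in>P. \<alpha> p)) at_infinity"
      unfolding \<psi>_def using filterlim_compose[of \<kappa> _ "at 0" "\<lambda>z. 1 / z" at_infinity] by simp
    show "G z = \<psi> z" if e: "e \<ge> R"
      and G: "\<And>z. norm z > e \<Longrightarrow> (G has_field_derivative (logf P r z - logf P \<alpha> z * G z)) (at z)"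
      and z: "norm z > e" for G e z
    proof -
      have z0: "z \<noteq> 0" using z e R(1) by auto
      have "(\<lambda>s. G (1 / s)) (1 / z) = \<kappa> (1 / z)"
      proof (rule c(3)[of "1 / e" _ "\<lambda>s. (logf P r (1 / s) - logf P \<alpha> (1 / s) * G (1 / s)) * (- 1 / s\<^sup>2)"])
        show "1 / e \<le> 1 / R" using e R(1) by (simp add: frac_le)
        show "0 < norm (1 / z)" "norm (1 / z) < 1 / e"
          using z z0 e R(1) by (auto simp: norm_divide frac_less2)
        fix s :: complex assume s: "0 < norm s" "norm s < 1 / e"
        then have s0: "s \<noteq> 0" and ne: "norm (1 / s) > e" using e R(1) by (auto simp: norm_divide field_simps)
        show "((\<lambda>s. G (1 / s)) has_field_derivative (logf P r (1 / s) - logf P \<alpha> (1 / s) * G (1 / s)) * (- 1 / s\<^sup>2)) (at s)"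
          by (rule DERIV_chain2[OF G[OF ne] inv[OF s0]])
        have nR: "norm (1 / s) > R" using ne e by linarith
        have e: "ext f s = - (1 / s) * logf P f (1 / s)" for f using ext[OF nR, of f] by simp
        show "s * ((logf P r (1 / s) - logf P \<alpha> (1 / s) * G (1 / s)) * (- 1 / s\<^sup>2)) + ext \<alpha> s * G (1 / s) = ext r s"
          unfolding e using s0 by (simp add: field_simps power2_eq_square)
      qed
      then show ?thesis by (simp add: \<psi>_def)
    qed
  qed
qed

section \<open>Intersection numbers of logarithmic forms\<close>

subsection \<open>Cutoff functions and approximate identities\<close>

text \<open>The square of the norm keeps the function smooth at the centre. The function is 1 up to
  radius r and 0 from 2 r on.\<close>

definition cutoff :: "complex \<Rightarrow> real \<Rightarrow> complex \<Rightarrow> complex" where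
  "cutoff p r z = of_real (step ((norm (z - p))\<^sup>2 / r\<^sup>2))"

lemma smooth_on_cutoff: "smooth_on UNIV (cutoff p r)"
proof -
  have "smooth_on UNIV (\<lambda>z. of_real ((norm (z - p))\<^sup>2 / r\<^sup>2))"
    using smooth_on_mult[OF open_UNIV smooth_on_norm_square[of p] smooth_on_const[of _ "of_real (inverse (r\<^sup>2))"]]
    by (simp add: divide_inverse)
  from smooth_on_step[OF this] show ?thesis by (simp add: cutoff_def [abs_def])
qed

lemma cutoff_eq_1: "0 < r \<Longrightarrow> norm (z - p) \<le> r \<Longrightarrow> cutoff p r z = 1"
  by (simp add: cutoff_def step_eq_1 divide_le_eq power_mono)

lemma cutoff_eq_0:
  assumes "0 < r" "2 * r \<le> norm (z - p)"
  shows "cutoff p r z = 0"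
proof -
  have "(2 * r)\<^sup>2 \<le> (norm (z - p))\<^sup>2" using assms by (intro power_mono) auto
  then have "4 * r\<^sup>2 \<le> (norm (z - p))\<^sup>2" by (simp add: power_mult_distrib)
  then have "2 * r\<^sup>2 \<le> (norm (z - p))\<^sup>2" using zero_le_power2[of r] by linarith
  then show ?thesis using assms by (simp add: cutoff_def step_eq_0 le_divide_eq)
qed

text \<open>The radial weight that remains when the factor z - p is split off d(cutoff) \<and> dt;
  that factor is left to cancel simple poles at p.\<close>

definition bump :: "complex \<Rightarrow> real \<Rightarrow> complex \<Rightarrow> complex" where
  "bump p r z = 2 * \<i> * of_real (step' ((norm (z - p))\<^sup>2 / r\<^sup>2) / r\<^sup>2)"

text \<open>The left side is the coefficient of d(cutoff) \<and> dt with respect to dx \<and> dy, in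
  other words 2 i times the derivative in the conjugate variable.\<close>

lemma cutoff_wedge:
  "\<i> * frechet_derivative (cutoff p r) (at z) 1 - frechet_derivative (cutoff p r) (at z) \<i> = bump p r z * (z - p)"
proof -
  have "((\<lambda>z. (norm (z - p))\<^sup>2) has_derivative (\<lambda>v. 2 * (Re (z - p) * Re v + Im (z - p) * Im v))) (at z)"
    unfolding cmod_power2 by (auto intro!: derivative_eq_intros simp: algebra_simps)
  then have "((\<lambda>z. (norm (z - p))\<^sup>2 / r\<^sup>2) has_derivative (\<lambda>v. 2 * (Re (z - p) * Re v + Im (z - p) * Im v) * inverse (r\<^sup>2))) (at z)"
    unfolding divide_inverse by (rule has_derivative_mult_left)
  from has_derivative_compose[OF this step_has_derivative[unfolded has_field_derivative_def]]
  have "(cutoff p r has_derivative (\<lambda>v. of_real (step' ((norm (z - p))\<^sup>2 / r\<^sup>2) * (2 * (Re (z - p) * Re v + Im (z - p) * Im v) * inverse (r\<^sup>2))))) (at z)"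
    unfolding cutoff_def [abs_def] by (rule has_derivative_of_real)
  note D = frechet_derivative_unique[OF this]
  show ?thesis
    unfolding D bump_def by (simp add: complex_eq_iff divide_inverse)
qed

lemma bump_eq_0: "0 < r \<Longrightarrow> norm (z - p) < r \<or> 2 * r \<le> norm (z - p) \<Longrightarrow> bump p r z = 0"
proof -
  assume r: "0 < r" and z: "norm (z - p) < r \<or> 2 * r \<le> norm (z - p)"
  have "(norm (z - p))\<^sup>2 / r\<^sup>2 < 1 \<or> (norm (z - p))\<^sup>2 / r\<^sup>2 > 2"
    using z
  proof
    assume "norm (z - p) < r"
    then have "(norm (z - p))\<^sup>2 < r\<^sup>2" using r by (intro power_strict_mono) auto
    then show ?thesis using r by simp
  next
    assume "2 * r \<le> norm (z - p)"
    then have "(2 * r)\<^sup>2 \<le> (norm (z - p))\<^sup>2" using r by (intro power_mono) auto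
    then have "4 * r\<^sup>2 \<le> (norm (z - p))\<^sup>2" by (simp add: power_mult_distrib)
    moreover have "0 < r\<^sup>2" using r by simp
    ultimately have "2 * r\<^sup>2 < (norm (z - p))\<^sup>2" by linarith
    then show ?thesis using r by (simp add: less_divide_eq)
  qed
  then show ?thesis using step'_eq_0 by (simp add: bump_def)
qed

lemma continuous_on_bump: "continuous_on S (bump p r)"
  unfolding bump_def divide_inverse
  by (intro continuous_intros continuous_on_compose2[OF continuous_on_step']) auto

lemma integral_scale:
  fixes f :: "complex \<Rightarrow> complex"
  assumes "f \<in> borel_measurable borel" "r > 0"
  shows "(LINT z|lborel. f z) = of_real (r\<^sup>2) * (LINT u|lborel. f (p + of_real r * u))"
proof -
  have "(LINT z|lborel. f z) = (LINT z|density (distr lborel borel (\<lambda>x. p + r *\<^sub>R x)) (\<lambda>_. ennreal (\<bar>r\<bar> ^ DIM(complex))). f z)"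
    using lborel_affine[of r p] assms(2) by simp
  also have "\<dots> = (LINT z|distr lborel borel (\<lambda>x. p + r *\<^sub>R x). (\<bar>r\<bar> ^ DIM(complex)) *\<^sub>R f z)"
    by (rule integral_density) (use assms in auto)
  also have "\<dots> = (LINT u|lborel. (\<bar>r\<bar> ^ DIM(complex)) *\<^sub>R f (p + r *\<^sub>R u))"
    by (rule integral_distr) (use assms in auto)
  also have "\<dots> = of_real (r\<^sup>2) * (LINT u|lborel. f (p + of_real r * u))"
    by (simp add: scaleR_conv_of_real)
  finally show ?thesis .
qed

text \<open>The substitution z = p + e u turns the bump into the fixed weight 2 i step'(|u|^2),
  which lives on 1 \<le> |u| < 2 and has total mass - 2 \<pi> i; then dominated convergence applies.
  As \<open>e\<close> may tend to 0 or to infinity, the lemma serves the punctures and the point at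
  infinity alike.\<close>

lemma bump_approximate_identity:
  assumes g: "g \<in> borel_measurable borel" and e: "\<And>n. e n > 0"
    and lim: "\<And>u. 1 \<le> norm u \<Longrightarrow> (\<lambda>n. g (p + of_real (e n) * u)) \<longlonglongrightarrow> c"
    and bound: "\<And>n u. 1 \<le> norm u \<Longrightarrow> norm u < 2 \<Longrightarrow> norm (g (p + of_real (e n) * u)) \<le> B"
  shows "(\<lambda>n. LINT z|lborel. bump p (e n) z * g z) \<longlonglongrightarrow> - 2 * of_real pi * \<i> * c"
proof -
  define s where "s = (\<lambda>u::complex. step' ((norm u)\<^sup>2))"
  have mb: "bump p r \<in> borel_measurable borel" for r
    by (rule borel_measurable_continuous_onI[OF continuous_on_bump])
  have eq: "(LINT z|lborel. bump p (e n) z * g z) = (LINT u|lborel. 2 * \<i> * of_real (s u) * g (p + of_real (e n) * u))" for n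
  proof -
    have "(LINT z|lborel. bump p (e n) z * g z) = of_real ((e n)\<^sup>2) * (LINT u|lborel. bump p (e n) (p + of_real (e n) * u) * g (p + of_real (e n) * u))"
      by (rule integral_scale) (use mb g e in auto)
    also have "\<dots> = (LINT u|lborel. of_real ((e n)\<^sup>2) * (bump p (e n) (p + of_real (e n) * u) * g (p + of_real (e n) * u)))"
      by simp
    also have "\<dots> = (LINT u|lborel. 2 * \<i> * of_real (s u) * g (p + of_real (e n) * u))"
      using e[of n] by (intro Bochner_Integration.integral_cong refl) (simp add: bump_def s_def norm_mult power_mult_distrib)
    finally show ?thesis .
  qed
  have ms: "s \<in> borel_measurable borel"
    unfolding s_def by (intro borel_measurable_continuous_onI continuous_on_compose2[OF continuous_on_step'] continuous_intros) auto
  have s0: "s u = 0" if "norm u < 1 \<or> norm u \<ge> 2" for u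
    using bump_eq_0[of 1 u 0] that by (simp add: s_def bump_def)
  have int: "integrable lborel s" using integral_step'_norm_square(1) by (simp add: s_def)
  have "(\<lambda>n. LINT u|lborel. 2 * \<i> * of_real (s u) * g (p + of_real (e n) * u)) \<longlonglongrightarrow> (LINT u|lborel. 2 * \<i> * of_real (s u) * c)"
  proof (rule integral_dominated_convergence[where w = "\<lambda>u. norm (2 * s u) * B"])
    show "(\<lambda>u. 2 * \<i> * of_real (s u) * c) \<in> borel_measurable lborel" using ms by measurable
    show "(\<lambda>u. 2 * \<i> * of_real (s u) * g (p + of_real (e n) * u)) \<in> borel_measurable lborel" for n
      using ms g by measurable
    show "integrable lborel (\<lambda>u. norm (2 * s u) * B)" using int by (intro integrable_mult_left integrable_norm integrable_mult_right)
    show "AE u in lborel. (\<lambda>n. 2 * \<i> * of_real (s u) * g (p + of_real (e n) * u)) \<longlonglongrightarrow> 2 * \<i> * of_real (s u) * c"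
    proof (rule AE_I2)
      fix u show "(\<lambda>n. 2 * \<i> * of_real (s u) * g (p + of_real (e n) * u)) \<longlonglongrightarrow> 2 * \<i> * of_real (s u) * c"
        using s0[of u] lim[of u] by (cases "norm u < 1 \<or> norm u \<ge> 2") (auto intro!: tendsto_intros)
    qed
    show "AE u in lborel. norm (2 * \<i> * of_real (s u) * g (p + of_real (e n) * u)) \<le> norm (2 * s u) * B" for n
    proof (rule AE_I2)
      fix u show "norm (2 * \<i> * of_real (s u) * g (p + of_real (e n) * u)) \<le> norm (2 * s u) * B"
        using s0[of u] bound[of u n] by (cases "norm u < 1 \<or> norm u \<ge> 2") (auto simp: norm_mult abs_mult intro!: mult_left_mono)
    qed
  qed
  also have "(LINT u|lborel. 2 * \<i> * of_real (s u) * c) = 2 * \<i> * of_real (- pi) * c"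
    using integral_step'_norm_square(2) by (simp add: s_def)
  finally show ?thesis unfolding eq by (simp add: mult_ac)
qed

lemma smooth_on_cutoff_extend:
  assumes "open U" "smooth_on U f" "smooth_on UNIV X" "closed C" "C \<subseteq> U" "\<And>z. z \<notin> C \<Longrightarrow> X z = 0"
  shows "smooth_on UNIV (\<lambda>z. if z \<in> U then X z * f z else 0)"
proof -
  have "smooth_on U (\<lambda>z. if z \<in> U then X z * f z else 0) = smooth_on U (\<lambda>z. X z * f z)"
    by (rule smooth_on_cong[OF assms(1)]) simp
  moreover have "smooth_on U (\<lambda>z. X z * f z)"
    by (intro smooth_on_mult assms smooth_on_subset[OF assms(3)]) auto
  moreover have "smooth_on (- C) (\<lambda>z. if z \<in> U then X z * f z else 0) = smooth_on (- C) (\<lambda>z. 0)"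
    by (rule smooth_on_cong) (use assms in auto)
  ultimately have "smooth_on (U \<union> - C) (\<lambda>z. if z \<in> U then X z * f z else 0)"
    using assms by (intro smooth_on_Un) auto
  moreover have "U \<union> - C = UNIV" using assms(5) by auto
  ultimately show ?thesis by simp
qed

subsection \<open>Cohomology classes\<close>

text \<open>The twisted differential squares to zero: the second derivatives of g cancel by
  symmetry, and \<omega> is closed because w is holomorphic. The part h dt is closed for the same
  reason.\<close>

lemma exact_form_closed:
  assumes T: "open T" "z \<in> T" and h: "h holomorphic_on T" and w: "w holomorphic_on T" and g: "smooth_on T g"
  shows "nabla1 w (\<lambda>z v. times_dt h z v - nabla0 w g z v) z = 0"
proof -
  have dh: "(h has_derivative (\<lambda>v. deriv h z * v)) (at z)" and dw: "(w has_derivative (\<lambda>v. deriv w z * v)) (at z)"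
    using holomorphic_derivI[OF h T] holomorphic_derivI[OF w T] by (simp_all add: has_field_derivative_def)
  note dg = smooth_on_has_derivative[OF g T(2)]
  have d: "((\<lambda>y. times_dt h y v - nabla0 w g y v) has_derivative
      (\<lambda>u. deriv h z * u * v - (frechet_derivative (\<lambda>y. frechet_derivative g (at y) v) (at z) u
         + (w z * v * frechet_derivative g (at z) u + deriv w z * u * v * g z)))) (at z)" if "v \<in> {1, \<i>}" for v
    unfolding times_dt_def nabla0_def
    by (rule has_derivative_diff[OF has_derivative_mult_left[OF dh] has_derivative_add[OF
        smooth_on_has_derivative[OF smooth_on_frechet_derivative[OF g that] T(2)]
        has_derivative_mult[OF has_derivative_mult_left[OF dw] dg]]])
  show ?thesis
    unfolding nabla1_def frechet_derivative_unique[OF d[of 1, simplified]] frechet_derivative_unique[OF d[of \<i>, simplified]]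
      frechet_derivative_symmetric[OF T g]
    by (simp add: wedge_def times_dt_def nabla0_def frechet_derivative_symmetric[OF T g] algebra_simps)
qed

lemma exact_form_in_E1:
  assumes T: "open T" and h: "h holomorphic_on T" and w: "w holomorphic_on T" and g: "smooth_on T g"
  shows "(\<lambda>z v. times_dt h z v - nabla0 w g z v) \<in> E1 T"
proof -
  have "linear (\<lambda>v. times_dt h z v - nabla0 w g z v)" if "z \<in> T" for z
  proof -
    have "linear (frechet_derivative g (at z))"
      using has_derivative_linear[OF smooth_on_has_derivative[OF g that]] .
    then show ?thesis
      unfolding times_dt_def nabla0_def linear_iff by (simp add: algebra_simps scaleR_conv_of_real)
  qed
  moreover have "smooth_on T (\<lambda>z. times_dt h z v - nabla0 w g z v)" if "v \<in> {1, \<i>}" for v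
    unfolding times_dt_def nabla0_def
    by (intro smooth_on_diff smooth_on_add smooth_on_mult smooth_on_const T g
        smooth_on_holomorphic[OF T h] smooth_on_holomorphic[OF T w] smooth_on_frechet_derivative[OF g that])
  ultimately show ?thesis by (simp add: E1_def)
qed

lemma nabla0_zero: "nabla0 w (\<lambda>_. 0) z v = 0"
  by (simp add: nabla0_def)

lemma times_dt_in_Z1:
  assumes T: "open T" and h: "h holomorphic_on T" and w: "w holomorphic_on T"
  shows "times_dt h \<in> Z1 T w"
  using exact_form_in_E1[OF T h w smooth_on_const[of T 0]] exact_form_closed[OF T _ h w smooth_on_const[of T 0]]
  by (auto simp: Z1_def nabla0_zero)

lemma cohom_refl: "\<eta> \<in> Z1 T w \<Longrightarrow> (\<eta>, \<eta>) \<in> cohom T w"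
  unfolding cohom_def by (auto simp: E0_def nabla0_zero intro!: exI[of _ "\<lambda>_. 0"])

lemma cohomc_refl:
  assumes "\<eta> \<in> Z1c T w"
  shows "(\<eta>, \<eta>) \<in> cohomc T w"
proof -
  have "(\<lambda>_. 0) \<in> E0c T" by (auto simp: E0c_def E0_def compactly_supported_def intro!: exI[of _ "{}"])
  then show ?thesis using assms unfolding cohomc_def by (auto simp: nabla0_zero intro!: bexI[of _ "\<lambda>_. 0"])
qed

lemma nabla0_add:
  assumes "f differentiable (at z)" "g differentiable (at z)"
  shows "nabla0 w (\<lambda>z. f z + g z) z v = nabla0 w f z v + nabla0 w g z v"
proof -
  have "((\<lambda>z. f z + g z) has_derivative (\<lambda>v. frechet_derivative f (at z) v + frechet_derivative g (at z) v)) (at z)"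
    by (intro has_derivative_add; use assms frechet_derivative_works in blast)
  from frechet_derivative_unique[OF this] show ?thesis by (simp add: nabla0_def algebra_simps)
qed

lemma nabla0_minus:
  assumes "f differentiable (at z)"
  shows "nabla0 w (\<lambda>z. - f z) z v = - nabla0 w f z v"
proof -
  have "((\<lambda>z. - f z) has_derivative (\<lambda>v. - frechet_derivative f (at z) v)) (at z)"
    by (intro has_derivative_minus; use assms frechet_derivative_works in blast)
  from frechet_derivative_unique[OF this] show ?thesis by (simp add: nabla0_def)
qed

lemma cohom_sym:
  assumes "open T" "(\<eta>, \<theta>) \<in> cohom T w"
  shows "(\<theta>, \<eta>) \<in> cohom T w"
proof -
  obtain g where g: "smooth_on T g" "\<And>z v. z \<in> T \<Longrightarrow> \<eta> z v - \<theta> z v = nabla0 w g z v"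
    using assms(2) by (auto simp: cohom_def E0_def)
  have "smooth_on T (\<lambda>z. - g z)" using smooth_on_mult[OF assms(1) smooth_on_const g(1), of "-1"] by simp
  moreover have "\<theta> z v - \<eta> z v = nabla0 w (\<lambda>z. - g z) z v" if "z \<in> T" for z v
    using nabla0_minus[OF smooth_on_differentiable[OF g(1) that]] g(2)[OF that, of v] by (simp add: algebra_simps)
  ultimately show ?thesis using assms(2) by (auto simp: cohom_def E0_def)
qed

lemma cohom_trans:
  assumes "open T" "(\<eta>, \<theta>) \<in> cohom T w" "(\<theta>, \<zeta>) \<in> cohom T w"
  shows "(\<eta>, \<zeta>) \<in> cohom T w"
proof -
  obtain f where f: "smooth_on T f" "\<And>z v. z \<in> T \<Longrightarrow> \<eta> z v - \<theta> z v = nabla0 w f z v"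
    using assms(2) by (auto simp: cohom_def E0_def)
  obtain g where g: "smooth_on T g" "\<And>z v. z \<in> T \<Longrightarrow> \<theta> z v - \<zeta> z v = nabla0 w g z v"
    using assms(3) by (auto simp: cohom_def E0_def)
  have "smooth_on T (\<lambda>z. f z + g z)" by (rule smooth_on_add[OF assms(1) f(1) g(1)])
  moreover have "\<eta> z v - \<zeta> z v = nabla0 w (\<lambda>z. f z + g z) z v" if "z \<in> T" for z v
    using nabla0_add[OF smooth_on_differentiable[OF f(1) that] smooth_on_differentiable[OF g(1) that], of w v]
      f(2)[OF that, of v] g(2)[OF that, of v] by (simp add: algebra_simps)
  ultimately show ?thesis using assms(2,3) by (auto simp: cohom_def E0_def)
qed

lemma cohom_class_eq:
  assumes "open T" "(\<eta>, \<theta>) \<in> cohom T w"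
  shows "cohom_class T w \<eta> = cohom_class T w \<theta>"
  using cohom_trans[OF assms(1)] cohom_sym[OF assms(1)] assms(2) unfolding cohom_class_def by blast

lemma cohomc_imp_cohom: "(\<eta>, \<theta>) \<in> cohomc T w \<Longrightarrow> (\<eta>, \<theta>) \<in> cohom T w"
  by (auto simp: cohomc_def cohom_def Z1c_def Z1_def E1c_def E0c_def)

text \<open>Only surjectivity of the natural map is needed: \<open>jmath\<close> then picks some compactly supported class.\<close>

lemma jmath_representative:
  assumes T: "open T" and \<eta>0: "\<eta>0 \<in> Z1c T w" "(\<omega>, \<eta>0) \<in> cohom T w"
  defines "\<eta> \<equiv> (SOME \<eta>. \<eta> \<in> jmath T w (cohom_class T w \<omega>))"
  shows "\<eta> \<in> Z1c T w" "(\<omega>, \<eta>) \<in> cohom T w"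
proof -
  let ?C = "cohom_class T w \<omega>"
  define X0 where "X0 = cohomc T w `` {\<eta>0}"
  have X0: "X0 \<in> H1c T w" using \<eta>0(1) by (auto simp: X0_def H1c_def quotient_def)
  have "natural_map T w X0 = ?C"
  proof (intro equalityI subsetI)
    fix \<theta> assume "\<theta> \<in> natural_map T w X0"
    then obtain \<zeta> where "(\<eta>0, \<zeta>) \<in> cohomc T w" "(\<zeta>, \<theta>) \<in> cohom T w" by (auto simp: natural_map_def X0_def)
    then show "\<theta> \<in> ?C"
      using cohom_trans[OF T cohom_trans[OF T \<eta>0(2) cohomc_imp_cohom]] by (auto simp: cohom_class_def)
  next
    fix \<theta> assume "\<theta> \<in> ?C"
    then have "(\<eta>0, \<theta>) \<in> cohom T w"
      using cohom_trans[OF T cohom_sym[OF T \<eta>0(2)]] by (auto simp: cohom_class_def)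
    then show "\<theta> \<in> natural_map T w X0"
      using cohomc_refl[OF \<eta>0(1)] by (auto simp: natural_map_def X0_def)
  qed
  then have im: "?C \<in> natural_map T w ` H1c T w" using X0 by blast
  define X where "X = jmath T w ?C"
  have X: "X \<in> H1c T w" "natural_map T w X = ?C"
    unfolding X_def jmath_def using inv_into_into[OF im] f_inv_into_f[OF im] by auto
  obtain \<eta>1 where \<eta>1: "\<eta>1 \<in> Z1c T w" "X = cohomc T w `` {\<eta>1}"
    using X(1) by (auto simp: H1c_def quotient_def)
  have "\<eta>1 \<in> X" using \<eta>1 cohomc_refl by auto
  then have "\<eta> \<in> X" unfolding \<eta>_def X_def by (rule someI[of "\<lambda>\<eta>. \<eta> \<in> jmath T w ?C"])
  then have c: "(\<eta>1, \<eta>) \<in> cohomc T w" using \<eta>1 by simp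
  then show "\<eta> \<in> Z1c T w" by (auto simp: cohomc_def)
  then have "\<eta> \<in> Z1 T w" by (auto simp: Z1c_def Z1_def E1c_def)
  then have "\<eta> \<in> natural_map T w X" using \<open>\<eta> \<in> X\<close> cohom_refl by (auto simp: natural_map_def)
  then show "(\<omega>, \<eta>) \<in> cohom T w" unfolding X(2) by (simp add: cohom_class_def)
qed

section \<open>Twisted cohomology of the plane punctured at finitely many points\<close>

locale twisted_plane =
  fixes P :: "complex set" and \<alpha> :: "complex \<Rightarrow> complex"
  assumes finite_P: "finite P"
    and exponents: "\<And>p. p \<in> P \<Longrightarrow> \<alpha> p \<notin> \<int>"
    and exponent_at_infinity: "(\<Sum>p\<in>P. \<alpha> p) \<notin> \<int>"
begin

abbreviation "T \<equiv> - P"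
abbreviation "w \<equiv> logf P \<alpha>"

lemma open_T: "open T"
  using finite_P by (simp add: finite_imp_closed open_Compl)

lemma holomorphic_w: "w holomorphic_on T"
  by (rule holomorphic_logf[OF finite_P])

text \<open>The factor 4 leaves room for cutoffs that vanish only from radius 2 e on and for the
  triangle inequality between two punctures.\<close>

lemma common_radius:
  assumes "\<And>p. p \<in> P \<Longrightarrow> open (U p)" "\<And>p. p \<in> P \<Longrightarrow> p \<in> U p"
  obtains e where "e > 0" "\<And>p. p \<in> P \<Longrightarrow> ball p (4 * e) \<subseteq> U p"
proof -
  have "\<forall>p\<in>P. \<exists>e. e > 0 \<and> ball p e \<subseteq> U p"
  proof
    fix p assume "p \<in> P"
    from assms[OF this] show "\<exists>e. e > 0 \<and> ball p e \<subseteq> U p" by (simp add: open_contains_ball)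
  qed
  from bchoice[OF this] obtain d where d: "\<And>p. p \<in> P \<Longrightarrow> d p > 0" "\<And>p. p \<in> P \<Longrightarrow> ball p (d p) \<subseteq> U p" by blast
  define e where "e = Min (insert 1 (d ` P)) / 4"
  have "e > 0" using finite_P d(1) by (simp add: e_def)
  moreover have "ball p (4 * e) \<subseteq> U p" if "p \<in> P" for p
  proof -
    have "4 * e \<le> d p" using finite_P that by (simp add: e_def)
    from subset_trans[OF subset_ball[OF this] d(2)[OF that]] show ?thesis .
  qed
  ultimately show ?thesis by (rule that)
qed

lemma compact_outside:
  assumes e: "e > 0"
  shows "compact (cball 0 R - (\<Union>p\<in>P. ball p e))" "cball 0 R - (\<Union>p\<in>P. ball p e) \<subseteq> T"
proof -
  show "compact (cball 0 R - (\<Union>p\<in>P. ball p e))"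
    by (intro compact_diff compact_cball open_UN) auto
  show "cball 0 R - (\<Union>p\<in>P. ball p e) \<subseteq> T" using e by auto
qed

lemma exact_near:
  assumes U: "open U" "z \<in> U" and G: "\<And>y. y \<in> U \<Longrightarrow> G y = \<psi> y"
    and \<psi>: "(\<psi> has_field_derivative (logf P r z - w z * \<psi> z)) (at z)"
  shows "times_dt (logf P r) z v - nabla0 w G z v = 0"
proof -
  have "frechet_derivative G (at z) = frechet_derivative \<psi> (at z)"
    by (rule frechet_derivative_cong_open[OF U G])
  also have "\<dots> = (*) (logf P r z - w z * \<psi> z)"
    using \<psi> by (intro frechet_derivative_unique) (simp add: has_field_derivative_def)
  finally show ?thesis using G[OF U(2)] by (simp add: times_dt_def nabla0_def algebra_simps)
qed

lemma compact_representative: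
  "\<exists>\<eta>\<in>Z1c T w. (times_dt (logf P r), \<eta>) \<in> cohom T w"
proof -
  have op: "open (- (P - {p}))" for p
    using finite_P by (intro open_Compl finite_imp_closed finite_Diff)
  obtain e where e: "e > 0" "\<And>p. p \<in> P \<Longrightarrow> ball p (4 * e) \<subseteq> - (P - {p})"
    by (rule common_radius[of "\<lambda>p. - (P - {p})", OF op]) blast+
  have sep: "4 * e \<le> dist p q" if "p \<in> P" "q \<in> P" "q \<noteq> p" for p q
    using e(2)[OF that(1)] that by (meson Diff_iff ComplD mem_ball not_le singletonD subsetD)
  have "bounded P" using finite_P by (rule finite_imp_bounded)
  then obtain R where R: "R > 0" "\<And>q. q \<in> P \<Longrightarrow> norm q \<le> R" by (auto simp: bounded_pos)
  have "\<forall>p\<in>P. \<exists>\<psi>. \<psi> holomorphic_on ball p (4 * e) \<and> (\<forall>z. 0 < dist p z \<longrightarrow> dist p z < 4 * e \<longrightarrow>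
      (\<psi> has_field_derivative (logf P r z - w z * \<psi> z)) (at z))"
  proof
    fix p assume p: "p \<in> P"
    have e4: "4 * e > 0" using e by simp
    show "\<exists>\<psi>. \<psi> holomorphic_on ball p (4 * e) \<and> (\<forall>z. 0 < dist p z \<longrightarrow> dist p z < 4 * e \<longrightarrow>
      (\<psi> has_field_derivative (logf P r z - w z * \<psi> z)) (at z))"
    proof (rule local_solution_at_puncture[where P = P and p = p and \<alpha> = \<alpha> and R = "4 * e" and r = r, OF finite_P p exponents[OF p] e4 sep[OF p]])
      fix \<psi> assume "\<psi> holomorphic_on ball p (4 * e)"
        "\<And>z. 0 < dist p z \<Longrightarrow> dist p z < 4 * e \<Longrightarrow> (\<psi> has_field_derivative (logf P r z - w z * \<psi> z)) (at z)"
      then show ?thesis by (intro exI[of _ \<psi>] conjI allI impI)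
    qed
  qed
  then obtain \<psi> where \<psi>: "\<And>p. p \<in> P \<Longrightarrow> \<psi> p holomorphic_on ball p (4 * e)"
    "\<And>p z. p \<in> P \<Longrightarrow> 0 < dist p z \<Longrightarrow> dist p z < 4 * e \<Longrightarrow> (\<psi> p has_field_derivative (logf P r z - w z * \<psi> p z)) (at z)"
    by metis
  obtain \<psi>i where \<psi>i: "\<psi>i holomorphic_on - cball 0 R"
    "\<And>z. norm z > R \<Longrightarrow> (\<psi>i has_field_derivative (logf P r z - w z * \<psi>i z)) (at z)"
  proof (rule local_solution_at_infinity[where P = P and \<alpha> = \<alpha> and R = R and r = r, OF finite_P exponent_at_infinity R])
    fix \<psi> assume "\<psi> holomorphic_on - cball 0 R" "\<And>z. R < norm z \<Longrightarrow> (\<psi> has_field_derivative (logf P r z - w z * \<psi> z)) (at z)"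
    then show ?thesis by (rule that)
  qed
  \<comment> \<open>The outer cutoff is then 1 on the small balls around the punctures, and all
    puncture cutoffs vanish beyond radius 2 R1, so the pieces of \<Psi> do not disturb each
    other.\<close>
  define R1 where "R1 = R + 4 * e"
  have R1: "R1 > 0" "R1 > R" using R e by (auto simp: R1_def)
  define A where "A = (\<lambda>p z. if z \<in> ball p (4 * e) then cutoff p e z * \<psi> p z else 0)"
  define B where "B = (\<lambda>z. if z \<in> - cball 0 R then (1 - cutoff 0 R1 z) * \<psi>i z else 0)"
  define \<Psi> where "\<Psi> = (\<lambda>z. (\<Sum>p\<in>P. A p z) + B z)"
  have sA: "smooth_on UNIV (A p)" if "p \<in> P" for p
    unfolding A_def
  proof (rule smooth_on_cutoff_extend[where C = "cball p (2 * e)"])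
    show "smooth_on (ball p (4 * e)) (\<psi> p)" by (rule smooth_on_holomorphic[OF open_ball \<psi>(1)[OF that]])
    show "cutoff p e z = 0" if "z \<notin> cball p (2 * e)" for z
      using that e by (intro cutoff_eq_0) (auto simp: dist_norm norm_minus_commute)
  qed (use e in \<open>auto intro: smooth_on_cutoff\<close>)
  have sB: "smooth_on UNIV B"
    unfolding B_def
  proof (rule smooth_on_cutoff_extend[where C = "- ball 0 R1"])
    show "smooth_on (- cball 0 R) \<psi>i" by (rule smooth_on_holomorphic[OF _ \<psi>i(1)]) auto
    show "smooth_on UNIV (\<lambda>z. 1 - cutoff 0 R1 z)" by (intro smooth_on_diff smooth_on_const smooth_on_cutoff) auto
    show "1 - cutoff 0 R1 z = 0" if "z \<notin> - ball 0 R1" for z using that R1 by (simp add: cutoff_eq_1)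
  qed (use R1 in auto)
  have s\<Psi>: "smooth_on UNIV \<Psi>" unfolding \<Psi>_def by (intro smooth_on_add smooth_on_sum sA sB) auto
  have near: "\<Psi> z = \<psi> p z" if "p \<in> P" "z \<in> ball p e" for p z
  proof -
    have zp: "dist p z < e" using that by simp
    have "A q z = 0" if "q \<in> P" "q \<noteq> p" for q
    proof -
      have "dist q z \<ge> 3 * e"
        using sep[OF \<open>p \<in> P\<close> that] zp dist_triangle[of p q z] by (simp add: dist_commute)
      then have "cutoff q e z = 0" using e by (intro cutoff_eq_0) (auto simp: dist_norm norm_minus_commute)
      then show ?thesis by (simp add: A_def)
    qed
    then have "(\<Sum>q\<in>P - {p}. A q z) = 0" by simp
    then have "(\<Sum>q\<in>P. A q z) = A p z" using sum.remove[OF finite_P that(1), of "\<lambda>q. A q z"] by simp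
    also have "A p z = \<psi> p z" using zp e by (simp add: A_def cutoff_eq_1 dist_norm norm_minus_commute)
    finally have 1: "(\<Sum>q\<in>P. A q z) = \<psi> p z" .
    have "norm z \<le> norm p + dist p z" using norm_triangle_ineq2[of z p] by (simp add: dist_norm norm_minus_commute)
    then have "norm z \<le> R1" using R(2)[OF that(1)] zp e by (simp add: R1_def)
    then have "B z = 0" using R1 by (simp add: B_def cutoff_eq_1)
    then show ?thesis using 1 by (simp add: \<Psi>_def)
  qed
  have far: "\<Psi> z = \<psi>i z" if "z \<in> - cball 0 (2 * R1)" for z
  proof -
    have z: "norm z > 2 * R1" using that by simp
    have "A q z = 0" if "q \<in> P" for q
    proof -
      have "2 * e \<le> norm (z - q)" using norm_triangle_ineq2[of z q] R(2)[OF that] z R1 R(1) e by (simp add: R1_def)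
      then have "cutoff q e z = 0" using e by (intro cutoff_eq_0) auto
      then show ?thesis by (simp add: A_def)
    qed
    moreover have "B z = \<psi>i z" using z R1 by (simp add: B_def cutoff_eq_0)
    ultimately show ?thesis by (simp add: \<Psi>_def)
  qed
  define \<eta> where "\<eta> = (\<lambda>z v. times_dt (logf P r) z v - nabla0 w \<Psi> z v)"
  have s\<Psi>T: "smooth_on T \<Psi>" by (rule smooth_on_subset[OF s\<Psi>]) simp
  note hr = holomorphic_logf[OF finite_P, of r]
  have E1: "\<eta> \<in> E1 T" unfolding \<eta>_def by (rule exact_form_in_E1[OF open_T hr holomorphic_w s\<Psi>T])
  have closed: "nabla1 w \<eta> z = 0" if "z \<in> T" for z
    unfolding \<eta>_def by (rule exact_form_closed[OF open_T that hr holomorphic_w s\<Psi>T])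
  \<comment> \<open>Off this set \<Psi> is one of the local solutions, that of a puncture or that of
    infinity, so \<eta> vanishes there by \<open>exact_near\<close>.\<close>
  let ?K = "cball 0 (2 * R1) - (\<Union>p\<in>P. ball p e)"
  have vanish: "\<eta> z v = 0" if z: "z \<in> T - ?K" for z v
  proof (cases "\<exists>p\<in>P. z \<in> ball p e")
    case True
    then obtain p where p: "p \<in> P" "z \<in> ball p e" by blast
    have "0 < dist p z" "dist p z < 4 * e" using p z e by auto
    then show ?thesis unfolding \<eta>_def
      by (intro exact_near[of "ball p e" z \<Psi> "\<psi> p"] near \<psi>(2) p) auto
  next
    case False
    then have z': "z \<in> - cball 0 (2 * R1)" using z by auto
    show ?thesis unfolding \<eta>_def
      by (rule exact_near[of "- cball 0 (2 * R1)" z \<Psi> \<psi>i]) (use z' R1 far \<psi>i(2) in auto)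
  qed
  have "compactly_supported T (\<lambda>z. \<eta> z v)" for v
    unfolding compactly_supported_def
    by (intro exI[of _ ?K] conjI ballI compact_outside[OF e(1)] vanish)
  then have "\<eta> \<in> Z1c T w" using E1 closed by (simp add: Z1c_def E1c_def)
  moreover have "(times_dt (logf P r), \<eta>) \<in> cohom T w"
    unfolding cohom_def using times_dt_in_Z1[OF open_T hr holomorphic_w] E1 closed s\<Psi>T
    by (auto simp: Z1_def E0_def \<eta>_def intro!: exI[of _ \<Psi>])
  ultimately show ?thesis by blast
qed

text \<open>\<open>E1c\<close> provides a compact set for each tangent vector separately; by real
  linearity the sets for 1 and \<i> suffice for all.\<close>

lemma common_support:
  assumes "\<eta> \<in> E1c T"
  obtains K where "compact K" "K \<subseteq> T" "\<And>z v. z \<in> T - K \<Longrightarrow> \<eta> z v = 0"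
proof -
  have ex: "\<exists>K. compact K \<and> K \<subseteq> T \<and> (\<forall>z\<in>T - K. \<eta> z v = 0)" for v
    using assms by (simp add: E1c_def compactly_supported_def)
  obtain K1 where K1: "compact K1" "K1 \<subseteq> T" "\<forall>z\<in>T - K1. \<eta> z 1 = 0" using ex[of 1] by blast
  obtain K2 where K2: "compact K2" "K2 \<subseteq> T" "\<forall>z\<in>T - K2. \<eta> z \<i> = 0" using ex[of \<i>] by blast
  note K = K1 K2
  have "\<eta> z v = 0" if "z \<in> T - (K1 \<union> K2)" for z v
  proof -
    have lin: "linear (\<eta> z)" using assms that by (auto simp: E1c_def E1_def)
    have "v = Re v *\<^sub>R 1 + Im v *\<^sub>R \<i>" by (simp add: complex_eq_iff)
    then have "\<eta> z v = \<eta> z (Re v *\<^sub>R 1 + Im v *\<^sub>R \<i>)" by simp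
    also have "\<dots> = Re v *\<^sub>R \<eta> z 1 + Im v *\<^sub>R \<eta> z \<i>"
      by (simp only: linear_add[OF lin] linear_scale[OF lin])
    finally show ?thesis using K that by simp
  qed
  then show ?thesis using K by (intro that[of "K1 \<union> K2"]) auto
qed

text \<open>As \<eta> is closed for \<nabla>_\<omega>, the \<omega> terms cancel and \<eta> \<and>
  \<nabla>_{-\<omega>} G = - d(G \<eta>), a form to which Stokes' theorem applies because \<eta> has
  compact support.\<close>

lemma wedge_exact_integral:
  assumes \<eta>: "\<eta> \<in> Z1c T w" and G: "smooth_on T G"
  shows "set_integrable lborel T (wedge \<eta> (nabla0 (\<lambda>t. - w t) G))" "(LINT z:T|lborel. wedge \<eta> (nabla0 (\<lambda>t. - w t) G) z) = 0"
proof -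
  obtain K where K: "compact K" "K \<subseteq> T" "\<And>z v. z \<in> T - K \<Longrightarrow> \<eta> z v = 0"
    using common_support[of \<eta>] \<eta> by (auto simp: Z1c_def)
  have s\<eta>: "smooth_on T (\<lambda>z. \<eta> z v)" if "v \<in> {1, \<i>}" for v using \<eta> that by (auto simp: Z1c_def E1c_def E1_def)
  have sf: "smooth_on T (\<lambda>z. G z * \<eta> z v)" if "v \<in> {1, \<i>}" for v
    by (intro smooth_on_mult open_T G s\<eta> that)
  have C1: "Ck_on 1 T (\<lambda>z. G z * \<eta> z v)" if "v \<in> {1, \<i>}" for v
    using sf[OF that] unfolding smooth_on_def by blast
  have v0: "G z * \<eta> z v = 0" if "z \<in> T - K" for z v using K(3)[OF that] by simp
  note st = stokes[OF open_T C1 K(1,2) v0]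
  have eq: "wedge \<eta> (nabla0 (\<lambda>t. - w t) G) z = frechet_derivative (\<lambda>z. G z * \<eta> z 1) (at z) \<i> - frechet_derivative (\<lambda>z. G z * \<eta> z \<i>) (at z) 1"
    if z: "z \<in> T" for z
  proof -
    have d: "frechet_derivative (\<lambda>z. G z * \<eta> z v) (at z) u
        = G z * frechet_derivative (\<lambda>z. \<eta> z v) (at z) u + frechet_derivative G (at z) u * \<eta> z v" if "v \<in> {1, \<i>}" for u v
      using frechet_derivative_unique[OF has_derivative_mult[OF smooth_on_has_derivative[OF G z] smooth_on_has_derivative[OF s\<eta>[OF that] z]]] by simp
    have "nabla1 w \<eta> z = 0" using \<eta> z by (simp add: Z1c_def)
    then have "frechet_derivative (\<lambda>y. \<eta> y 1) (at z) \<i> - frechet_derivative (\<lambda>y. \<eta> y \<i>) (at z) 1 = wedge (times_dt w) \<eta> z"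
      by (simp add: nabla1_def algebra_simps)
    then have "G z * (frechet_derivative (\<lambda>y. \<eta> y 1) (at z) \<i> - frechet_derivative (\<lambda>y. \<eta> y \<i>) (at z) 1) = G z * wedge (times_dt w) \<eta> z"
      by simp
    then show ?thesis by (simp add: d wedge_def nabla0_def times_dt_def algebra_simps)
  qed
  have meas: "T \<in> sets lborel" using open_T by simp
  show "set_integrable lborel T (wedge \<eta> (nabla0 (\<lambda>t. - w t) G))"
    using set_integral_diff(1)[OF st(1)[of 1 \<i>] st(1)[of \<i> 1]] eq
    by (subst set_integrable_cong[OF refl refl]) (auto simp: eq)
  have "(LINT z:T|lborel. wedge \<eta> (nabla0 (\<lambda>t. - w t) G) z)
     = (LINT z:T|lborel. frechet_derivative (\<lambda>z. G z * \<eta> z 1) (at z) \<i> - frechet_derivative (\<lambda>z. G z * \<eta> z \<i>) (at z) 1)"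
    by (rule set_lebesgue_integral_cong[OF meas]) (use eq in auto)
  also have "\<dots> = 0"
    using set_integral_diff(2)[OF st(1)[of 1 \<i>] st(1)[of \<i> 1]] st(2)[of 1 \<i>] st(2)[of \<i> 1] by simp
  finally show "(LINT z:T|lborel. wedge \<eta> (nabla0 (\<lambda>t. - w t) G) z) = 0" .
qed

lemma set_integrable_compact:
  fixes f :: "complex \<Rightarrow> complex"
  assumes "continuous_on T f" "compact K" "K \<subseteq> T" "\<And>z. z \<in> T - K \<Longrightarrow> f z = 0"
  shows "set_integrable lborel T f"
proof -
  have "integrable lborel (\<lambda>z. indicator K z *\<^sub>R f z)"
    by (rule borel_integrable_compact[OF assms(2) continuous_on_subset[OF assms(1,3)]])
  also have "(\<lambda>z. indicator K z *\<^sub>R f z) = (\<lambda>z. indicator T z *\<^sub>R f z)"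
    using assms(3,4) by (auto simp: fun_eq_iff indicator_def)
  finally show ?thesis by (simp add: set_integrable_def)
qed

lemma logf_residue: "p \<in> P \<Longrightarrow> ((\<lambda>z. (z - p) * logf P \<rho> z) \<longlongrightarrow> \<rho> p) (at p)"
proof -
  assume p: "p \<in> P"
  have "((\<lambda>z. \<rho> p + (z - p) * (\<Sum>q\<in>P - {p}. \<rho> q / (z - q))) \<longlongrightarrow> \<rho> p + (p - p) * (\<Sum>q\<in>P - {p}. \<rho> q / (p - q))) (at p)"
    by (intro tendsto_intros) auto
  moreover have "\<forall>\<^sub>F z in at p. \<rho> p + (z - p) * (\<Sum>q\<in>P - {p}. \<rho> q / (z - q)) = (z - p) * logf P \<rho> z"
    by (auto simp: eventually_at_filter logf_def sum.remove[OF finite_P p] distrib_left)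
  ultimately show ?thesis by (auto intro: Lim_transform_eventually)
qed

lemma logf_residue_at_infinity: "((\<lambda>z. z * logf P \<rho> z) \<longlongrightarrow> (\<Sum>p\<in>P. \<rho> p)) at_infinity"
proof -
  have "((\<lambda>z. \<Sum>p\<in>P. \<rho> p + \<rho> p * p * inverse (z + - p)) \<longlongrightarrow> (\<Sum>p\<in>P. \<rho> p + \<rho> p * p * 0)) at_infinity"
  proof -
    have "filterlim (\<lambda>z. z + - p) at_infinity at_infinity" for p :: complex
      by (rule tendsto_add_filterlim_at_infinity'[OF filterlim_ident tendsto_const])
    from filterlim_compose[OF tendsto_inverse_0 this] show ?thesis
      by (intro tendsto_sum tendsto_add tendsto_mult tendsto_const)
  qed
  moreover have "\<forall>\<^sub>F z in at_infinity. (\<Sum>p\<in>P. \<rho> p + \<rho> p * p * inverse (z + - p)) = z * logf P \<rho> z"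
  proof -
    obtain R where R: "\<And>q. q \<in> P \<Longrightarrow> norm q \<le> R" using finite_imp_bounded[OF finite_P] by (auto simp: bounded_iff)
    have "(\<Sum>p\<in>P. \<rho> p + \<rho> p * p * inverse (z + - p)) = z * logf P \<rho> z" if "norm z \<ge> R + 1" for z
      unfolding logf_def sum_distrib_left
    proof (rule sum.cong[OF refl])
      fix p assume "p \<in> P"
      then have "z - p \<noteq> 0" using R[of p] that by auto
      then show "\<rho> p + \<rho> p * p * inverse (z + - p) = z * (\<rho> p / (z - p))" by (simp add: field_simps)
    qed
    then show ?thesis unfolding eventually_at_infinity by blast
  qed
  ultimately show ?thesis by (auto intro: Lim_transform_eventually)
qed

end

section \<open>Boundary values of primitives and the intersection integral\<close>

context twisted_plane
begin

text \<open>Where \<eta> vanishes the real derivative of G is multiplication by a complex number, so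
  a merely smooth primitive is holomorphic there and solves the local differential equation.\<close>

lemma primitive_has_field_derivative:
  assumes G: "smooth_on T G" and eq: "\<And>z v. z \<in> T \<Longrightarrow> times_dt (logf P r) z v - \<eta> z v = nabla0 w G z v"
    and z: "z \<in> T" "\<And>v. \<eta> z v = 0"
  shows "(G has_field_derivative (logf P r z - w z * G z)) (at z)"
proof -
  have "frechet_derivative G (at z) v = (logf P r z - w z * G z) * v" for v
    using eq[OF z(1), of v] z(2)[of v] by (simp add: times_dt_def nabla0_def algebra_simps)
  then have "frechet_derivative G (at z) = (*) (logf P r z - w z * G z)" by (rule ext)
  with smooth_on_has_derivative[OF G z(1)] show ?thesis by (simp add: has_field_derivative_def)
qed

text \<open>In a punctured disc off the support of \<eta> the primitive solves the equation of the
  local solution. Single-valuedness makes that solution unique, so every primitive has the same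
  limit at p.\<close>

lemma primitive_tendsto_puncture:
  assumes G: "smooth_on T G" and eq: "\<And>z v. z \<in> T \<Longrightarrow> times_dt (logf P r) z v - \<eta> z v = nabla0 w G z v"
    and K: "compact K" "K \<subseteq> T" "\<And>z v. z \<in> T - K \<Longrightarrow> \<eta> z v = 0" and p: "p \<in> P"
  shows "(G \<longlongrightarrow> r p / \<alpha> p) (at p)"
proof -
  have "open (- K \<inter> - (P - {p}))"
    using finite_P K(1) by (intro open_Int open_Compl finite_imp_closed finite_Diff compact_imp_closed)
  moreover have "p \<in> - K \<inter> - (P - {p})" using K(2) p by auto
  ultimately obtain e where e: "e > 0" "ball p e \<subseteq> - K \<inter> - (P - {p})" by (rule openE)
  have T: "z \<in> T - K" if "0 < dist p z" "dist p z < e" for z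
    using e(2) that by (auto simp: subset_iff)
  have sep: "e \<le> dist p q" if "q \<in> P" "q \<noteq> p" for q
    using e(2) that by (force simp: subset_iff not_less[symmetric])
  show ?thesis
  proof (rule local_solution_at_puncture[where P = P and p = p and \<alpha> = \<alpha> and R = e and r = r, OF finite_P p exponents[OF p] e(1) sep])
    fix \<psi> assume \<psi>: "\<psi> holomorphic_on ball p e" "\<psi> p = r p / \<alpha> p"
      and u: "\<And>G e' z. e' \<le> e \<Longrightarrow> (\<And>z. 0 < dist p z \<Longrightarrow> dist p z < e' \<Longrightarrow> (G has_field_derivative (logf P r z - w z * G z)) (at z)) \<Longrightarrow>
         0 < dist p z \<Longrightarrow> dist p z < e' \<Longrightarrow> G z = \<psi> z"
    have "G z = \<psi> z" if "0 < dist p z" "dist p z < e" for z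
      using that by (intro u[of e G z] primitive_has_field_derivative[OF G eq]) (use T K(3) in auto)
    then have "\<forall>\<^sub>F z in at p. \<psi> z = G z"
      using e(1) by (auto simp: eventually_at dist_commute intro!: exI[of _ e])
    moreover have "isCont \<psi> p"
      using holomorphic_on_imp_continuous_on[OF \<psi>(1)] e(1) by (simp add: continuous_on_eq_continuous_at)
    ultimately show ?thesis
      using Lim_transform_eventually \<psi>(2) by (auto simp: isCont_def)
  qed
qed

lemma primitive_tendsto_infinity:
  assumes G: "smooth_on T G" and eq: "\<And>z v. z \<in> T \<Longrightarrow> times_dt (logf P r) z v - \<eta> z v = nabla0 w G z v"
    and K: "compact K" "K \<subseteq> T" "\<And>z v. z \<in> T - K \<Longrightarrow> \<eta> z v = 0"
  shows "(G \<longlongrightarrow> (\<Sum>p\<in>P. r p) / (\<Sum>p\<in>P. \<alpha> p)) at_infinity"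
proof -
  have "bounded (P \<union> K)" using finite_imp_bounded[OF finite_P] compact_imp_bounded[OF K(1)] by simp
  then obtain R where R: "R > 0" "\<And>q. q \<in> P \<union> K \<Longrightarrow> norm q \<le> R" by (auto simp: bounded_pos)
  have RP: "norm q \<le> R" if "q \<in> P" for q using R(2)[of q] that by simp
  have T: "z \<in> T - K" if "norm z > R" for z
    using R(2)[of z] that by auto
  show ?thesis
  proof (rule local_solution_at_infinity[where P = P and \<alpha> = \<alpha> and R = R and r = r, OF finite_P exponent_at_infinity R(1) RP])
    fix \<psi> assume \<psi>: "(\<psi> \<longlongrightarrow> (\<Sum>p\<in>P. r p) / (\<Sum>p\<in>P. \<alpha> p)) at_infinity"
      and u: "\<And>G e z. e \<ge> R \<Longrightarrow> (\<And>z. norm z > e \<Longrightarrow> (G has_field_derivative (logf P r z - w z * G z)) (at z)) \<Longrightarrow>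
         norm z > e \<Longrightarrow> G z = \<psi> z"
    have "\<psi> z = G z" if "norm z \<ge> R + 1" for z
      using that by (intro u[of R G z, symmetric] primitive_has_field_derivative[OF G eq]) (use T K(3) in auto)
    then have "\<forall>\<^sub>F z in at_infinity. \<psi> z = G z" unfolding eventually_at_infinity by blast
    with \<psi> show ?thesis by (rule Lim_transform_eventually)
  qed
qed

text \<open>The representatives are arbitrary, since \<open>jmath\<close> and the class on the other
  side give no control over the chosen ones. The last term is the contribution of infinity: there
  the residues and the exponent are minus the sums, so their quotient enters with a minus
  sign.\<close>

lemma intersection_integral:
  assumes \<eta>: "\<eta> \<in> Z1c T w" "(times_dt (logf P r), \<eta>) \<in> cohom T w"
    and \<theta>: "(times_dt (logf P \<rho>), \<theta>) \<in> cohom T (\<lambda>t. - w t)"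
  shows "(LINT z:T|lborel. wedge \<eta> \<theta> z) =
    2 * of_real pi * \<i> * ((\<Sum>p\<in>P. r p * \<rho> p / \<alpha> p) - (\<Sum>p\<in>P. r p) * (\<Sum>p\<in>P. \<rho> p) / (\<Sum>p\<in>P. \<alpha> p))"
proof -
  define h where "h = logf P \<rho>"
  have meas: "T \<in> sets lborel" using open_T by simp
  obtain G where G: "smooth_on T G" "\<And>z v. z \<in> T \<Longrightarrow> times_dt (logf P r) z v - \<eta> z v = nabla0 w G z v"
    using \<eta>(2) by (auto simp: cohom_def E0_def)
  obtain G' where G': "smooth_on T G'" "\<And>z v. z \<in> T \<Longrightarrow> times_dt h z v - \<theta> z v = nabla0 (\<lambda>t. - w t) G' z v"
    using \<theta> by (auto simp: cohom_def E0_def h_def)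
  obtain K where K: "compact K" "K \<subseteq> T" "\<And>z v. z \<in> T - K \<Longrightarrow> \<eta> z v = 0"
    using common_support[of \<eta>] \<eta> by (auto simp: Z1c_def)
  have hh: "h holomorphic_on T" unfolding h_def by (rule holomorphic_logf[OF finite_P])
  have sh: "smooth_on T h" by (rule smooth_on_holomorphic[OF open_T hh])
  define V where "V = wedge \<eta> (times_dt h)"
  \<comment> \<open>Multiples of dt drop out of the wedge product with h dt, which leaves - dG
    \<and> h dt.\<close>
  have V: "V z = h z * (frechet_derivative G (at z) \<i> - \<i> * frechet_derivative G (at z) 1)" if "z \<in> T" for z
  proof -
    have e: "\<eta> z v = times_dt (logf P r) z v - nabla0 w G z v" for v
      using G(2)[OF that, of v] by (simp add: algebra_simps)
    show ?thesis unfolding V_def wedge_def e times_dt_def nabla0_def by (simp add: algebra_simps)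
  qed
  have V0: "V z = 0" if "z \<in> T - K" for z using K(3)[OF that] by (simp add: V_def wedge_def)
  have s\<eta>: "smooth_on T (\<lambda>z. \<eta> z v)" if "v \<in> {1, \<i>}" for v using \<eta> that by (auto simp: Z1c_def E1c_def E1_def)
  have cV: "continuous_on T V"
    unfolding V_def wedge_def times_dt_def
    by (intro continuous_intros smooth_on_continuous s\<eta> sh) auto
  have iV: "set_integrable lborel T V" by (rule set_integrable_compact[OF cV K(1,2) V0])
  note ex = wedge_exact_integral[OF \<eta>(1) G'(1)]
  have "(LINT z:T|lborel. wedge \<eta> \<theta> z) = (LINT z:T|lborel. V z - wedge \<eta> (nabla0 (\<lambda>t. - w t) G') z)"
  proof (rule set_lebesgue_integral_cong[OF meas], intro allI impI)
    fix z assume "z \<in> T"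
    from G'(2)[OF this, of 1] G'(2)[OF this, of \<i>]
    have "\<theta> z 1 = times_dt h z 1 - nabla0 (\<lambda>t. - w t) G' z 1" "\<theta> z \<i> = times_dt h z \<i> - nabla0 (\<lambda>t. - w t) G' z \<i>"
      by (simp_all add: algebra_simps)
    then show "wedge \<eta> \<theta> z = V z - wedge \<eta> (nabla0 (\<lambda>t. - w t) G') z"
      unfolding V_def wedge_def by (simp only:) (simp add: algebra_simps)
  qed
  also have "\<dots> = (LINT z:T|lborel. V z)"
    using set_integral_diff(2)[OF iV ex(1)] ex(2) by simp
  finally have I0: "(LINT z:T|lborel. wedge \<eta> \<theta> z) = (LINT z:T|lborel. V z)" .

  \<comment> \<open>The factor z - p cancels the pole of h at p, and the extension by 0 makes the
    function Borel on the whole plane. The instance \<open>g 0\<close> also serves infinity, where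
    the outer cutoff is centred at 0.\<close>
  define g where "g = (\<lambda>p z. indicator T z *\<^sub>R ((z - p) * (G z * h z)))"
  have cG: "continuous_on T G" and ch: "continuous_on T h" using smooth_on_continuous G(1) sh by auto
  have mg: "g p \<in> borel_measurable borel" for p
  proof -
    have "(\<lambda>z. indicator T z *\<^sub>R ((z - p) * (G z * h z))) \<in> borel_measurable borel"
      by (rule borel_measurable_continuous_on_indicator)
        (use open_T in \<open>auto intro!: continuous_intros cG ch\<close>)
    then show ?thesis by (simp only: g_def)
  qed
  define c where "c = (\<lambda>p. r p / \<alpha> p * \<rho> p)"
  define ci where "ci = (\<Sum>p\<in>P. r p) / (\<Sum>p\<in>P. \<alpha> p) * (\<Sum>p\<in>P. \<rho> p)"
  have lim: "(g p \<longlongrightarrow> c p) (at p)" if p: "p \<in> P" for p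
  proof -
    have "((\<lambda>z. G z * ((z - p) * h z)) \<longlongrightarrow> c p) (at p)"
      unfolding c_def h_def by (intro tendsto_mult primitive_tendsto_puncture[OF G K p] logf_residue p)
    moreover have "\<forall>\<^sub>F z in at p. G z * ((z - p) * h z) = g p z"
    proof -
      have "open (- (P - {p}))" using finite_P by (intro open_Compl finite_imp_closed finite_Diff)
      then have "\<forall>\<^sub>F z in at p. z \<in> - (P - {p})" by (rule eventually_at_in_open') simp
      then show ?thesis
        by (rule eventually_mono[OF eventually_conj[OF _ eventually_neq_at_within]]) (auto simp: g_def)
    qed
    ultimately show ?thesis by (rule Lim_transform_eventually)
  qed
  have limi: "(g 0 \<longlongrightarrow> ci) at_infinity"
  proof -
    have "((\<lambda>z. G z * (z * h z)) \<longlongrightarrow> ci) at_infinity"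
      unfolding ci_def h_def by (intro tendsto_mult primitive_tendsto_infinity[OF G K] logf_residue_at_infinity)
    moreover have "\<forall>\<^sub>F z in at_infinity. G z * (z * h z) = g 0 z"
    proof -
      obtain R where R: "\<And>q. q \<in> P \<Longrightarrow> norm q \<le> R" using finite_imp_bounded[OF finite_P] by (auto simp: bounded_iff)
      have "G z * (z * h z) = g 0 z" if "norm z \<ge> R + 1" for z
        using R[of z] that by (auto simp: g_def indicator_def)
      then show ?thesis unfolding eventually_at_infinity by blast
    qed
    ultimately show ?thesis by (rule Lim_transform_eventually)
  qed

  have "\<exists>d>0. \<forall>z. 0 < dist z p \<and> dist z p < d \<longrightarrow> dist (g p z) (c p) < 1" if "p \<in> P" for p
    using lim[OF that] by (auto simp: tendsto_iff eventually_at)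
  then obtain d where d: "\<And>p. p \<in> P \<Longrightarrow> d p > 0"
    "\<And>p z. p \<in> P \<Longrightarrow> 0 < dist z p \<Longrightarrow> dist z p < d p \<Longrightarrow> dist (g p z) (c p) < 1" by metis
  \<comment> \<open>These balls lie where \<open>g p\<close> is bounded off its centre, avoid the
    support \<open>K\<close>, and contain no second puncture.\<close>
  obtain e0 where e0: "e0 > 0" "\<And>p. p \<in> P \<Longrightarrow> ball p (4 * e0) \<subseteq> ball p (d p) \<inter> (- K \<inter> - (P - {p}))"
  proof (rule common_radius[of "\<lambda>p. ball p (d p) \<inter> (- K \<inter> - (P - {p}))"])
    show "open (ball p (d p) \<inter> (- K \<inter> - (P - {p})))" for p
      using finite_P K(1) by (intro open_Int open_ball open_Compl finite_imp_closed finite_Diff compact_imp_closed)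
    show "p \<in> ball p (d p) \<inter> (- K \<inter> - (P - {p}))" if "p \<in> P" for p using d(1) K(2) that by auto
  qed (use that in blast)
  have sep: "4 * e0 \<le> dist p q" if "p \<in> P" "q \<in> P" "q \<noteq> p" for p q
  proof (rule ccontr)
    assume "\<not> ?thesis"
    then have "q \<in> ball p (4 * e0)" by simp
    then show False using e0(2)[OF that(1)] that by blast
  qed
  have Kfar: "4 * e0 \<le> dist p z" if "p \<in> P" "z \<in> K" for p z
  proof (rule ccontr)
    assume "\<not> ?thesis"
    then have "z \<in> ball p (4 * e0)" by simp
    then show False using e0(2)[OF that(1)] that by blast
  qed
  have gb: "norm (g p z) \<le> norm (c p) + 1" if "p \<in> P" "0 < dist p z" "dist p z < 4 * e0" for p z
  proof -
    have "z \<in> ball p (4 * e0)" using that by simp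
    then have "dist z p < d p" using e0(2)[OF that(1)] by (auto simp: dist_commute)
    then have "norm (g p z - c p) < 1" using d(2)[OF that(1), of z] that(2) unfolding dist_norm[symmetric] by (simp add: dist_commute)
    then show ?thesis using norm_triangle_ineq2[of "g p z" "c p"] by linarith
  qed
  obtain B where B: "\<And>z. norm z \<ge> B \<Longrightarrow> norm (g 0 z) \<le> norm ci + 1"
  proof -
    have "\<forall>\<^sub>F z in at_infinity. dist (g 0 z) ci < 1" using limi by (auto simp: tendsto_iff)
    then obtain B where B: "\<And>z. norm z \<ge> B \<Longrightarrow> dist (g 0 z) ci < 1" unfolding eventually_at_infinity by blast
    have "norm (g 0 z) \<le> norm ci + 1" if "norm z \<ge> B" for z
      using B[OF that] norm_triangle_ineq2[of "g 0 z" ci] unfolding dist_norm by linarith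
    then show ?thesis by (rule that)
  qed
  have "bounded (P \<union> K)" using finite_imp_bounded[OF finite_P] compact_imp_bounded[OF K(1)] by simp
  then obtain R where R: "R > 0" "\<And>q. q \<in> P \<union> K \<Longrightarrow> norm q \<le> R" by (auto simp: bounded_pos)
  \<comment> \<open>Beyond this radius \<open>g 0\<close> is bounded; within it lie \<open>K\<close>
    and all the small discs, so the outer cutoff is 1 on them.\<close>
  define R0 where "R0 = max B (R + 4 * e0)"
  have R0: "R0 > 0" "B \<le> R0" "R + 4 * e0 \<le> R0" using R(1) e0(1) by (auto simp: R0_def)
  define e where "e = (\<lambda>n::nat. e0 / real (Suc n))"
  define S where "S = (\<lambda>n::nat. R0 * real (Suc n))"
  have e: "e n > 0" "e n \<le> e0" for n
  proof -
    show "e n > 0" using e0 by (simp add: e_def)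
    have "e0 * 1 \<le> e0 * real (Suc n)" using e0(1) by (intro mult_left_mono) auto
    then show "e n \<le> e0" by (simp add: e_def divide_le_eq)
  qed
  have S: "S n > 0" "R0 \<le> S n" for n
  proof -
    show "S n > 0" using R0 by (simp add: S_def)
    have "R0 * 1 \<le> R0 * real (Suc n)" using R0(1) by (intro mult_left_mono) auto
    then show "R0 \<le> S n" by (simp add: S_def)
  qed
  \<comment> \<open>\<open>Y n\<close> has compact support in \<open>T\<close> and is \<open>1\<close> on the support of \<open>\<eta>\<close>, so Stokes' theorem for \<open>Y n G h dt\<close>
    leaves only the terms with \<open>d(Y n)\<close>, which concentrate at the punctures and at infinity.\<close>
  define Y where "Y = (\<lambda>n z. cutoff 0 (S n) z - (\<Sum>p\<in>P. cutoff p (e n) z))"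
  have sY: "smooth_on UNIV (Y n)" for n
    unfolding Y_def by (intro smooth_on_diff smooth_on_sum smooth_on_cutoff) auto
  have Y1: "Y n z = 1" if "z \<in> K" for n z
  proof -
    have "norm z \<le> S n" using R(2)[of z] that R0(3) S(2)[of n] e0(1) by simp
    moreover have "cutoff p (e n) z = 0" if "p \<in> P" for p
      using Kfar[OF that \<open>z \<in> K\<close>] e[of n] by (intro cutoff_eq_0) (auto simp: dist_norm norm_minus_commute)
    ultimately show ?thesis using S(1)[of n] by (simp add: Y_def cutoff_eq_1)
  qed
  have Y0: "Y n z = 0" if "z \<notin> cball 0 (2 * S n) - (\<Union>p\<in>P. ball p (e n))" for n z
  proof (cases "\<exists>p\<in>P. z \<in> ball p (e n)")
    case True
    then obtain p where p: "p \<in> P" "dist p z < e n" by auto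
    have "cutoff q (e n) z = 0" if "q \<in> P" "q \<noteq> p" for q
    proof -
      have "dist q z \<ge> 2 * e n"
        using sep[OF p(1) that] p(2) e[of n] dist_triangle[of p q z] by (simp add: dist_commute)
      then show ?thesis using e[of n] by (intro cutoff_eq_0) (auto simp: dist_norm norm_minus_commute)
    qed
    then have "(\<Sum>q\<in>P. cutoff q (e n) z) = cutoff p (e n) z"
      using sum.remove[OF finite_P p(1), of "\<lambda>q. cutoff q (e n) z"] by simp
    also have "\<dots> = 1" using p(2) e[of n] by (intro cutoff_eq_1) (auto simp: dist_norm norm_minus_commute)
    finally have 1: "(\<Sum>q\<in>P. cutoff q (e n) z) = 1" .
    have "norm z \<le> norm p + dist p z" using norm_triangle_ineq2[of z p] by (simp add: dist_norm norm_minus_commute)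
    then have "norm z \<le> S n" using R(2)[of p] p e[of n] R0(3) S(2)[of n] by simp
    then show ?thesis using 1 S(1)[of n] by (simp add: Y_def cutoff_eq_1)
  next
    case False
    then have z: "norm z > 2 * S n" using that by auto
    have "cutoff q (e n) z = 0" if "q \<in> P" for q
    proof -
      have "2 * e n \<le> norm (z - q)"
        using norm_triangle_ineq2[of z q] R(2)[of q] that z S(2)[of n] S(1)[of n] R0(3) e[of n] R(1) by simp
      then show ?thesis using e[of n] by (intro cutoff_eq_0) auto
    qed
    then show ?thesis using z S(1)[of n] by (simp add: Y_def cutoff_eq_0)
  qed
  have Vn: "(LINT z:T|lborel. V z) = (LINT z|lborel. bump 0 (S n) z * g 0 z) - (\<Sum>p\<in>P. LINT z|lborel. bump p (e n) z * g p z)" for n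
  proof -
    define f where "f = (\<lambda>z. Y n z * (G z * h z))"
    have sf: "smooth_on T f" unfolding f_def
      by (intro smooth_on_mult open_T G(1) sh smooth_on_subset[OF sY]) auto
    then have C1: "Ck_on 1 T f" unfolding smooth_on_def by blast
    have f0: "f z = 0" if "z \<in> T - (cball 0 (2 * S n) - (\<Union>p\<in>P. ball p (e n)))" for z
      using Y0[of z n] that by (simp add: f_def)
    note st = stokes[OF open_T C1 compact_outside(1)[OF e(1)[of n], of "2 * S n"] compact_outside(2)[OF e(1)[of n], of "2 * S n"] f0]
    define U where "U = (\<lambda>p r z. bump p r z * ((z - p) * (G z * h z)))"
    \<comment> \<open>This is d(Y G h dt) = Y dG \<and> h dt + G h dY \<and> dt, combined with Y V =
      V. The exact term integrates to 0 by Stokes' theorem.\<close>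
    have split: "V z = (U 0 (S n) z - (\<Sum>p\<in>P. U p (e n) z)) - (\<i> * frechet_derivative f (at z) 1 - frechet_derivative f (at z) \<i>)"
      if z: "z \<in> T" for z
    proof -
      have dc: "(cutoff p r has_derivative frechet_derivative (cutoff p r) (at z)) (at z)" for p r
        by (rule smooth_on_has_derivative[OF smooth_on_cutoff UNIV_I])
      have dh: "(h has_derivative (\<lambda>v. deriv h z * v)) (at z)"
        using holomorphic_derivI[OF hh open_T z] by (simp add: has_field_derivative_def)
      have dY: "frechet_derivative (Y n) (at z) v = frechet_derivative (cutoff 0 (S n)) (at z) v - (\<Sum>p\<in>P. frechet_derivative (cutoff p (e n)) (at z) v)" for v
        unfolding Y_def by (subst frechet_derivative_unique[OF has_derivative_diff[OF dc has_derivative_sum[OF dc]]]) simp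
      have Yw: "\<i> * frechet_derivative (Y n) (at z) 1 - frechet_derivative (Y n) (at z) \<i>
          = bump 0 (S n) z * (z - 0) - (\<Sum>p\<in>P. bump p (e n) z * (z - p))"
        unfolding dY cutoff_wedge[symmetric] by (simp add: algebra_simps sum_distrib_left sum_subtractf)
      have df: "frechet_derivative f (at z) v = Y n z * (G z * (deriv h z * v) + frechet_derivative G (at z) v * h z)
          + frechet_derivative (Y n) (at z) v * (G z * h z)" for v
        unfolding f_def
        by (subst frechet_derivative_unique[OF has_derivative_mult[OF smooth_on_has_derivative[OF sY UNIV_I]
            has_derivative_mult[OF smooth_on_has_derivative[OF G(1) z] dh]]]) simp
      have E: "\<i> * frechet_derivative f (at z) 1 - frechet_derivative f (at z) \<i>
         = - (Y n z * V z) + (\<i> * frechet_derivative (Y n) (at z) 1 - frechet_derivative (Y n) (at z) \<i>) * (G z * h z)"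
        unfolding df V[OF z] by (simp add: algebra_simps)
      have YV: "Y n z * V z = V z" using Y1[of z n] V0[of z] z by (cases "z \<in> K") auto
      show ?thesis unfolding E YV Yw U_def by (simp add: algebra_simps sum_distrib_left sum_distrib_right)
    qed
    have cU: "continuous_on T (U p r)" for p r
      unfolding U_def by (intro continuous_intros continuous_on_bump cG ch)
    have iU0: "set_integrable lborel T (U 0 (S n))"
    proof (rule set_integrable_compact[OF cU])
      show "compact (cball (0::complex) (2 * S n) - ball 0 (S n))" by (intro compact_diff compact_cball open_ball)
      show "cball 0 (2 * S n) - ball 0 (S n) \<subseteq> T"
      proof
        fix z :: complex assume "z \<in> cball 0 (2 * S n) - ball 0 (S n)"
        then show "z \<in> T" using R(2)[of z] S(2)[of n] R0(3) e0(1) by auto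
      qed
      show "U 0 (S n) z = 0" if "z \<in> T - (cball 0 (2 * S n) - ball 0 (S n))" for z
        using that S(1)[of n] bump_eq_0[of "S n" z 0] by (auto simp: U_def)
    qed
    have iUp: "set_integrable lborel T (U p (e n))" if p: "p \<in> P" for p
    proof (rule set_integrable_compact[OF cU])
      show "compact (cball p (2 * e n) - ball p (e n))" by (intro compact_diff compact_cball open_ball)
      show "cball p (2 * e n) - ball p (e n) \<subseteq> T"
      proof
        fix z assume z: "z \<in> cball p (2 * e n) - ball p (e n)"
        then have "dist p z < 4 * e0" "z \<noteq> p" using e[of n] e0(1) by auto
        then show "z \<in> T" using sep[OF p, of z] by auto
      qed
      show "U p (e n) z = 0" if "z \<in> T - (cball p (2 * e n) - ball p (e n))" for z
        using that e(1)[of n] bump_eq_0[of "e n" z p] by (auto simp: U_def dist_norm norm_minus_commute)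
    qed
    have iS: "set_integrable lborel T (\<lambda>z. \<Sum>p\<in>P. U p (e n) z)"
      using iUp unfolding set_integrable_def scaleR_sum_right by (rule Bochner_Integration.integrable_sum)
    have Ug: "(LINT z:T|lborel. U p r z) = (LINT z|lborel. bump p r z * g p z)" for p r
      unfolding set_lebesgue_integral_def
      by (intro Bochner_Integration.integral_cong refl) (simp add: U_def g_def indicator_def)
    have st1: "set_integrable lborel T (\<lambda>z. \<i> * frechet_derivative f (at z) 1)" "(LINT z:T|lborel. \<i> * frechet_derivative f (at z) 1) = 0"
      using st[of 1] by (simp_all add: set_integrable_mult_right)
    have st2: "set_integrable lborel T (\<lambda>z. \<i> * frechet_derivative f (at z) 1 - frechet_derivative f (at z) \<i>)"
       "(LINT z:T|lborel. \<i> * frechet_derivative f (at z) 1 - frechet_derivative f (at z) \<i>) = 0"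
      using set_integral_diff[OF st1(1) st(1)[of \<i>]] st1(2) st(2)[of \<i>] by simp_all
    have "(LINT z:T|lborel. V z) = (LINT z:T|lborel. (U 0 (S n) z - (\<Sum>p\<in>P. U p (e n) z)) - (\<i> * frechet_derivative f (at z) 1 - frechet_derivative f (at z) \<i>))"
      by (rule set_lebesgue_integral_cong[OF meas]) (use split in auto)
    also have "\<dots> = (LINT z:T|lborel. U 0 (S n) z - (\<Sum>p\<in>P. U p (e n) z))"
      using set_integral_diff(2)[OF set_integral_diff(1)[OF iU0 iS] st2(1)] st2(2) by simp
    also have "\<dots> = (LINT z:T|lborel. U 0 (S n) z) - (LINT z:T|lborel. (\<Sum>p\<in>P. U p (e n) z))"
      by (rule set_integral_diff(2)[OF iU0 iS])
    also have "(LINT z:T|lborel. (\<Sum>p\<in>P. U p (e n) z)) = (\<Sum>p\<in>P. LINT z:T|lborel. U p (e n) z)"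
      using iUp unfolding set_lebesgue_integral_def set_integrable_def scaleR_sum_right
      by (rule Bochner_Integration.integral_sum)
    finally show ?thesis unfolding Ug .
  qed
  have e_lim: "e \<longlonglongrightarrow> 0"
    using tendsto_mult[OF tendsto_const[of e0] LIMSEQ_inverse_real_of_nat] by (simp add: e_def divide_inverse)
  have L1: "(\<lambda>n. LINT z|lborel. bump p (e n) z * g p z) \<longlonglongrightarrow> - 2 * of_real pi * \<i> * c p" if p: "p \<in> P" for p
  proof (rule bump_approximate_identity[OF mg e(1)])
    fix u :: complex assume u: "1 \<le> norm u"
    show "(\<lambda>n. g p (p + of_real (e n) * u)) \<longlonglongrightarrow> c p"
    proof (rule filterlim_compose[OF lim[OF p]])
      have "(\<lambda>n. p + of_real (e n) * u) \<longlonglongrightarrow> p + of_real 0 * u" by (intro tendsto_intros e_lim)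
      moreover have "p + of_real (e n) * u \<noteq> p" for n using u e(1)[of n] by auto
      ultimately show "filterlim (\<lambda>n. p + of_real (e n) * u) (at p) sequentially" by (simp add: filterlim_at)
    qed
    show "norm (g p (p + of_real (e n) * u)) \<le> norm (c p) + 1" if "norm u < 2" for n
    proof (rule gb[OF p])
      have "dist p (p + of_real (e n) * u) = e n * norm u" using e(1)[of n] by (simp add: dist_norm norm_mult)
      moreover have "e n * norm u \<le> e0 * 2" using e[of n] that e0(1) by (intro mult_mono) auto
      moreover have "0 < e n * norm u" using e(1)[of n] u by (intro mult_pos_pos) auto
      ultimately show "0 < dist p (p + of_real (e n) * u)" "dist p (p + of_real (e n) * u) < 4 * e0" using e0(1) by auto
    qed
  qed
  have L2: "(\<lambda>n. LINT z|lborel. bump 0 (S n) z * g 0 z) \<longlonglongrightarrow> - 2 * of_real pi * \<i> * ci"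
  proof (rule bump_approximate_identity[OF mg S(1)])
    fix u :: complex assume u: "1 \<le> norm u"
    have nS: "norm (0 + of_real (S n) * u) \<ge> S n" for n
      using mult_left_mono[OF u, of "S n"] S(1)[of n] by (simp add: norm_mult)
    show "(\<lambda>n. g 0 (0 + of_real (S n) * u)) \<longlonglongrightarrow> ci"
    proof (rule filterlim_compose[OF limi])
      have "filterlim S at_top sequentially"
        unfolding S_def by (rule filterlim_tendsto_pos_mult_at_top[OF tendsto_const R0(1)])
          (rule filterlim_compose[OF filterlim_real_sequentially filterlim_Suc])
      then show "filterlim (\<lambda>n. 0 + of_real (S n) * u) at_infinity sequentially"
        unfolding filterlim_at_infinity_conv_norm_at_top by (rule filterlim_at_top_mono) (use nS in auto)
    qed
    show "norm (g 0 (0 + of_real (S n) * u)) \<le> norm ci + 1" for n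
      by (rule B) (use nS[of n] S(2)[of n] R0(2) in linarith)
  qed
  \<comment> \<open>The integral does not depend on n, so it equals the limit. The puncture cutoffs
    enter \<open>Y\<close> with a minus sign, which makes their contributions positive.\<close>
  have "(\<lambda>n. LINT z:T|lborel. V z) \<longlonglongrightarrow> - 2 * of_real pi * \<i> * ci - (\<Sum>p\<in>P. - 2 * of_real pi * \<i> * c p)"
  proof -
    have "(\<lambda>n. LINT z:T|lborel. V z) = (\<lambda>n. (LINT z|lborel. bump 0 (S n) z * g 0 z) - (\<Sum>p\<in>P. LINT z|lborel. bump p (e n) z * g p z))"
      by (rule ext) (rule Vn)
    then show ?thesis by (simp only:) (intro tendsto_diff tendsto_sum L1 L2)
  qed
  then have "(LINT z:T|lborel. V z) = - 2 * of_real pi * \<i> * ci - (\<Sum>p\<in>P. - 2 * of_real pi * \<i> * c p)"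
    by (simp only: LIMSEQ_const_iff)
  also have "\<dots> = 2 * of_real pi * \<i> * ((\<Sum>p\<in>P. r p * \<rho> p / \<alpha> p) - (\<Sum>p\<in>P. r p) * (\<Sum>p\<in>P. \<rho> p) / (\<Sum>p\<in>P. \<alpha> p))"
    by (simp add: c_def ci_def sum_negf sum_distrib_left algebra_simps)
  finally show ?thesis unfolding I0 .
qed

theorem intersection_form_logf:
  "intersection_form T w (cohom_class T w (times_dt (logf P r))) (cohom_class T (\<lambda>t. - w t) (times_dt (logf P \<rho>))) =
    2 * of_real pi * \<i> * ((\<Sum>p\<in>P. r p * \<rho> p / \<alpha> p) - (\<Sum>p\<in>P. r p) * (\<Sum>p\<in>P. \<rho> p) / (\<Sum>p\<in>P. \<alpha> p))"
proof -
  obtain \<eta>0 where \<eta>0: "\<eta>0 \<in> Z1c T w" "(times_dt (logf P r), \<eta>0) \<in> cohom T w"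
    using compact_representative by blast
  note \<eta> = jmath_representative[OF open_T \<eta>0]
  let ?C = "cohom_class T (\<lambda>t. - w t) (times_dt (logf P \<rho>))"
  have "times_dt (logf P \<rho>) \<in> Z1 T (\<lambda>t. - w t)"
    by (intro times_dt_in_Z1 open_T holomorphic_logf finite_P holomorphic_on_minus)
  then have "times_dt (logf P \<rho>) \<in> ?C" by (simp add: cohom_class_def cohom_refl)
  then have "(SOME \<theta>. \<theta> \<in> ?C) \<in> ?C" by (rule someI[of "\<lambda>\<theta>. \<theta> \<in> ?C"])
  then have "(times_dt (logf P \<rho>), SOME \<theta>. \<theta> \<in> ?C) \<in> cohom T (\<lambda>t. - w t)" by (simp add: cohom_class_def)
  from intersection_integral[OF \<eta> this] show ?thesis by (simp add: intersection_form_def)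
qed

end

section \<open>Growth of the coefficients\<close>

lemma eventually_ratio_bound:
  fixes g :: "nat \<Rightarrow> complex"
  assumes R: "R \<ge> 1" and ratio: "\<And>n. n \<ge> N \<Longrightarrow> norm (g (Suc n)) \<le> R * norm (g n)"
  shows "\<exists>K\<ge>0. \<forall>n. norm (g n) \<le> K * R ^ n"
proof -
  define K where "K = (\<Sum>i\<le>N. norm (g i))"
  have K: "norm (g i) \<le> K" if "i \<le> N" for i
    unfolding K_def using that by (intro member_le_sum) auto
  have K0: "K \<ge> 0" by (simp add: K_def sum_nonneg)
  have "norm (g n) \<le> K * R ^ n" for n
  proof (induction n)
    case 0
    then show ?case using K[of 0] by simp
  next
    case (Suc n)
    show ?case
    proof (cases "n \<ge> N")
      case True
      have "norm (g (Suc n)) \<le> R * (K * R ^ n)"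
        using ratio[OF True] mult_left_mono[OF Suc, of R] R by linarith
      then show ?thesis by (simp add: mult_ac)
    next
      case False
      then have "norm (g (Suc n)) \<le> K * 1" using K[of "Suc n"] by simp
      also have "\<dots> \<le> K * R ^ Suc n" by (intro mult_left_mono K0 one_le_power R)
      finally show ?thesis .
    qed
  qed
  then show ?thesis using K0 by blast
qed

text \<open>One factor may grow like a factorial while the other decays like the inverse of one.
  From n to n + 1 the product changes by the factor (u - n - 1)/(v + n), whose modulus tends to 1,
  so the growth is below R^n for every R > 1.\<close>

lemma rGamma_pair_bound_nat:
  assumes R: "R > 1"
  shows "\<exists>K\<ge>0. \<forall>n::nat. norm (rGamma (u - of_nat n) * rGamma (v + of_nat n) :: complex) \<le> K * R ^ n"
proof -
  \<comment> \<open>From here on |u| + n + 1 \<le> R (n - |v|) with a positive right side, which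
    bounds the quotient of successive terms by R.\<close>
  obtain n0 :: nat where n0: "real n0 \<ge> (1 + norm u + R * norm v) / (R - 1) + norm v + 1"
    using real_arch_simple by blast
  show ?thesis
  proof (rule eventually_ratio_bound[where N = n0])
    fix n assume n: "n \<ge> n0"
    have 1: "rGamma (u - of_nat (Suc n)) = (u - of_nat (Suc n)) * rGamma (u - of_nat n)"
      using rGamma_plus1[of "u - of_nat (Suc n)"] by (simp add: algebra_simps)
    have 2: "rGamma (v + of_nat n) = (v + of_nat n) * rGamma (v + of_nat (Suc n))"
      using rGamma_plus1[of "v + of_nat n"] by (simp add: algebra_simps)
    have rn: "real n \<ge> (1 + norm u + R * norm v) / (R - 1) + norm v + 1" using n0 n by linarith
    have q0: "(1 + norm u + R * norm v) / (R - 1) \<ge> 0" using R by (intro divide_nonneg_pos) auto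
    have nv: "norm (v + of_nat n) \<ge> real n - norm v"
      using norm_triangle_ineq2[of "of_nat n" "- v"] by (simp add: add.commute)
    have pos: "real n - norm v > 0" using rn q0 by linarith
    have "norm (u - of_nat (Suc n)) \<le> norm u + real n + 1"
      using norm_triangle_ineq4[of u "of_nat (Suc n)"] by (simp del: of_nat_Suc add: norm_of_nat)
    also have "\<dots> \<le> R * (real n - norm v)"
    proof -
      have "(1 + norm u + R * norm v) / (R - 1) \<le> real n" using rn by (smt (verit) norm_ge_zero)
      then have "1 + norm u + R * norm v \<le> real n * (R - 1)" using R by (simp add: divide_le_eq)
      then show ?thesis by (simp add: algebra_simps)
    qed
    also have "\<dots> \<le> R * norm (v + of_nat n)" using nv R by (intro mult_left_mono) auto
    finally have uv: "norm (u - of_nat (Suc n)) \<le> R * norm (v + of_nat n)" .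
    have "norm (rGamma (u - of_nat (Suc n)) * rGamma (v + of_nat (Suc n)))
        = norm (u - of_nat (Suc n)) * (norm (rGamma (u - of_nat n)) * norm (rGamma (v + of_nat (Suc n))))"
      unfolding 1 by (simp add: norm_mult mult_ac)
    also have "\<dots> \<le> (R * norm (v + of_nat n)) * (norm (rGamma (u - of_nat n)) * norm (rGamma (v + of_nat (Suc n))))"
      by (intro mult_right_mono uv) auto
    also have "\<dots> = R * norm (rGamma (u - of_nat n) * rGamma (v + of_nat n))"
      unfolding 2 by (simp only: norm_mult mult_ac)
    finally show "norm (rGamma (u - of_nat (Suc n)) * rGamma (v + of_nat (Suc n)))
      \<le> R * norm (rGamma (u - of_nat n) * rGamma (v + of_nat n))" .
  qed (use R in simp)
qed

text \<open>Only p - q enters, and its sign decides which of the two factors takes the decaying role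
  in the one-parameter bound.\<close>

lemma rGamma_pair_bound:
  assumes R: "R > 1"
  shows "\<exists>K\<ge>0. \<forall>p q :: nat. norm (rGamma (u - of_nat p + of_nat q) * rGamma (v + of_nat p - of_nat q) :: complex) \<le> K * R ^ (p + q)"
proof -
  obtain K1 where K1: "K1 \<ge> 0" "\<And>n::nat. norm (rGamma (u - of_nat n) * rGamma (v + of_nat n)) \<le> K1 * R ^ n"
    using rGamma_pair_bound_nat[OF R, of u v] by blast
  obtain K2 where K2: "K2 \<ge> 0" "\<And>n::nat. norm (rGamma (v - of_nat n) * rGamma (u + of_nat n)) \<le> K2 * R ^ n"
    using rGamma_pair_bound_nat[OF R, of v u] by blast
  have "norm (rGamma (u - of_nat p + of_nat q) * rGamma (v + of_nat p - of_nat q)) \<le> (K1 + K2) * R ^ (p + q)" for p q :: nat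
  proof (cases "q \<le> p")
    case True
    then obtain n where n: "p = q + n" using le_Suc_ex by blast
    have "norm (rGamma (u - of_nat p + of_nat q) * rGamma (v + of_nat p - of_nat q)) \<le> K1 * R ^ n"
      using K1(2)[of n] by (simp add: n algebra_simps)
    also have "\<dots> \<le> (K1 + K2) * R ^ (p + q)"
      using K1 K2 R by (intro mult_mono power_increasing) (auto simp: n)
    finally show ?thesis .
  next
    case False
    then obtain n where n: "q = p + n" using le_Suc_ex nat_le_linear by blast
    have "norm (rGamma (u - of_nat p + of_nat q) * rGamma (v + of_nat p - of_nat q)) \<le> K2 * R ^ n"
      using K2(2)[of n] by (simp add: n algebra_simps)
    also have "\<dots> \<le> (K1 + K2) * R ^ (p + q)"
      using K1 K2 R by (intro mult_mono power_increasing) (auto simp: n)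
    finally show ?thesis .
  qed
  then show ?thesis using K1(1) K2(1) by (intro exI[of _ "K1 + K2"]) auto
qed

text \<open>Every finite set of indices lies in a box, over which the sum factors into finite
  geometric sums.\<close>

lemma summable_on_geometric_PiE:
  fixes r :: real
  assumes A: "finite A" and r: "0 \<le> r" "r < 1"
  shows "(\<lambda>n. \<Prod>l\<in>A. r ^ n l) summable_on (A \<rightarrow>\<^sub>E (UNIV :: nat set))"
proof (rule nonneg_bdd_above_summable_on)
  show "0 \<le> (\<Prod>l\<in>A. r ^ n l)" for n :: "'a \<Rightarrow> nat" using r by (intro prod_nonneg) auto
  show "bdd_above (sum (\<lambda>n. \<Prod>l\<in>A. r ^ n l) ` {F. F \<subseteq> A \<rightarrow>\<^sub>E (UNIV :: nat set) \<and> finite F})"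
  proof (rule bdd_aboveI2)
    fix F assume "F \<in> {F. F \<subseteq> A \<rightarrow>\<^sub>E (UNIV :: nat set) \<and> finite F}"
    then have F: "F \<subseteq> A \<rightarrow>\<^sub>E UNIV" "finite F" by auto
    define N where "N = Max (insert 0 (\<Union>n\<in>F. n ` A))"
    have N: "n l \<le> N" if "n \<in> F" "l \<in> A" for n l
      unfolding N_def using F(2) A that by (intro Max_ge) auto
    have "F \<subseteq> A \<rightarrow>\<^sub>E {..N}" using F(1) N by (auto simp: PiE_iff subset_iff)
    then have "(\<Sum>n\<in>F. \<Prod>l\<in>A. r ^ n l) \<le> (\<Sum>n\<in>A \<rightarrow>\<^sub>E {..N}. \<Prod>l\<in>A. r ^ n l)"
      using r A by (intro sum_mono2 finite_PiE prod_nonneg) auto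
    also have "\<dots> = (\<Prod>l\<in>A. \<Sum>j\<le>N. r ^ j)" by (rule prod_sum_PiE[symmetric]) (use A in auto)
    also have "\<dots> \<le> (\<Prod>l\<in>A. 1 / (1 - r))"
    proof (rule prod_mono)
      fix l assume "l \<in> A"
      have "(\<Sum>j\<le>N. r ^ j) \<le> (\<Sum>j. r ^ j)"
        using r by (intro sum_le_suminf summable_geometric) auto
      also have "\<dots> = 1 / (1 - r)" using r by (intro suminf_geometric) auto
      finally show "0 \<le> (\<Sum>j\<le>N. r ^ j) \<and> (\<Sum>j\<le>N. r ^ j) \<le> 1 / (1 - r)" using r by (auto intro: sum_nonneg)
    qed
    finally show "(\<Sum>n\<in>F. \<Prod>l\<in>A. r ^ n l) \<le> (\<Prod>l\<in>A. 1 / (1 - r))" .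
  qed
qed

lemma sum_split_at:
  fixes f :: "nat \<Rightarrow> 'a::comm_monoid_add"
  assumes "1 \<le> k" "k \<le> m"
  shows "(\<Sum>l\<in>{1..m}. f l) = (\<Sum>l\<in>{1..<k}. f l) + f k + (\<Sum>l\<in>{k+1..m}. f l)"
proof -
  have 1: "{1..m} = insert k ({1..<k} \<union> {k+1..m})" using assms by auto
  have 2: "sum f ({1..<k} \<union> {k+1..m}) = sum f {1..<k} + sum f {k+1..m}"
    by (rule sum.union_disjoint) auto
  have 3: "sum f (insert k ({1..<k} \<union> {k+1..m})) = f k + sum f ({1..<k} \<union> {k+1..m})"
    by (rule sum.insert) auto
  show ?thesis unfolding 1 3 2 by (simp add: add_ac)
qed

lemma sum_upto_split:
  fixes f :: "nat \<Rightarrow> 'a::comm_monoid_add"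
  assumes "1 \<le> k"
  shows "(\<Sum>l\<in>{1..k}. f l) = (\<Sum>l\<in>{1..<k}. f l) + f k"
  using sum_split_at[of k k f] assms by simp

text \<open>The reciprocal Gamma factors fall into pairs with opposite shifts: one for each index l,
  and one made of the last two factors. The first kind costs R^(n_l) each and the last R^|n|, hence
  R^(2|n|) altogether.\<close>

lemma rGamma_k_summable:
  assumes k: "1 \<le> k" "k \<le> m" and q: "0 < q" "q < 1"
  shows "(\<lambda>n. norm (rGamma_k m k a b c n) * q ^ (\<Sum>l\<in>{1..m}. n l)) summable_on ({1..m} \<rightarrow>\<^sub>E (UNIV :: nat set))"
proof -
  obtain s where s: "q < s" "s < 1" using dense q by blast
  \<comment> \<open>With this choice R^2 q = s < 1, so the majorant is still geometric.\<close>
  define R where "R = sqrt (s / q)"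
  have sq: "s / q > 1" using s q by simp
  then have R: "R > 1" "R * R * q = s" using q by (auto simp: R_def)
  have "\<forall>l. \<exists>K\<ge>0. \<forall>n::nat. norm (rGamma ((if l = k then c - a else 1 - b l) - of_nat n) * rGamma (1 + of_nat n)) \<le> K * R ^ n"
    using rGamma_pair_bound_nat[OF R(1), of _ 1] by blast
  then obtain K where K: "\<And>l. K l \<ge> 0" "\<And>l n. norm (rGamma ((if l = k then c - a else 1 - b l) - of_nat n) * rGamma (1 + of_nat n)) \<le> K l * R ^ n"
    by metis
  obtain K' where K': "K' \<ge> 0" "\<And>p q::nat. norm (rGamma ((- (\<Sum>l\<in>{1..k}. b l) + c) - of_nat p + of_nat q) * rGamma ((2 + (\<Sum>l\<in>{1..<k}. b l) - c) + of_nat p - of_nat q)) \<le> K' * R ^ (p + q)"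
    using rGamma_pair_bound[OF R(1)] by blast
  have bound: "norm (rGamma_k m k a b c n) * q ^ (\<Sum>l\<in>{1..m}. n l) \<le> K' * (\<Prod>l\<in>{1..m}. K l) * (\<Prod>l\<in>{1..m}. s ^ n l)" for n
  proof -
    have "rGamma (c - a - of_nat (n k)) * (\<Prod>l\<in>{1..m} - {k}. rGamma (1 - b l - of_nat (n l))) * (\<Prod>l\<in>{1..m}. rGamma (1 + of_nat (n l)))
       = (\<Prod>l\<in>{1..m}. rGamma ((if l = k then c - a else 1 - b l) - of_nat (n l)) * rGamma (1 + of_nat (n l)))"
    proof -
      have "(\<Prod>l\<in>{1..m} - {k}. rGamma (1 - b l - of_nat (n l))) = (\<Prod>l\<in>{1..m} - {k}. rGamma ((if l = k then c - a else 1 - b l) - of_nat (n l)))"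
        by (intro prod.cong) auto
      then show ?thesis
        using prod.remove[of "{1..m}" k "\<lambda>l. rGamma ((if l = k then c - a else 1 - b l) - of_nat (n l))"] k
        by (simp add: prod.distrib)
    qed
    moreover have "norm (\<Prod>l\<in>{1..m}. rGamma ((if l = k then c - a else 1 - b l) - of_nat (n l)) * rGamma (1 + of_nat (n l)))
       \<le> (\<Prod>l\<in>{1..m}. K l * R ^ n l)"
      unfolding prod_norm[symmetric] by (rule prod_mono) (use K in auto)
    moreover have "norm (rGamma (- (\<Sum>l\<in>{1..k}. b l) + c - (\<Sum>l\<in>{1..k}. of_nat (n l)) + (\<Sum>l\<in>{k+1..m}. of_nat (n l)))
         * rGamma (2 + (\<Sum>l\<in>{1..<k}. b l) - c + (\<Sum>l\<in>{1..k}. of_nat (n l)) - (\<Sum>l\<in>{k+1..m}. of_nat (n l)))) \<le> K' * R ^ (\<Sum>l\<in>{1..m}. n l)"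
    proof -
      have "(\<Sum>l\<in>{1..m}. n l) = (\<Sum>l\<in>{1..k}. n l) + (\<Sum>l\<in>{k+1..m}. n l)"
        unfolding sum_split_at[OF k] sum_upto_split[OF k(1)] ..
      then show ?thesis using K'(2)[of "\<Sum>l\<in>{1..k}. n l" "\<Sum>l\<in>{k+1..m}. n l"] by (simp only: of_nat_sum)
    qed
    ultimately have "norm (rGamma_k m k a b c n) \<le> (\<Prod>l\<in>{1..m}. K l * R ^ n l) * (K' * R ^ (\<Sum>l\<in>{1..m}. n l))"
      unfolding rGamma_k_def mult.assoc[of _ "rGamma (- _ + _ - _ + _)"] norm_mult[of "_ * _ * _" "_ * _"]
      using K K' R(1) by (intro mult_mono) (auto intro!: prod_nonneg)
    then have "norm (rGamma_k m k a b c n) * q ^ (\<Sum>l\<in>{1..m}. n l) \<le> (\<Prod>l\<in>{1..m}. K l * R ^ n l) * (K' * R ^ (\<Sum>l\<in>{1..m}. n l)) * q ^ (\<Sum>l\<in>{1..m}. n l)"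
      using q by (intro mult_right_mono) auto
    also have "\<dots> = K' * (\<Prod>l\<in>{1..m}. K l) * ((R * R * q) ^ (\<Sum>l\<in>{1..m}. n l))"
      by (simp add: prod.distrib power_sum[symmetric] power_mult_distrib mult_ac)
    also have "\<dots> = K' * (\<Prod>l\<in>{1..m}. K l) * (\<Prod>l\<in>{1..m}. s ^ n l)" unfolding R(2) by (simp add: power_sum)
    finally show ?thesis .
  qed
  have "(\<lambda>n. K' * (\<Prod>l\<in>{1..m}. K l) * (\<Prod>l\<in>{1..m}. s ^ n l)) summable_on ({1..m} \<rightarrow>\<^sub>E (UNIV :: nat set))"
    using s q by (intro summable_on_cmult_right summable_on_geometric_PiE) auto
  then show ?thesis
    by (rule summable_on_comparison_test) (use bound q in auto)
qed

section \<open>The series as a sum over a coset of exponents\<close>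

text \<open>The exponents of the n-th term once the powers in front of the series are absorbed into
  it.\<close>

definition exponents_of :: "nat \<Rightarrow> nat \<Rightarrow> (nat \<Rightarrow> complex) \<Rightarrow> complex \<Rightarrow> (nat \<Rightarrow> nat) \<Rightarrow> nat \<Rightarrow> complex" where
  "exponents_of m k b c n = (\<lambda>l\<in>{1..m}. if l < k then - b l - of_nat (n l)
     else if l = k then (\<Sum>l\<in>{1..<k}. b l) - c + 1 + (\<Sum>l\<in>{1..k}. of_nat (n l)) - (\<Sum>l\<in>{k+1..m}. of_nat (n l))
     else of_nat (n l))"

text \<open>Unlike the image of \<open>exponents_of\<close>, this set is stable under unit shifts of
  single coordinates in both directions.\<close>

definition exponent_coset :: "nat \<Rightarrow> nat \<Rightarrow> (nat \<Rightarrow> complex) \<Rightarrow> complex \<Rightarrow> (nat \<Rightarrow> complex) set" where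
  "exponent_coset m k b c = {e \<in> {1..m} \<rightarrow>\<^sub>E UNIV. \<forall>l\<in>{1..m}. e l - exponents_of m k b c (\<lambda>_. 0) l \<in> \<int>}"

definition monomial :: "nat \<Rightarrow> nat \<Rightarrow> (nat \<Rightarrow> complex) \<Rightarrow> (nat \<Rightarrow> complex) \<Rightarrow> complex" where
  "monomial m k e x = exp (\<Sum>l\<in>{1..m}. e l * log_branch k l (x l))"

text \<open>The coefficient written through the exponents of the monomial is independent of \<open>k\<close>.\<close>

definition coeff_of ::
  "nat \<Rightarrow> complex \<Rightarrow> (nat \<Rightarrow> complex) \<Rightarrow> complex \<Rightarrow> (nat \<Rightarrow> complex) \<Rightarrow> complex" where
  "coeff_of m a b c e = rGamma (1 - a - (\<Sum>l\<in>{1..m}. e l)) * rGamma (c + (\<Sum>l\<in>{1..m}. e l))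
     * (\<Prod>l\<in>{1..m}. rGamma (1 + e l) * rGamma (1 - b l - e l))"

text \<open>The ratios x_k / x_l and x_l / x_k have degree 0, so only n_k is seen by the total
  degree. This turns c - a - n_k into 1 - a - |e| and 1 + n_k into c + |e|.\<close>

lemma sum_exponents_of:
  assumes "1 \<le> k" "k \<le> m"
  shows "(\<Sum>l\<in>{1..m}. exponents_of m k b c n l) = 1 - c + of_nat (n k)"
proof -
  have 1: "(\<Sum>l\<in>{1..<k}. exponents_of m k b c n l) = (\<Sum>l\<in>{1..<k}. - b l - of_nat (n l))"
    by (intro sum.cong) (use assms in \<open>auto simp: exponents_of_def\<close>)
  have 2: "(\<Sum>l\<in>{k+1..m}. exponents_of m k b c n l) = (\<Sum>l\<in>{k+1..m}. of_nat (n l))"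
    by (intro sum.cong) (use assms in \<open>auto simp: exponents_of_def\<close>)
  have 3: "exponents_of m k b c n k = (\<Sum>l\<in>{1..<k}. b l) - c + 1 + ((\<Sum>l\<in>{1..<k}. of_nat (n l)) + of_nat (n k)) - (\<Sum>l\<in>{k+1..m}. of_nat (n l))"
    unfolding sum_upto_split[OF assms(1), of "\<lambda>l. of_nat (n l)", symmetric] using assms by (simp add: exponents_of_def)
  show ?thesis
    unfolding sum_split_at[OF assms] 1 2 3 by (simp add: sum_subtractf sum_negf)
qed

text \<open>For l < k the two factors of index l exchange their roles, for l > k they correspond
  directly, and the factors of index k are the last two of \<open>rGamma_k\<close>.\<close>

lemma coeff_of_exponents:
  assumes k: "1 \<le> k" "k \<le> m"
  shows "coeff_of m a b c (exponents_of m k b c n) = rGamma_k m k a b c n"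
proof -
  let ?e = "exponents_of m k b c n"
  have kk: "?e k = (\<Sum>l\<in>{1..<k}. b l) - c + 1 + (\<Sum>l\<in>{1..k}. of_nat (n l)) - (\<Sum>l\<in>{k+1..m}. of_nat (n l))"
    using k by (simp add: exponents_of_def)
  have "(\<Prod>l\<in>{1..m} - {k}. rGamma (1 + ?e l) * rGamma (1 - b l - ?e l)) = (\<Prod>l\<in>{1..m} - {k}. rGamma (1 - b l - of_nat (n l)) * rGamma (1 + of_nat (n l)))"
    by (intro prod.cong) (auto simp: exponents_of_def algebra_simps)
  then have 1: "(\<Prod>l\<in>{1..m}. rGamma (1 + ?e l) * rGamma (1 - b l - ?e l))
     = rGamma (1 + ?e k) * rGamma (1 - b k - ?e k) * ((\<Prod>l\<in>{1..m} - {k}. rGamma (1 - b l - of_nat (n l))) * (\<Prod>l\<in>{1..m} - {k}. rGamma (1 + of_nat (n l))))"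
    using prod.remove[of "{1..m}" k "\<lambda>l. rGamma (1 + ?e l) * rGamma (1 - b l - ?e l)"] k by (simp add: prod.distrib)
  have 2: "(\<Prod>l\<in>{1..m}. rGamma (1 + of_nat (n l) :: complex)) = rGamma (1 + of_nat (n k)) * (\<Prod>l\<in>{1..m} - {k}. rGamma (1 + of_nat (n l)))"
    using k by (intro prod.remove) auto
  have 3: "1 + ?e k = 2 + (\<Sum>l\<in>{1..<k}. b l) - c + (\<Sum>l\<in>{1..k}. of_nat (n l)) - (\<Sum>l\<in>{k+1..m}. of_nat (n l))"
    unfolding kk by simp
  have 4: "1 - b k - ?e k = - (\<Sum>l\<in>{1..k}. b l) + c - (\<Sum>l\<in>{1..k}. of_nat (n l)) + (\<Sum>l\<in>{k+1..m}. of_nat (n l))"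
    unfolding kk sum_upto_split[OF k(1), of b] by simp
  have 5: "1 - a - (1 - c + of_nat (n k)) = c - a - of_nat (n k)" by simp
  show ?thesis
    unfolding coeff_of_def rGamma_k_def sum_exponents_of[OF k] 1 2 unfolding 3 4 5 by simp
qed

lemma exponents_of_in_coset: "exponents_of m k b c n \<in> exponent_coset m k b c"
  by (auto simp: exponent_coset_def exponents_of_def intro!: Ints_add Ints_diff Ints_sum)

lemma inj_exponents_of:
  assumes k: "1 \<le> k" "k \<le> m"
  shows "inj_on (exponents_of m k b c) ({1..m} \<rightarrow>\<^sub>E UNIV)"
proof (rule inj_onI)
  fix n n' assume n: "n \<in> {1..m} \<rightarrow>\<^sub>E UNIV" "n' \<in> {1..m} \<rightarrow>\<^sub>E UNIV" and eq: "exponents_of m k b c n = exponents_of m k b c n'"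
  have "n l = n' l" if "l \<in> {1..m}" for l
  proof (cases "l = k")
    case True
    then show ?thesis using sum_exponents_of[OF k, of b c n] sum_exponents_of[OF k, of b c n'] eq by simp
  next
    case False
    then show ?thesis using fun_cong[OF eq, of l] that by (auto simp: exponents_of_def split: if_splits)
  qed
  then show "n = n'" using n by (intro PiE_ext) auto
qed

text \<open>The reciprocal Gamma function vanishes at the nonpositive integers. A nonzero
  coefficient therefore forces - b_l - e_l for l < k, e_l for l > k, and c - 1 + |e| to be natural
  numbers; these are the n_l and n_k of a term of the series.\<close>

lemma coeff_of_vanishes:
  assumes k: "1 \<le> k" "k \<le> m" and e: "e \<in> exponent_coset m k b c" "e \<notin> exponents_of m k b c ` ({1..m} \<rightarrow>\<^sub>E UNIV)"
  shows "coeff_of m a b c e = 0"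
proof (rule ccontr)
  assume nz: "coeff_of m a b c e \<noteq> 0"
  have zero: "rGamma (1 + z) = 0" if "z \<in> \<int>" "z \<notin> \<nat>" for z :: complex
  proof -
    from that(1) obtain i :: int where i: "z = of_int i" by (rule Ints_cases)
    have "i < 0"
    proof (rule ccontr)
      assume "\<not> i < 0"
      then have "z = of_nat (nat i)" by (simp add: i)
      then show False using that(2) by simp
    qed
    then have "1 + z \<in> \<int>\<^sub>\<le>\<^sub>0" unfolding i using of_int_in_nonpos_Ints_iff[of "1 + i", where 'a = complex] by simp
    then show ?thesis by (simp add: rGamma_eq_zero_iff)
  qed
  have eI: "e l - exponents_of m k b c (\<lambda>_. 0) l \<in> \<int>" if "l \<in> {1..m}" for l using e(1) that by (auto simp: exponent_coset_def)
  have fac: "rGamma (c + (\<Sum>l\<in>{1..m}. e l)) \<noteq> 0" "\<And>l. l \<in> {1..m} \<Longrightarrow> rGamma (1 + e l) \<noteq> 0" "\<And>l. l \<in> {1..m} \<Longrightarrow> rGamma (1 - b l - e l) \<noteq> 0"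
    using nz by (auto simp: coeff_of_def)
  have low: "- b l - e l \<in> \<nat>" if "l \<in> {1..<k}" for l
  proof (rule ccontr)
    assume "- b l - e l \<notin> \<nat>"
    moreover have "- (e l - exponents_of m k b c (\<lambda>_. 0) l) \<in> \<int>" using eI[of l] that k by (simp only: minus_in_Ints_iff) auto
    then have "- b l - e l \<in> \<int>" using that k by (simp add: exponents_of_def algebra_simps)
    ultimately have "rGamma (1 + (- b l - e l)) = 0" by (intro zero)
    then show False using fac(3)[of l] that k by (simp add: algebra_simps)
  qed
  have high: "e l \<in> \<nat>" if "l \<in> {k+1..m}" for l
  proof (rule ccontr)
    assume "e l \<notin> \<nat>"
    moreover have "e l \<in> \<int>" using eI[of l] that k by (simp add: exponents_of_def)
    ultimately show False using zero[of "e l"] fac(2)[of l] that k by simp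
  qed
  have mid: "c - 1 + (\<Sum>l\<in>{1..m}. e l) \<in> \<nat>"
  proof (rule ccontr)
    assume "c - 1 + (\<Sum>l\<in>{1..m}. e l) \<notin> \<nat>"
    moreover have "(\<Sum>l\<in>{1..m}. e l - exponents_of m k b c (\<lambda>_. 0) l) \<in> \<int>" by (intro Ints_sum eI)
    then have "c - 1 + (\<Sum>l\<in>{1..m}. e l) \<in> \<int>" unfolding sum_subtractf sum_exponents_of[OF k] by (simp add: algebra_simps)
    ultimately have "rGamma (1 + (c - 1 + (\<Sum>l\<in>{1..m}. e l))) = 0" by (intro zero)
    then show False using fac(1) by simp
  qed
  have "\<forall>l\<in>{1..m}. \<exists>j::nat. of_nat j = (if l < k then - b l - e l else if l = k then c - 1 + (\<Sum>l\<in>{1..m}. e l) else e l)"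
  proof
    fix l assume l: "l \<in> {1..m}"
    have "(if l < k then - b l - e l else if l = k then c - 1 + (\<Sum>l\<in>{1..m}. e l) else e l) \<in> \<nat>"
      using low[of l] high[of l] mid l by auto
    then show "\<exists>j::nat. of_nat j = (if l < k then - b l - e l else if l = k then c - 1 + (\<Sum>l\<in>{1..m}. e l) else e l)"
      by (auto elim!: Nats_cases intro: sym)
  qed
  from bchoice[OF this] obtain n0 where n0': "\<forall>l\<in>{1..m}. of_nat (n0 l :: nat) = (if l < k then - b l - e l else if l = k then c - 1 + (\<Sum>l\<in>{1..m}. e l) else e l)"
    by (rule exE)
  define n where "n = restrict n0 {1..m}"
  have n: "of_nat (n l) = (if l < k then - b l - e l else if l = k then c - 1 + (\<Sum>l\<in>{1..m}. e l) else e l)" if "l \<in> {1..m}" for l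
    using bspec[OF n0' that] that by (simp only: n_def restrict_apply' if_True)
  have other: "exponents_of m k b c n l = e l" if "l \<in> {1..m}" "l \<noteq> k" for l
    using n[OF that(1)] that by (auto simp: exponents_of_def)
  have "(\<Sum>l\<in>{1..m}. exponents_of m k b c n l) = (\<Sum>l\<in>{1..m}. e l)"
    unfolding sum_exponents_of[OF k] using n[of k] k by simp
  moreover have "(\<Sum>l\<in>{1..m} - {k}. exponents_of m k b c n l) = (\<Sum>l\<in>{1..m} - {k}. e l)"
    by (intro sum.cong) (use other in auto)
  ultimately have "exponents_of m k b c n k = e k"
    using sum.remove[of "{1..m}" k "exponents_of m k b c n"] sum.remove[of "{1..m}" k e] k by simp
  then have 1: "exponents_of m k b c n l = e l" if "l \<in> {1..m}" for l
    using other[OF that] by (cases "l = k") blast+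
  have "e \<in> {1..m} \<rightarrow>\<^sub>E UNIV" using e(1) by (simp add: exponent_coset_def)
  moreover have "exponents_of m k b c n \<in> {1..m} \<rightarrow>\<^sub>E UNIV" by (simp add: exponents_of_def)
  ultimately have "e = exponents_of m k b c n" by (rule PiE_ext) (rule 1[symmetric])
  moreover have "n \<in> {1..m} \<rightarrow>\<^sub>E UNIV" by (simp add: n_def)
  ultimately show False using e(2) by blast
qed

lemma has_sum_exponents_of:
  assumes k: "1 \<le> k" "k \<le> m" and g: "\<And>e. coeff_of m a b c e = 0 \<Longrightarrow> g e = 0"
  shows "((\<lambda>n. g (exponents_of m k b c n)) has_sum s) ({1..m} \<rightarrow>\<^sub>E UNIV) \<longleftrightarrow> (g has_sum s) (exponent_coset m k b c)"
proof -
  have "((\<lambda>n. g (exponents_of m k b c n)) has_sum s) ({1..m} \<rightarrow>\<^sub>E UNIV) \<longleftrightarrow> (g has_sum s) (exponents_of m k b c ` ({1..m} \<rightarrow>\<^sub>E UNIV))"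
    using has_sum_reindex[OF inj_exponents_of[OF k, of b c], of g s] by (simp add: o_def)
  also have "\<dots> \<longleftrightarrow> (g has_sum s) (exponent_coset m k b c)"
    by (rule has_sum_cong_neutral) (use exponents_of_in_coset coeff_of_vanishes[OF k] g in auto)
  finally show ?thesis .
qed

subsection \<open>A polydisc around the base point\<close>

text \<open>Relative to the modulus \<xi>^l of any base coordinate the displacement is less than (1
  - \<xi>)/4. This keeps quotients of later by earlier coordinates below 1 in modulus and each
  coordinate on its side of the imaginary axis.\<close>

definition radius :: "nat \<Rightarrow> real \<Rightarrow> real" where
  "radius m \<xi> = \<xi> ^ m * ((1 - \<xi>) / 4)"

definition polydisc :: "nat \<Rightarrow> nat \<Rightarrow> real \<Rightarrow> (nat \<Rightarrow> complex) set" where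
  "polydisc m k \<xi> = {x. \<forall>l\<in>{1..m}. dist (x l) (base_point k \<xi> l) < radius m \<xi>}"

locale near_base =
  fixes m k :: nat and \<xi> :: real
  assumes k: "1 \<le> k" "k \<le> m" and \<xi>: "0 < \<xi>" "\<xi> < 1"
begin

text \<open>The largest modulus that x_{l+1} / x_l can approach under relative displacements of (1 -
  \<xi>)/4.\<close>

definition ratio :: real where
  "ratio = \<xi> * (1 + (1 - \<xi>) / 4) / (1 - (1 - \<xi>) / 4)"

lemma ratio: "0 < ratio" "ratio < 1"
proof -
  have pos: "0 < 1 + (1 - \<xi>) / 4" "0 < 1 - (1 - \<xi>) / 4" using \<xi> by (simp_all add: field_simps)
  \<comment> \<open>A quarter of this product is the difference of the two sides of the next
    inequality.\<close>
  have "(1 - \<xi>) * (3 - \<xi>) > 0" using \<xi> by simp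
  then have "\<xi> * (1 + (1 - \<xi>) / 4) < 1 - (1 - \<xi>) / 4" by (simp add: field_simps)
  then show "ratio < 1" using pos by (simp only: ratio_def divide_less_eq_1_pos)
  show "0 < ratio" using \<xi>(1) pos unfolding ratio_def by (intro divide_pos_pos mult_pos_pos)
qed

lemma radius_pos: "radius m \<xi> > 0"
  using \<xi> by (simp add: radius_def)

lemma radius_le: "l \<le> m \<Longrightarrow> radius m \<xi> \<le> \<xi> ^ l * ((1 - \<xi>) / 4)"
  unfolding radius_def using \<xi> by (intro mult_right_mono power_decreasing) auto

lemma base_point_k: "base_point k \<xi> k = - of_real (\<xi> ^ k)"
proof -
  have "exp (- (complex_of_real pi * \<i>)) = -1" using exp_pi_i' by (simp add: exp_minus mult.commute)
  then show ?thesis by (simp add: base_point_def)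
qed

lemma norm_base_point: "norm (base_point k \<xi> l) = \<xi> ^ l"
  using \<xi> base_point_k by (cases "l = k") (auto simp: base_point_def norm_mult norm_power)

lemma polydiscD: "x \<in> polydisc m k \<xi> \<Longrightarrow> l \<in> {1..m} \<Longrightarrow> dist (x l) (base_point k \<xi> l) < radius m \<xi>"
  by (simp add: polydisc_def)

lemma polydisc_norm:
  assumes "x \<in> polydisc m k \<xi>" "l \<in> {1..m}"
  shows "\<xi> ^ l * (1 - (1 - \<xi>) / 4) < norm (x l)" "norm (x l) < \<xi> ^ l * (1 + (1 - \<xi>) / 4)"
proof -
  have d: "norm (x l - base_point k \<xi> l) < \<xi> ^ l * ((1 - \<xi>) / 4)"
    using polydiscD[OF assms] radius_le[of l] assms(2) by (auto simp: dist_norm)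
  show "\<xi> ^ l * (1 - (1 - \<xi>) / 4) < norm (x l)"
    using d norm_triangle_ineq2[of "base_point k \<xi> l" "x l"]
    unfolding norm_base_point norm_minus_commute[of "base_point k \<xi> l"] right_diff_distrib[of "\<xi> ^ l" 1] by linarith
  show "norm (x l) < \<xi> ^ l * (1 + (1 - \<xi>) / 4)"
    using d norm_triangle_ineq2[of "x l" "base_point k \<xi> l"]
    unfolding norm_base_point distrib_left[of "\<xi> ^ l" 1] by linarith
qed

lemma polydisc_nonzero: "x \<in> polydisc m k \<xi> \<Longrightarrow> l \<in> {1..m} \<Longrightarrow> x l \<noteq> 0"
proof -
  assume "x \<in> polydisc m k \<xi>" "l \<in> {1..m}"
  note polydisc_norm(1)[OF this]
  moreover have "0 < \<xi> ^ l * (1 - (1 - \<xi>) / 4)" using \<xi> by (intro mult_pos_pos) auto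
  ultimately show ?thesis by auto
qed

lemma polydisc_ratio:
  assumes x: "x \<in> polydisc m k \<xi>" and l: "l \<in> {1..m}" "l' \<in> {1..m}" "l < l'"
  shows "norm (x l' / x l) \<le> ratio"
proof -
  have "norm (x l') \<le> \<xi> ^ l' * (1 + (1 - \<xi>) / 4)" using polydisc_norm(2)[OF x l(2)] by simp
  also have "\<dots> \<le> \<xi> ^ Suc l * (1 + (1 - \<xi>) / 4)"
    using l \<xi> by (intro mult_right_mono power_decreasing) auto
  also have "\<dots> = ratio * (\<xi> ^ l * (1 - (1 - \<xi>) / 4))"
    using \<xi> by (simp add: ratio_def)
  also have "\<dots> \<le> ratio * norm (x l)"
    using polydisc_norm(1)[OF x l(1)] ratio by (intro mult_left_mono) auto
  finally show ?thesis using polydisc_nonzero[OF x l(1)] by (simp add: norm_divide divide_le_eq)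
qed

lemma polydisc_norm_le:
  assumes x: "x \<in> polydisc m k \<xi>" and l: "l \<in> {1..m}"
  shows "norm (x l) \<le> ratio"
proof -
  have "norm (x l) \<le> \<xi> ^ l * (1 + (1 - \<xi>) / 4)" using polydisc_norm(2)[OF assms] by simp
  also have "\<dots> \<le> \<xi> ^ 1 * (1 + (1 - \<xi>) / 4)" using l \<xi> by (intro mult_right_mono power_decreasing) auto
  also have "\<dots> \<le> ratio"
  proof -
    have "\<xi> * (1 + (1 - \<xi>) / 4) * (1 - (1 - \<xi>) / 4) \<le> \<xi> * (1 + (1 - \<xi>) / 4) * 1"
      using \<xi> by (intro mult_left_mono) auto
    then show ?thesis using \<xi> by (simp add: ratio_def le_divide_eq)
  qed
  finally show ?thesis .
qed

lemma polydisc_distinct: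
  assumes x: "x \<in> polydisc m k \<xi>"
  shows "inj_on (\<lambda>i. if i = 0 then 0 else if i = m + 1 then 1 else x i) {0..m + 1}"
proof -
  have 1: "norm (x l) < 1" if "l \<in> {1..m}" for l using polydisc_norm_le[OF x that] ratio by simp
  have 2: "x l \<noteq> x l'" if "l \<in> {1..m}" "l' \<in> {1..m}" "l < l'" for l l'
    using polydisc_ratio[OF x that] ratio polydisc_nonzero[OF x that(1)] by auto
  have 3: "x l \<noteq> 0" "x l \<noteq> 1" if "l \<in> {1..m}" for l using polydisc_nonzero[OF x that] 1[OF that] by auto
  show ?thesis
  proof (rule linorder_inj_onI)
    fix i j assume ij: "i < j" "i \<in> {0..m + 1}" "j \<in> {0..m + 1}"
    then show "(if i = 0 then 0 else if i = m + 1 then 1 else x i) \<noteq> (if j = 0 then 0 else if j = m + 1 then 1 else x j)"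
      using 2[of i j] 3[of i] 3[of j] by auto
  qed auto
qed

text \<open>A half-plane containing the base coordinate and avoiding the cut of
  \<open>log_branch\<close>.\<close>

definition slit :: "nat \<Rightarrow> complex set" where
  "slit l = {z. if l = k then Re z < 0 else Re z > 0}"

lemma polydisc_slit:
  assumes x: "x \<in> polydisc m k \<xi>" and l: "l \<in> {1..m}"
  shows "x l \<in> slit l"
proof -
  have "radius m \<xi> < \<xi> ^ l"
  proof -
    have "radius m \<xi> \<le> \<xi> ^ l * ((1 - \<xi>) / 4)" using l by (intro radius_le) simp
    also have "\<dots> < \<xi> ^ l * 1" using \<xi> by (intro mult_strict_left_mono) auto
    finally show ?thesis by simp
  qed
  then have d: "norm (x l - base_point k \<xi> l) < \<xi> ^ l" using polydiscD[OF assms] by (simp add: dist_norm)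
  then have "\<bar>Re (x l - base_point k \<xi> l)\<bar> < \<xi> ^ l" using abs_Re_le_cmod le_less_trans by blast
  then show ?thesis
  proof (cases "l = k")
    case True
    with \<open>\<bar>Re (x l - base_point k \<xi> l)\<bar> < \<xi> ^ l\<close> base_point_k show ?thesis by (auto simp: slit_def)
  next
    case False
    with \<open>\<bar>Re (x l - base_point k \<xi> l)\<bar> < \<xi> ^ l\<close> show ?thesis by (auto simp: slit_def base_point_def)
  qed
qed

lemma log_branch_derivative:
  assumes "z \<in> slit l"
  shows "(log_branch k l has_field_derivative 1 / z) (at z)"
proof (cases "l = k")
  case True
  have z: "Re z < 0" using assms True by (simp add: slit_def)
  then have "- z \<notin> \<real>\<^sub>\<le>\<^sub>0" by (auto simp: complex_nonpos_Reals_iff)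
  then have "((\<lambda>z. Ln (- z)) has_field_derivative inverse (- z) * (-1)) (at z)"
    by (intro DERIV_chain2[OF has_field_derivative_Ln]) (auto intro!: derivative_eq_intros)
  then have "((\<lambda>z. Ln (- z) - of_real pi * \<i>) has_field_derivative 1 / z - 0) (at z)"
    by (intro DERIV_diff) (auto simp: divide_inverse)
  then show ?thesis unfolding log_branch_def [abs_def] using True by simp
next
  case False
  then have "z \<notin> \<real>\<^sub>\<le>\<^sub>0" using assms by (auto simp: slit_def complex_nonpos_Reals_iff)
  from has_field_derivative_Ln[OF this] show ?thesis
    unfolding log_branch_def [abs_def] using False by (simp add: divide_inverse)
qed

lemma exp_log_branch:
  assumes "z \<noteq> 0"
  shows "exp (log_branch k l z) = z"
  using assms exp_pi_i' by (auto simp: log_branch_def exp_diff mult.commute)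

subsection \<open>Convergence\<close>

lemma term_eq:
  assumes x: "\<forall>l\<in>{1..m}. x l \<noteq> 0"
  shows "monomial m k (exponents_of m k b c n) x =
     (\<Prod>l\<in>{1..<k}. pow_branch k l (x l) (- b l)) * pow_branch k k (x k) ((\<Sum>l\<in>{1..<k}. b l) - c + 1)
       * ((\<Prod>l\<in>{1..<k}. (x k / x l) ^ n l) * x k ^ n k * (\<Prod>l\<in>{k+1..m}. (x l / x k) ^ n l))"
proof -
  define L where "L = (\<lambda>l. log_branch k l (x l))"
  have L: "exp (L l) = x l" if "l \<in> {1..m}" for l unfolding L_def by (rule exp_log_branch[OF bspec[OF x that]])
  have 1: "(\<Prod>l\<in>{1..<k}. (x k / x l) ^ n l) = exp (\<Sum>l\<in>{1..<k}. of_nat (n l) * (L k - L l))"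
    unfolding exp_sum[OF finite_atLeastLessThan]
    by (intro prod.cong) (use k in \<open>auto simp: exp_of_nat_mult exp_diff L\<close>)
  have 2: "(\<Prod>l\<in>{k+1..m}. (x l / x k) ^ n l) = exp (\<Sum>l\<in>{k+1..m}. of_nat (n l) * (L l - L k))"
    unfolding exp_sum[OF finite_atLeastAtMost]
    by (intro prod.cong) (use k in \<open>auto simp: exp_of_nat_mult exp_diff L\<close>)
  have 3: "x k ^ n k = exp (of_nat (n k) * L k)" using k by (simp add: exp_of_nat_mult L)
  have 4: "(\<Prod>l\<in>{1..<k}. pow_branch k l (x l) (- b l)) = exp (\<Sum>l\<in>{1..<k}. - b l * L l)"
    unfolding exp_sum[OF finite_atLeastLessThan] by (simp add: pow_branch_def L_def)
  have 5: "pow_branch k k (x k) ((\<Sum>l\<in>{1..<k}. b l) - c + 1) = exp (((\<Sum>l\<in>{1..<k}. b l) - c + 1) * L k)"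
    by (simp add: pow_branch_def L_def)
  have e1: "(\<Sum>l\<in>{1..<k}. exponents_of m k b c n l * L l) = (\<Sum>l\<in>{1..<k}. - b l * L l) - (\<Sum>l\<in>{1..<k}. of_nat (n l) * L l)"
    unfolding sum_subtractf[symmetric]
    by (intro sum.cong) (use k in \<open>auto simp: exponents_of_def algebra_simps\<close>)
  have e2: "(\<Sum>l\<in>{k+1..m}. exponents_of m k b c n l * L l) = (\<Sum>l\<in>{k+1..m}. of_nat (n l) * L l)"
    by (intro sum.cong) (use k in \<open>auto simp: exponents_of_def\<close>)
  have e3: "exponents_of m k b c n k = (\<Sum>l\<in>{1..<k}. b l) - c + 1 + ((\<Sum>l\<in>{1..<k}. of_nat (n l)) + of_nat (n k)) - (\<Sum>l\<in>{k+1..m}. of_nat (n l))"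
    unfolding sum_upto_split[OF k(1), of "\<lambda>l. of_nat (n l)", symmetric] using k by (simp add: exponents_of_def)
  have mon: "monomial m k e x = exp (\<Sum>l\<in>{1..m}. e l * L l)" for e unfolding monomial_def L_def ..
  have "monomial m k (exponents_of m k b c n) x = exp ((\<Sum>l\<in>{1..<k}. - b l * L l) + ((\<Sum>l\<in>{1..<k}. b l) - c + 1) * L k
      + ((\<Sum>l\<in>{1..<k}. of_nat (n l) * (L k - L l)) + of_nat (n k) * L k + (\<Sum>l\<in>{k+1..m}. of_nat (n l) * (L l - L k))))"
    unfolding mon sum_split_at[OF k] e1 e2 e3
    by (rule arg_cong[where f = exp]) (simp only: right_diff_distrib left_diff_distrib distrib_right sum_subtractf sum_distrib_right, simp)
  then show ?thesis unfolding 1 2 3 4 5 by (simp only: exp_add mult.assoc)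
qed

text \<open>Every integer power in the series is a power of a later coordinate divided by an earlier
  one, or of x_k itself, and all of these are bounded by \<open>ratio\<close>.\<close>

lemma norm_term_le:
  assumes x: "x \<in> polydisc m k \<xi>"
  shows "norm (monomial m k (exponents_of m k b c n) x) \<le> norm (monomial m k (exponents_of m k b c (\<lambda>_. 0)) x) * ratio ^ (\<Sum>l\<in>{1..m}. n l)"
proof -
  have nz: "\<forall>l\<in>{1..m}. x l \<noteq> 0" using polydisc_nonzero[OF x] by blast
  define p where "p = (\<Prod>l\<in>{1..<k}. pow_branch k l (x l) (- b l)) * pow_branch k k (x k) ((\<Sum>l\<in>{1..<k}. b l) - c + 1)"
  have p: "monomial m k (exponents_of m k b c (\<lambda>_. 0)) x = p" unfolding term_eq[OF nz] p_def by simp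
  have "norm ((\<Prod>l\<in>{1..<k}. (x k / x l) ^ n l) * x k ^ n k * (\<Prod>l\<in>{k+1..m}. (x l / x k) ^ n l))
      \<le> (\<Prod>l\<in>{1..<k}. ratio ^ n l) * ratio ^ n k * (\<Prod>l\<in>{k+1..m}. ratio ^ n l)"
    unfolding norm_mult prod_norm[symmetric] norm_power
  proof (intro mult_mono prod_mono conjI power_mono)
    show "norm (x k / x l) \<le> ratio" if "l \<in> {1..<k}" for l using that k by (intro polydisc_ratio[OF x]) auto
    show "norm (x l / x k) \<le> ratio" if "l \<in> {k+1..m}" for l using that k by (intro polydisc_ratio[OF x]) auto
    show "norm (x k) \<le> ratio" using k by (intro polydisc_norm_le[OF x]) auto
  qed (use ratio in \<open>auto intro!: prod_nonneg mult_nonneg_nonneg\<close>)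
  also have "\<dots> = ratio ^ (\<Sum>l\<in>{1..m}. n l)"
    unfolding sum_split_at[OF k] by (simp only: power_add power_sum)
  finally show ?thesis unfolding p unfolding term_eq[OF nz] p_def[symmetric] norm_mult[of p] by (intro mult_left_mono) auto
qed

definition majorant :: "complex \<Rightarrow> (nat \<Rightarrow> complex) \<Rightarrow> complex \<Rightarrow> (nat \<Rightarrow> nat) \<Rightarrow> real" where
  "majorant a b c n = norm (rGamma_k m k a b c n) * ratio ^ (\<Sum>l\<in>{1..m}. n l)"

lemma majorant_summable: "majorant a b c summable_on ({1..m} \<rightarrow>\<^sub>E UNIV)"
  using rGamma_k_summable[OF k ratio] by (simp add: majorant_def [abs_def])

lemma norm_coeff_term_le:
  assumes x: "x \<in> polydisc m k \<xi>" and B: "norm (monomial m k (exponents_of m k b c (\<lambda>_. 0)) x) \<le> B"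
  shows "norm (rGamma_k m k a b c n * monomial m k (exponents_of m k b c n) x) \<le> B * majorant a b c n"
proof -
  have "norm (rGamma_k m k a b c n * monomial m k (exponents_of m k b c n) x)
      \<le> norm (rGamma_k m k a b c n) * (norm (monomial m k (exponents_of m k b c (\<lambda>_. 0)) x) * ratio ^ (\<Sum>l\<in>{1..m}. n l))"
    unfolding norm_mult by (intro mult_left_mono norm_term_le x) auto
  also have "\<dots> \<le> norm (rGamma_k m k a b c n) * (B * ratio ^ (\<Sum>l\<in>{1..m}. n l))"
    using B ratio by (intro mult_left_mono mult_right_mono) auto
  finally show ?thesis by (simp add: majorant_def mult_ac)
qed

lemma f_ser_eq:
  assumes x: "x \<in> polydisc m k \<xi>"
  shows "f_ser m k a b c x = (\<Sum>\<^sub>\<infinity>n\<in>{1..m} \<rightarrow>\<^sub>E UNIV. rGamma_k m k a b c n * monomial m k (exponents_of m k b c n) x)"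
proof -
  have nz: "\<forall>l\<in>{1..m}. x l \<noteq> 0" using polydisc_nonzero[OF x] by blast
  show ?thesis
    unfolding f_ser_def infsum_cmult_right'[symmetric] term_eq[OF nz] by (intro infsum_cong) (simp only: mult_ac)
qed

lemma f_ser_has_sum_nat:
  assumes x: "x \<in> polydisc m k \<xi>"
  shows "((\<lambda>n. rGamma_k m k a b c n * monomial m k (exponents_of m k b c n) x) has_sum f_ser m k a b c x) ({1..m} \<rightarrow>\<^sub>E UNIV)"
proof -
  let ?B = "norm (monomial m k (exponents_of m k b c (\<lambda>_. 0)) x)"
  have "(\<lambda>n. ?B * majorant a b c n) summable_on ({1..m} \<rightarrow>\<^sub>E UNIV)"
    by (rule summable_on_cmult_right[OF majorant_summable])
  then have "(\<lambda>n. norm (rGamma_k m k a b c n * monomial m k (exponents_of m k b c n) x)) summable_on ({1..m} \<rightarrow>\<^sub>E UNIV)"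
    by (rule summable_on_comparison_test) (rule norm_coeff_term_le[OF x order_refl], rule norm_ge_zero)
  from has_sum_infsum[OF abs_summable_summable[OF this]] show ?thesis unfolding f_ser_eq[OF x] .
qed

lemma f_ser_has_sum:
  assumes x: "x \<in> polydisc m k \<xi>"
  shows "((\<lambda>e. coeff_of m a b c e * monomial m k e x) has_sum f_ser m k a b c x) (exponent_coset m k b c)"
proof -
  have "coeff_of m a b c e = 0 \<Longrightarrow> coeff_of m a b c e * monomial m k e x = 0" for e by simp
  note has_sum_exponents_of[where m = m and k = k and a = a and b = b and c = c
      and g = "\<lambda>e. coeff_of m a b c e * monomial m k e x" and s = "f_ser m k a b c x", OF k this]
  then show ?thesis using f_ser_has_sum_nat[OF x, of a b c] unfolding coeff_of_exponents[OF k] by blast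
qed

lemma polydisc_update:
  assumes x: "x \<in> polydisc m k \<xi>" and i: "i \<in> {1..m}"
  obtains r where "r > 0" "\<And>z. z \<in> cball (x i) r \<Longrightarrow> x(i := z) \<in> polydisc m k \<xi>"
proof -
  define r where "r = (radius m \<xi> - dist (x i) (base_point k \<xi> i)) / 2"
  have r: "r > 0" using polydiscD[OF x i] by (simp add: r_def)
  have "x(i := z) \<in> polydisc m k \<xi>" if "z \<in> cball (x i) r" for z
  proof -
    have "dist z (base_point k \<xi> i) \<le> r + dist (x i) (base_point k \<xi> i)"
      using that dist_triangle[of z "base_point k \<xi> i" "x i"] by (simp add: dist_commute)
    also have "\<dots> < radius m \<xi>" using r by (simp add: r_def field_simps)
    finally show ?thesis using x by (auto simp: polydisc_def)
  qed
  with r show ?thesis by (rule that)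
qed

lemma monomial_derivative:
  assumes x: "x \<in> polydisc m k \<xi>" and i: "i \<in> {1..m}"
  shows "((\<lambda>z. monomial m k e (x(i := z))) has_field_derivative e i * monomial m k e x / x i) (at (x i))"
proof -
  define C where "C = (\<Sum>l\<in>{1..m} - {i}. e l * log_branch k l (x l))"
  have mon: "monomial m k e (x(i := z)) = exp (e i * log_branch k i z + C)" for z
  proof -
    have "(\<Sum>l\<in>{1..m} - {i}. e l * log_branch k l ((x(i := z)) l)) = C"
      unfolding C_def by (intro sum.cong) auto
    then show ?thesis unfolding monomial_def using sum.remove[of "{1..m}" i "\<lambda>l. e l * log_branch k l ((x(i := z)) l)"] i by simp
  qed
  have "((\<lambda>z. exp (e i * log_branch k i z + C)) has_field_derivative exp (e i * log_branch k i (x i) + C) * (e i * (1 / x i) + 0)) (at (x i))"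
    by (intro DERIV_chain2[OF DERIV_exp] DERIV_add DERIV_cmult DERIV_const log_branch_derivative polydisc_slit x i)
  moreover have "exp (e i * log_branch k i (x i) + C) = monomial m k e x" using mon[of "x i"] by simp
  ultimately show ?thesis unfolding mon by (simp add: mult.commute)
qed

text \<open>A majorant for the functions on a disc is enough: the finite partial sums converge
  uniformly by the Weierstrass test, and for holomorphic functions uniform convergence passes to the
  derivatives.\<close>

lemma infsum_has_field_derivative:
  fixes f :: "'i \<Rightarrow> complex \<Rightarrow> complex"
  assumes r: "r > 0" and f: "\<And>n z. n \<in> I \<Longrightarrow> z \<in> cball z0 r \<Longrightarrow> (f n has_field_derivative f' n z) (at z)"
    and bound: "\<And>n z. n \<in> I \<Longrightarrow> z \<in> cball z0 r \<Longrightarrow> norm (f n z) \<le> M n" and M: "M summable_on I"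
  obtains D where "((\<lambda>z. \<Sum>\<^sub>\<infinity>n\<in>I. f n z) has_field_derivative D) (at z0)" "((\<lambda>n. f' n z0) has_sum D) I"
proof -
  let ?F = "finite_subsets_at_top I"
  have u: "uniform_limit (cball z0 r) (\<lambda>X z. \<Sum>n\<in>X. f n z) (\<lambda>z. \<Sum>\<^sub>\<infinity>n\<in>I. f n z) ?F"
    by (rule Weierstrass_m_test_general[OF _ M]) (rule bound)
  have ev: "\<forall>\<^sub>F X in ?F. X \<subseteq> I" by (auto simp: eventually_finite_subsets_at_top intro: exI[of _ "{}"])
  have d: "((\<lambda>z. \<Sum>n\<in>X. f n z) has_field_derivative (\<Sum>n\<in>X. f' n z)) (at z)" if "X \<subseteq> I" "z \<in> cball z0 r" for X z
    using that by (intro DERIV_sum f) auto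
  have cont: "\<forall>\<^sub>F X in ?F. continuous_on (cball z0 r) (\<lambda>z. \<Sum>n\<in>X. f n z) \<and>
      (\<forall>z\<in>ball z0 r. ((\<lambda>z. \<Sum>n\<in>X. f n z) has_field_derivative (\<Sum>n\<in>X. f' n z)) (at z))"
    using ev
  proof (rule eventually_mono)
    fix X assume X: "X \<subseteq> I"
    show "continuous_on (cball z0 r) (\<lambda>z. \<Sum>n\<in>X. f n z) \<and>
      (\<forall>z\<in>ball z0 r. ((\<lambda>z. \<Sum>n\<in>X. f n z) has_field_derivative (\<Sum>n\<in>X. f' n z)) (at z))"
    proof (intro conjI ballI)
      show "continuous_on (cball z0 r) (\<lambda>z. \<Sum>n\<in>X. f n z)"
        by (rule continuous_at_imp_continuous_on) (use DERIV_isCont[OF d[OF X]] in auto)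
    qed (use d[OF X] in auto)
  qed
  show ?thesis
  proof (rule has_complex_derivative_uniform_limit[OF cont u finite_subsets_at_top_neq_bot r])
    fix g' assume "\<And>w. w \<in> ball z0 r \<Longrightarrow> ((\<lambda>z. \<Sum>\<^sub>\<infinity>n\<in>I. f n z) has_field_derivative g' w) (at w) \<and> ((\<lambda>X. \<Sum>n\<in>X. f' n w) \<longlongrightarrow> g' w) ?F"
    from this[of z0] show ?thesis using r by (intro that[of "g' z0"]) (auto simp: has_sum_def)
  qed
qed

lemma f_ser_derivative:
  assumes x: "x \<in> polydisc m k \<xi>" and i: "i \<in> {1..m}"
  obtains D where "((\<lambda>z. f_ser m k a b c (x(i := z))) has_field_derivative D) (at (x i))"
    "((\<lambda>e. e i * (coeff_of m a b c e * monomial m k e x)) has_sum x i * D) (exponent_coset m k b c)"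
proof -
  obtain r where r: "r > 0" "\<And>z. z \<in> cball (x i) r \<Longrightarrow> x(i := z) \<in> polydisc m k \<xi>"
    using polydisc_update[OF x i] by blast
  define f where "f = (\<lambda>n z. rGamma_k m k a b c n * monomial m k (exponents_of m k b c n) (x(i := z)))"
  define f' where "f' = (\<lambda>n z. rGamma_k m k a b c n * (exponents_of m k b c n i * monomial m k (exponents_of m k b c n) (x(i := z)) / z))"
  have dm: "((\<lambda>z. monomial m k e (x(i := z))) has_field_derivative e i * monomial m k e (x(i := z)) / z) (at z)" if "z \<in> cball (x i) r" for e z
    using monomial_derivative[OF r(2)[OF that] i, of e] by simp
  have df: "(f n has_field_derivative f' n z) (at z)" if "z \<in> cball (x i) r" for n z
    unfolding f_def f'_def by (intro DERIV_cmult dm that)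
  have "continuous_on (cball (x i) r) (\<lambda>z. monomial m k (exponents_of m k b c (\<lambda>_. 0)) (x(i := z)))"
    by (rule continuous_at_imp_continuous_on) (use DERIV_isCont[OF dm] in auto)
  then have "bounded ((\<lambda>z. monomial m k (exponents_of m k b c (\<lambda>_. 0)) (x(i := z))) ` cball (x i) r)"
    by (intro compact_imp_bounded compact_continuous_image) auto
  then obtain B where "\<forall>y\<in>(\<lambda>z. monomial m k (exponents_of m k b c (\<lambda>_. 0)) (x(i := z))) ` cball (x i) r. norm y \<le> B"
    unfolding bounded_iff by (rule exE)
  \<comment> \<open>The term with n = 0 is bounded on the compact disc, so \<open>B\<close> times
    \<open>majorant\<close> dominates the series uniformly in the varied coordinate.\<close>
  then have B: "norm (monomial m k (exponents_of m k b c (\<lambda>_. 0)) (x(i := z))) \<le> B" if "z \<in> cball (x i) r" for z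
    using that by blast
  have bd: "norm (f n z) \<le> B * majorant a b c n" if "z \<in> cball (x i) r" for n z
    unfolding f_def by (rule norm_coeff_term_le[OF r(2)[OF that] B[OF that]])
  obtain D where D: "((\<lambda>z. \<Sum>\<^sub>\<infinity>n\<in>{1..m} \<rightarrow>\<^sub>E UNIV. f n z) has_field_derivative D) (at (x i))"
    "((\<lambda>n. f' n (x i)) has_sum D) ({1..m} \<rightarrow>\<^sub>E UNIV)"
    by (rule infsum_has_field_derivative[OF r(1) df bd summable_on_cmult_right[OF majorant_summable]])
  have xi: "x i \<noteq> 0" by (rule polydisc_nonzero[OF x i])
  show ?thesis
  proof (rule that[of D])
    show "((\<lambda>z. f_ser m k a b c (x(i := z))) has_field_derivative D) (at (x i))"
    proof (rule has_field_derivative_transform_within_open[OF D(1), of "ball (x i) r"])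
      show "(\<Sum>\<^sub>\<infinity>n\<in>{1..m} \<rightarrow>\<^sub>E UNIV. f n z) = f_ser m k a b c (x(i := z))" if "z \<in> ball (x i) r" for z
        unfolding f_def by (rule f_ser_eq[symmetric]) (use r(2)[of z] that in auto)
    qed (use r(1) in auto)
    have "((\<lambda>n. x i * f' n (x i)) has_sum x i * D) ({1..m} \<rightarrow>\<^sub>E UNIV)" by (rule has_sum_cmult_right[OF D(2)])
    moreover have "x i * f' n (x i) = exponents_of m k b c n i * (coeff_of m a b c (exponents_of m k b c n) * monomial m k (exponents_of m k b c n) x)" for n
      using xi unfolding coeff_of_exponents[OF k] by (simp add: f'_def)
    ultimately show "((\<lambda>e. e i * (coeff_of m a b c e * monomial m k e x)) has_sum x i * D) (exponent_coset m k b c)"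
      by (subst has_sum_exponents_of[OF k, of a b c, symmetric]) simp_all
  qed
qed

end

section \<open>Contiguity relations\<close>

lemma sum_fun_upd:
  fixes e :: "nat \<Rightarrow> complex"
  assumes "finite A" "i \<in> A"
  shows "(\<Sum>l\<in>A. (e(i := y)) l) = (\<Sum>l\<in>A. e l) - e i + y"
proof -
  have "(\<Sum>l\<in>A - {i}. (e(i := y)) l) = (\<Sum>l\<in>A - {i}. e l)" by (intro sum.cong) auto
  then show ?thesis using sum.remove[OF assms, of "e(i := y)"] sum.remove[OF assms, of e] by simp
qed

definition gamma_prod :: "nat \<Rightarrow> (nat \<Rightarrow> complex) \<Rightarrow> (nat \<Rightarrow> complex) \<Rightarrow> complex" where
  "gamma_prod m b e = (\<Prod>l\<in>{1..m}. rGamma (1 + e l) * rGamma (1 - b l - e l))"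

lemma gamma_prod_split:
  assumes "i \<in> {1..m}"
  shows "gamma_prod m (b(i := \<beta>)) (e(i := y)) =
    rGamma (1 + y) * rGamma (1 - \<beta> - y) * (\<Prod>l\<in>{1..m} - {i}. rGamma (1 + e l) * rGamma (1 - b l - e l))"
proof -
  have "(\<Prod>l\<in>{1..m} - {i}. rGamma (1 + (e(i := y)) l) * rGamma (1 - (b(i := \<beta>)) l - (e(i := y)) l))
     = (\<Prod>l\<in>{1..m} - {i}. rGamma (1 + e l) * rGamma (1 - b l - e l))"
    by (intro prod.cong) auto
  then show ?thesis unfolding gamma_prod_def
    using prod.remove[of "{1..m}" i "\<lambda>l. rGamma (1 + (e(i := y)) l) * rGamma (1 - (b(i := \<beta>)) l - (e(i := y)) l)"] assms by simp
qed

text \<open>Both affected factors change by the functional equation of the Gamma function. Keeping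
  \<open>e i + 1\<close> as a multiplier makes the identity valid where it vanishes.\<close>

lemma gamma_prod_raise:
  assumes "i \<in> {1..m}"
  shows "(e i + 1) * gamma_prod m b (e(i := e i + 1)) = - (b i + e i) * gamma_prod m b e"
proof -
  have "(e i + 1) * rGamma (1 + (e i + 1)) = rGamma (1 + e i)" using rGamma_plus1[of "1 + e i"] by (simp add: add_ac)
  moreover have "rGamma (1 - b i - (e i + 1)) = - (b i + e i) * rGamma (1 - b i - e i)"
    using rGamma_plus1[of "- b i - e i"] by (simp add: algebra_simps)
  ultimately show ?thesis
    using gamma_prod_split[OF assms, of b "b i" e "e i + 1"] gamma_prod_split[OF assms, of b "b i" e "e i"]
    by (simp only: fun_upd_triv) (simp only: mult.assoc[symmetric], simp only: mult_ac)
qed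

lemma gamma_prod_lower:
  assumes "i \<in> {1..m}"
  shows "gamma_prod m b (e(i := e i - 1)) = e i * gamma_prod m (b(i := b i - 1)) e"
    "gamma_prod m b e = (1 - b i - e i) * gamma_prod m (b(i := b i - 1)) e"
proof -
  have 1: "rGamma (1 + (e i - 1)) = e i * rGamma (1 + e i)" using rGamma_plus1[of "e i"] by (simp add: add_ac)
  have 2: "1 - b i - (e i - 1) = 1 - (b i - 1) - e i" by simp
  show "gamma_prod m b (e(i := e i - 1)) = e i * gamma_prod m (b(i := b i - 1)) e"
    using gamma_prod_split[OF assms, of b "b i" e "e i - 1"] gamma_prod_split[OF assms, of b "b i - 1" e "e i"]
    by (simp only: fun_upd_triv 1 2 mult.assoc)
  have 3: "rGamma (1 - b i - e i) = (1 - b i - e i) * rGamma (1 - (b i - 1) - e i)"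
    using rGamma_plus1[of "1 - b i - e i"] by (simp add: algebra_simps)
  show "gamma_prod m b e = (1 - b i - e i) * gamma_prod m (b(i := b i - 1)) e"
    using gamma_prod_split[OF assms, of b "b i" e "e i"] gamma_prod_split[OF assms, of b "b i - 1" e "e i"]
    by (simp only: fun_upd_triv 3 mult_ac)
qed

lemma coeff_of_eq: "coeff_of m a b c e = rGamma (1 - a - (\<Sum>l\<in>{1..m}. e l)) * rGamma (c + (\<Sum>l\<in>{1..m}. e l)) * gamma_prod m b e"
  by (simp add: coeff_of_def gamma_prod_def)

lemma rGamma_step:
  assumes "w = z + 1"
  shows "rGamma z = z * rGamma (w :: complex)"
  using rGamma_plus1[of z] assms by simp

lemma coeff_a:
  "coeff_of m a b c e = (1 - a - (\<Sum>l\<in>{1..m}. e l)) * coeff_of m (a - 1) b c e"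
proof -
  define S where "S = (\<Sum>l\<in>{1..m}. e l)"
  have 1: "rGamma (1 - a - S) = (1 - a - S) * rGamma (1 - (a - 1) - S)" by (rule rGamma_step) simp
  show ?thesis unfolding coeff_of_eq S_def[symmetric] 1 by (simp only: mult_ac)
qed

lemma coeff_c:
  "coeff_of m a b (c - 1) e = (c - 1 + (\<Sum>l\<in>{1..m}. e l)) * coeff_of m a b c e"
proof -
  define S where "S = (\<Sum>l\<in>{1..m}. e l)"
  have 1: "rGamma (c - 1 + S) = (c - 1 + S) * rGamma (c + S)" by (rule rGamma_step) simp
  show ?thesis unfolding coeff_of_eq S_def[symmetric] 1 by (simp only: mult_ac)
qed

text \<open>The coefficient form of \<open>relation_derivative\<close>: the i-th derivative has at
  the exponent e the coefficient e_i + 1 times the one at e raised by 1 in coordinate i.\<close>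

lemma coeff_relation_derivative:
  assumes i: "i \<in> {1..m}"
  shows "(a - c) * ((e i + 1) * coeff_of m (a - 1) b c (e(i := e i + 1)))
    = b i * coeff_of m a b c e + e i * coeff_of m a b c e - (e i + 1) * coeff_of m a b c (e(i := e i + 1))"
proof -
  define S where "S = (\<Sum>l\<in>{1..m}. e l)"
  have S': "(\<Sum>l\<in>{1..m}. (e(i := e i + 1)) l) = S + 1" using sum_fun_upd[of "{1..m}" i e "e i + 1"] i by (simp add: S_def)
  \<comment> \<open>All coefficients involved are polynomial multiples of X, which reduces the claim
    to (c + S) - (a + S) = c - a.\<close>
  define X where "X = rGamma (1 - a - S) * rGamma (c + S + 1) * gamma_prod m b e"
  note g = gamma_prod_raise[OF i, of e b]
  have 1: "(e i + 1) * coeff_of m (a - 1) b c (e(i := e i + 1)) = - (b i + e i) * X"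
  proof -
    have "(e i + 1) * coeff_of m (a - 1) b c (e(i := e i + 1)) = rGamma (1 - a - S) * rGamma (c + S + 1) * ((e i + 1) * gamma_prod m b (e(i := e i + 1)))"
      unfolding coeff_of_eq S' by (simp add: algebra_simps)
    then show ?thesis unfolding g X_def by (simp add: algebra_simps)
  qed
  have 2: "(e i + 1) * coeff_of m a b c (e(i := e i + 1)) = (a + S) * (b i + e i) * X"
  proof -
    have "- (a + S) = 1 - a - (S + 1)" by simp
    then have 3: "rGamma (1 - a - (S + 1)) = - (a + S) * rGamma (1 - a - S)"
      using rGamma_step[of "1 - a - S" "1 - a - (S + 1)"] by simp
    have "(e i + 1) * coeff_of m a b c (e(i := e i + 1)) = - (a + S) * rGamma (1 - a - S) * rGamma (c + S + 1) * ((e i + 1) * gamma_prod m b (e(i := e i + 1)))"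
      unfolding coeff_of_eq S' 3 add.assoc[of c S 1, symmetric] by (simp only: mult_ac)
    then show ?thesis unfolding g X_def by (simp add: algebra_simps)
  qed
  have 3: "coeff_of m a b c e = (c + S) * X"
    unfolding coeff_of_eq S_def[symmetric] X_def rGamma_step[of "c + S + 1" "c + S", OF refl] by (simp only: mult_ac)
  show ?thesis unfolding 1 2 3 by (simp add: algebra_simps)
qed

text \<open>Lowering e_l lowers |e|, which the shifts of a and c compensate exactly. The rest is 1 -
  b_l = (1 - b_l - e_l) + e_l.\<close>

lemma coeff_relation_b:
  assumes l: "l \<in> {1..m}"
  shows "(1 - b l) * coeff_of m (a - 1) (b(l := b l - 1)) (c - 1) e
    = coeff_of m (a - 1) b (c - 1) e + coeff_of m a b c (e(l := e l - 1))"
proof -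
  define S where "S = (\<Sum>l\<in>{1..m}. e l)"
  have S': "(\<Sum>j\<in>{1..m}. (e(l := e l - 1)) j) = S - 1" using sum_fun_upd[of "{1..m}" l e "e l - 1"] l by (simp add: S_def)
  have "1 - a - (S - 1) = 1 - (a - 1) - S" "c + (S - 1) = c - 1 + S" by simp_all
  then show ?thesis
    unfolding coeff_of_eq S' S_def[symmetric] gamma_prod_lower(1)[OF l, of b e] gamma_prod_lower(2)[OF l, of b e]
    by (simp only:) (simp add: algebra_simps)
qed

lemma monomial_fun_upd:
  assumes "l \<in> {1..m}"
  shows "monomial m k (e(l := y)) x = monomial m k e x * exp ((y - e l) * log_branch k l (x l))"
proof -
  have "(\<Sum>j\<in>{1..m} - {l}. (e(l := y)) j * log_branch k j (x j)) = (\<Sum>j\<in>{1..m} - {l}. e j * log_branch k j (x j))"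
    by (intro sum.cong) auto
  then have "(\<Sum>j\<in>{1..m}. (e(l := y)) j * log_branch k j (x j)) = (\<Sum>j\<in>{1..m}. e j * log_branch k j (x j)) + (y - e l) * log_branch k l (x l)"
    using sum.remove[of "{1..m}" l "\<lambda>j. (e(l := y)) j * log_branch k j (x j)"]
      sum.remove[of "{1..m}" l "\<lambda>j. e j * log_branch k j (x j)"] assms by (simp add: algebra_simps)
  then show ?thesis by (simp add: monomial_def exp_add)
qed

lemma has_sum_diff_complex:
  fixes f g :: "'a \<Rightarrow> complex"
  assumes "(f has_sum s) A" "(g has_sum t) A"
  shows "((\<lambda>x. f x - g x) has_sum (s - t)) A"
  using has_sum_add[OF assms(1) has_sum_cmult_right[OF assms(2), of "-1"]] by simp

lemma has_sum_finite_sum: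
  fixes f :: "'i \<Rightarrow> 'a \<Rightarrow> complex"
  assumes "finite I" "\<And>i. i \<in> I \<Longrightarrow> (f i has_sum s i) A"
  shows "((\<lambda>x. \<Sum>i\<in>I. f i x) has_sum (\<Sum>i\<in>I. s i)) A"
  using assms by (induction I rule: finite_induct) (auto intro: has_sum_add has_sum_0)

section \<open>Relations between the series at shifted parameters\<close>

context near_base
begin

lemma coset_update:
  assumes e: "e \<in> exponent_coset m k b c" and l: "l \<in> {1..m}" and y: "y - e l \<in> \<int>"
  shows "e(l := y) \<in> exponent_coset m k b c"
proof -
  have "y - exponents_of m k b c (\<lambda>_. 0) l = (y - e l) + (e l - exponents_of m k b c (\<lambda>_. 0) l)" by simp
  moreover have "e l - exponents_of m k b c (\<lambda>_. 0) l \<in> \<int>" using e l by (simp add: exponent_coset_def)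
  ultimately have "y - exponents_of m k b c (\<lambda>_. 0) l \<in> \<int>" using y Ints_add by metis
  moreover have "e(l := y) \<in> {1..m} \<rightarrow>\<^sub>E UNIV" using e l by (auto simp: exponent_coset_def PiE_iff extensional_def)
  ultimately show ?thesis using e by (auto simp: exponent_coset_def)
qed

lemma coset_eq:
  assumes "\<And>l. l \<in> {1..m} \<Longrightarrow> exponents_of m k b' c' (\<lambda>_. 0) l - exponents_of m k b c (\<lambda>_. 0) l \<in> \<int>"
  shows "exponent_coset m k b' c' = exponent_coset m k b c"
proof -
  have "e l - exponents_of m k b' c' (\<lambda>_. 0) l \<in> \<int> \<longleftrightarrow> e l - exponents_of m k b c (\<lambda>_. 0) l \<in> \<int>" if "l \<in> {1..m}" for e l
    using Ints_add[of "e l - exponents_of m k b' c' (\<lambda>_. 0) l" "exponents_of m k b' c' (\<lambda>_. 0) l - exponents_of m k b c (\<lambda>_. 0) l"]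
      Ints_diff[of "e l - exponents_of m k b c (\<lambda>_. 0) l" "exponents_of m k b' c' (\<lambda>_. 0) l - exponents_of m k b c (\<lambda>_. 0) l"] assms[OF that]
    by auto
  then show ?thesis by (auto simp: exponent_coset_def)
qed

lemma coset_c: "exponent_coset m k b (c - 1) = exponent_coset m k b c"
  by (rule coset_eq) (auto simp: exponents_of_def)

lemma coset_b:
  assumes l: "l \<in> {1..m}"
  shows "exponent_coset m k (b(l := b l - 1)) c = exponent_coset m k b c"
proof (rule coset_eq)
  fix j assume j: "j \<in> {1..m}"
  have "(\<Sum>i\<in>{1..<k}. (b(l := b l - 1)) i) - (\<Sum>i\<in>{1..<k}. b i) \<in> \<int>"
    unfolding sum_subtractf[symmetric] by (rule Ints_sum) auto
  then show "exponents_of m k (b(l := b l - 1)) c (\<lambda>_. 0) j - exponents_of m k b c (\<lambda>_. 0) j \<in> \<int>"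
    using j by (auto simp: exponents_of_def)
qed

text \<open>Reindexing by a unit shift of the coset; \<sigma> = 1 gives multiplication by x_l and
  \<sigma> = -1 division by it.\<close>

lemma has_sum_shift:
  assumes x: "x \<in> polydisc m k \<xi>" and l: "l \<in> {1..m}" and s: "\<sigma> \<in> {1, -1}"
    and B: "((\<lambda>e. B e * monomial m k e x) has_sum s) (exponent_coset m k b c)"
  shows "((\<lambda>e. B (e(l := e l - \<sigma>)) * monomial m k e x) has_sum (s * exp (\<sigma> * log_branch k l (x l)))) (exponent_coset m k b c)"
proof -
  let ?\<Lambda> = "exponent_coset m k b c"
  have sI: "\<sigma> \<in> \<int>" using s by auto
  have bij: "((\<lambda>e. B (e(l := e l - \<sigma>)) * monomial m k (e(l := e l - \<sigma>)) x) has_sum s) ?\<Lambda>"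
    using B
    by (subst has_sum_reindex_bij_witness[where i = "\<lambda>e. e(l := e l + \<sigma>)" and j = "\<lambda>e. e(l := e l - \<sigma>)" and T = ?\<Lambda>
          and h = "\<lambda>e. B e * monomial m k e x" and s' = s])
       (auto intro!: coset_update l simp: sI)
  have "B (e(l := e l - \<sigma>)) * monomial m k (e(l := e l - \<sigma>)) x * exp (\<sigma> * log_branch k l (x l)) = B (e(l := e l - \<sigma>)) * monomial m k e x" for e
    unfolding monomial_fun_upd[OF l] by (simp add: exp_minus)
  with has_sum_cmult_left[OF bij, of "exp (\<sigma> * log_branch k l (x l))"] show ?thesis by simp
qed

lemma has_sum_mult_coordinate:
  assumes x: "x \<in> polydisc m k \<xi>" and l: "l \<in> {1..m}"
    and B: "((\<lambda>e. B e * monomial m k e x) has_sum s) (exponent_coset m k b c)"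
  shows "((\<lambda>e. B (e(l := e l - 1)) * monomial m k e x) has_sum (x l * s)) (exponent_coset m k b c)"
  using has_sum_shift[OF x l _ B, of 1] exp_log_branch[OF polydisc_nonzero[OF x l]] by (simp add: mult.commute)

lemma has_sum_divide_coordinate:
  assumes x: "x \<in> polydisc m k \<xi>" and l: "l \<in> {1..m}"
    and B: "((\<lambda>e. B e * monomial m k e x) has_sum x l * s) (exponent_coset m k b c)"
  shows "((\<lambda>e. B (e(l := e l + 1)) * monomial m k e x) has_sum s) (exponent_coset m k b c)"
proof -
  have "x l * s * inverse (x l) = s" using polydisc_nonzero[OF x l] by (simp add: field_simps)
  with has_sum_shift[OF x l _ B, of "-1"] exp_log_branch[OF polydisc_nonzero[OF x l]] show ?thesis
    by (simp add: exp_minus)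
qed

definition partial :: "nat \<Rightarrow> complex \<Rightarrow> (nat \<Rightarrow> complex) \<Rightarrow> complex \<Rightarrow> (nat \<Rightarrow> complex) \<Rightarrow> complex" where
  "partial i a b c x = deriv (\<lambda>z. f_ser m k a b c (x(i := z))) (x i)"

lemma f_ser_partial:
  assumes x: "x \<in> polydisc m k \<xi>" and i: "i \<in> {1..m}"
  shows "((\<lambda>z. f_ser m k a b c (x(i := z))) has_field_derivative partial i a b c x) (at (x i))"
    "((\<lambda>e. (e i * coeff_of m a b c e) * monomial m k e x) has_sum x i * partial i a b c x) (exponent_coset m k b c)"
proof -
  obtain D where D: "((\<lambda>z. f_ser m k a b c (x(i := z))) has_field_derivative D) (at (x i))"
    "((\<lambda>e. e i * (coeff_of m a b c e * monomial m k e x)) has_sum x i * D) (exponent_coset m k b c)"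
    by (rule f_ser_derivative[OF x i])
  have "partial i a b c x = D" unfolding partial_def by (rule DERIV_imp_deriv[OF D(1)])
  with D show "((\<lambda>z. f_ser m k a b c (x(i := z))) has_field_derivative partial i a b c x) (at (x i))"
    "((\<lambda>e. (e i * coeff_of m a b c e) * monomial m k e x) has_sum x i * partial i a b c x) (exponent_coset m k b c)"
    by (simp_all add: mult.assoc)
qed

text \<open>The right side is b_i (F_0 - F_i) for the entries of \<open>F_vec\<close>, which is the
  reason for their normalization.\<close>

lemma relation_derivative:
  assumes x: "x \<in> polydisc m k \<xi>" and i: "i \<in> {1..m}"
  shows "(a - c) * partial i (a - 1) b c x = b i * f_ser m k a b c x + (x i - 1) * partial i a b c x"
proof -
  have 1: "((\<lambda>e. ((e i + 1) * coeff_of m a b c (e(i := e i + 1))) * monomial m k e x) has_sum partial i a b c x) (exponent_coset m k b c)" for a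
    using has_sum_divide_coordinate[OF x i f_ser_partial(2)[OF x i]] by simp
  have L: "((\<lambda>e. (a - c) * (((e i + 1) * coeff_of m (a - 1) b c (e(i := e i + 1))) * monomial m k e x)) has_sum (a - c) * partial i (a - 1) b c x) (exponent_coset m k b c)"
    by (rule has_sum_cmult_right[OF 1])
  have R: "((\<lambda>e. b i * (coeff_of m a b c e * monomial m k e x) + ((e i * coeff_of m a b c e) * monomial m k e x - ((e i + 1) * coeff_of m a b c (e(i := e i + 1))) * monomial m k e x))
     has_sum (b i * f_ser m k a b c x + (x i * partial i a b c x - partial i a b c x))) (exponent_coset m k b c)"
    by (intro has_sum_add has_sum_diff_complex has_sum_cmult_right f_ser_has_sum f_ser_partial(2) 1 x i)
  have "(a - c) * (((e i + 1) * coeff_of m (a - 1) b c (e(i := e i + 1))) * monomial m k e x)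
     = b i * (coeff_of m a b c e * monomial m k e x) + ((e i * coeff_of m a b c e) * monomial m k e x - ((e i + 1) * coeff_of m a b c (e(i := e i + 1))) * monomial m k e x)" for e
  proof -
    have "(a - c) * (((e i + 1) * coeff_of m (a - 1) b c (e(i := e i + 1))) * monomial m k e x)
       = ((a - c) * ((e i + 1) * coeff_of m (a - 1) b c (e(i := e i + 1)))) * monomial m k e x" by (simp only: mult.assoc)
    then show ?thesis unfolding coeff_relation_derivative[OF i] by (simp add: algebra_simps)
  qed
  then have "(a - c) * partial i (a - 1) b c x = b i * f_ser m k a b c x + (x i * partial i a b c x - partial i a b c x)"
    using has_sum_unique[OF L] R by simp
  then show ?thesis by (simp add: algebra_simps)
qed

text \<open>The sum of the x_i d/dx_i multiplies a monomial by its total degree, so this is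
  \<open>coeff_a\<close> read as an operator identity.\<close>

lemma relation_euler:
  assumes x: "x \<in> polydisc m k \<xi>"
  shows "(1 - a) * f_ser m k (a - 1) b c x = f_ser m k a b c x + (\<Sum>i\<in>{1..m}. x i * partial i (a - 1) b c x)"
proof -
  have L: "((\<lambda>e. (1 - a) * (coeff_of m (a - 1) b c e * monomial m k e x)) has_sum (1 - a) * f_ser m k (a - 1) b c x) (exponent_coset m k b c)"
    by (rule has_sum_cmult_right[OF f_ser_has_sum[OF x]])
  have R: "((\<lambda>e. coeff_of m a b c e * monomial m k e x + (\<Sum>i\<in>{1..m}. (e i * coeff_of m (a - 1) b c e) * monomial m k e x))
     has_sum (f_ser m k a b c x + (\<Sum>i\<in>{1..m}. x i * partial i (a - 1) b c x))) (exponent_coset m k b c)"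
    by (intro has_sum_add f_ser_has_sum has_sum_finite_sum finite_atLeastAtMost f_ser_partial(2) x)
  have "(1 - a) * (coeff_of m (a - 1) b c e * monomial m k e x) = coeff_of m a b c e * monomial m k e x + (\<Sum>i\<in>{1..m}. (e i * coeff_of m (a - 1) b c e) * monomial m k e x)" for e
    unfolding coeff_a[of m a b c e] mult.assoc sum_distrib_right[symmetric] by (simp add: algebra_simps)
  then show ?thesis using has_sum_unique[OF L] R by simp
qed

text \<open>Lowering c multiplies by c - 1 + |e| = (c - a) - (1 - a - |e|), and the last factor is
  the one that raises a - 1 to a.\<close>

lemma relation_c:
  assumes x: "x \<in> polydisc m k \<xi>"
  shows "f_ser m k (a - 1) b (c - 1) x = - f_ser m k a b c x - (a - c) * f_ser m k (a - 1) b c x"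
proof -
  have L: "((\<lambda>e. coeff_of m (a - 1) b (c - 1) e * monomial m k e x) has_sum f_ser m k (a - 1) b (c - 1) x) (exponent_coset m k b c)"
    using f_ser_has_sum[OF x, of "a - 1" b "c - 1"] unfolding coset_c .
  have R: "((\<lambda>e. (-1) * (coeff_of m a b c e * monomial m k e x) - (a - c) * (coeff_of m (a - 1) b c e * monomial m k e x))
      has_sum ((-1) * f_ser m k a b c x - (a - c) * f_ser m k (a - 1) b c x)) (exponent_coset m k b c)"
    by (intro has_sum_diff_complex has_sum_cmult_right f_ser_has_sum x)
  have "coeff_of m (a - 1) b (c - 1) e * monomial m k e x = (-1) * (coeff_of m a b c e * monomial m k e x) - (a - c) * (coeff_of m (a - 1) b c e * monomial m k e x)" for e
    unfolding coeff_a[of m a b c e] coeff_c[of m "a - 1" b c e] by (simp add: algebra_simps)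
  then show ?thesis using has_sum_unique[OF L] R by simp
qed

lemma relation_b:
  assumes x: "x \<in> polydisc m k \<xi>" and l: "l \<in> {1..m}"
  shows "(1 - b l) * f_ser m k (a - 1) (b(l := b l - 1)) (c - 1) x = f_ser m k (a - 1) b (c - 1) x + x l * f_ser m k a b c x"
proof -
  have L: "((\<lambda>e. (1 - b l) * (coeff_of m (a - 1) (b(l := b l - 1)) (c - 1) e * monomial m k e x)) has_sum (1 - b l) * f_ser m k (a - 1) (b(l := b l - 1)) (c - 1) x) (exponent_coset m k b c)"
    using has_sum_cmult_right[OF f_ser_has_sum[OF x, of "a - 1" "b(l := b l - 1)" "c - 1"], of "1 - b l"] unfolding coset_c coset_b[OF l] .
  have L': "((\<lambda>e. coeff_of m (a - 1) b (c - 1) e * monomial m k e x) has_sum f_ser m k (a - 1) b (c - 1) x) (exponent_coset m k b c)"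
    using f_ser_has_sum[OF x, of "a - 1" b "c - 1"] unfolding coset_c .
  have R: "((\<lambda>e. coeff_of m (a - 1) b (c - 1) e * monomial m k e x + coeff_of m a b c (e(l := e l - 1)) * monomial m k e x)
      has_sum (f_ser m k (a - 1) b (c - 1) x + x l * f_ser m k a b c x)) (exponent_coset m k b c)"
    by (intro has_sum_add L' has_sum_mult_coordinate[OF x l f_ser_has_sum[OF x]])
  have "(1 - b l) * (coeff_of m (a - 1) (b(l := b l - 1)) (c - 1) e * monomial m k e x)
     = coeff_of m (a - 1) b (c - 1) e * monomial m k e x + coeff_of m a b c (e(l := e l - 1)) * monomial m k e x" for e
    unfolding mult.assoc[symmetric] coeff_relation_b[OF l] by (simp add: algebra_simps)
  then show ?thesis using has_sum_unique[OF L] R by simp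
qed

text \<open>The identity is assumed on the whole polydisc, because differentiating it at x uses its
  validity at nearby points.\<close>

lemma partial_unique:
  assumes x: "x \<in> polydisc m k \<xi>" and i: "i \<in> {1..m}"
    and g: "\<And>y. y \<in> polydisc m k \<xi> \<Longrightarrow> s * f_ser m k a b c y = g y"
    and D: "((\<lambda>z. g (x(i := z))) has_field_derivative D) (at (x i))"
  shows "s * partial i a b c x = D"
proof -
  obtain r where r: "r > 0" "\<And>z. z \<in> cball (x i) r \<Longrightarrow> x(i := z) \<in> polydisc m k \<xi>"
    using polydisc_update[OF x i] by blast
  have "((\<lambda>z. s * f_ser m k a b c (x(i := z))) has_field_derivative s * partial i a b c x) (at (x i))"
    by (intro DERIV_cmult f_ser_partial x i)
  moreover have "((\<lambda>z. s * f_ser m k a b c (x(i := z))) has_field_derivative D) (at (x i))"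
    using D by (rule has_field_derivative_transform_within_open[where S = "ball (x i) r"]) (use r g in auto)
  ultimately show ?thesis by (rule DERIV_unique)
qed

lemma relation_c_derivative:
  assumes x: "x \<in> polydisc m k \<xi>" and i: "i \<in> {1..m}"
  shows "partial i (a - 1) b (c - 1) x = - partial i a b c x - (a - c) * partial i (a - 1) b c x"
proof -
  have "1 * partial i (a - 1) b (c - 1) x = - partial i a b c x - (a - c) * partial i (a - 1) b c x"
  proof (rule partial_unique[OF x i])
    show "1 * f_ser m k (a - 1) b (c - 1) y = - f_ser m k a b c y - (a - c) * f_ser m k (a - 1) b c y" if "y \<in> polydisc m k \<xi>" for y
      using relation_c[OF that] by simp
    show "((\<lambda>z. - f_ser m k a b c (x(i := z)) - (a - c) * f_ser m k (a - 1) b c (x(i := z)))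
       has_field_derivative - partial i a b c x - (a - c) * partial i (a - 1) b c x) (at (x i))"
      by (intro DERIV_diff DERIV_minus DERIV_cmult f_ser_partial x i)
  qed
  then show ?thesis by simp
qed

lemma relation_b_derivative:
  assumes x: "x \<in> polydisc m k \<xi>" and i: "i \<in> {1..m}" and l: "l \<in> {1..m}"
  shows "(1 - b l) * partial i (a - 1) (b(l := b l - 1)) (c - 1) x
    = partial i (a - 1) b (c - 1) x + x l * partial i a b c x + (if i = l then f_ser m k a b c x else 0)"
proof (rule partial_unique[OF x i relation_b[OF _ l]])
  show "((\<lambda>z. f_ser m k (a - 1) b (c - 1) (x(i := z)) + (x(i := z)) l * f_ser m k a b c (x(i := z)))
     has_field_derivative partial i (a - 1) b (c - 1) x + x l * partial i a b c x + (if i = l then f_ser m k a b c x else 0)) (at (x i))"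
  proof (cases "i = l")
    case True
    have "((\<lambda>z. f_ser m k (a - 1) b (c - 1) (x(i := z)) + z * f_ser m k a b c (x(i := z)))
       has_field_derivative partial i (a - 1) b (c - 1) x + (1 * f_ser m k a b c (x(i := x i)) + partial i a b c x * x i)) (at (x i))"
      by (intro DERIV_add DERIV_mult f_ser_partial x i DERIV_ident)
    then show ?thesis using True by (simp add: algebra_simps)
  next
    case False
    have "((\<lambda>z. f_ser m k (a - 1) b (c - 1) (x(i := z)) + x l * f_ser m k a b c (x(i := z)))
       has_field_derivative partial i (a - 1) b (c - 1) x + x l * partial i a b c x) (at (x i))"
      by (intro DERIV_add DERIV_cmult f_ser_partial x i)
    then show ?thesis using False by simp
  qed
qed

end

section \<open>The intersection matrices\<close>

declare sum.cl_ivl_Suc [simp del] sum.op_ivl_Suc [simp del]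

text \<open>No exponent \<alpha>_0, ..., \<alpha>_{m+2} is an integer.\<close>

definition generic :: "nat \<Rightarrow> complex \<Rightarrow> (nat \<Rightarrow> complex) \<Rightarrow> complex \<Rightarrow> bool" where
  "generic m a b c \<longleftrightarrow> a \<notin> \<int> \<and> c - a \<notin> \<int> \<and> (\<forall>l\<in>{1..m}. b l \<notin> \<int>) \<and> c - (\<Sum>l\<in>{1..m}. b l) \<notin> \<int>"

definition lin :: "nat \<Rightarrow> (nat \<Rightarrow> complex) \<Rightarrow> (nat \<Rightarrow> complex) \<Rightarrow> complex \<Rightarrow> complex" where
  "lin m x r t = (\<Sum>i\<in>{0..m + 1}. r i / (t - pt m x i))"

text \<open>The value in \<open>intersection_form_logf\<close> for residues given by indices. Since
  the finite exponents add up to - a, the contribution of infinity carries a plus sign.\<close>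

definition pairing :: "nat \<Rightarrow> complex \<Rightarrow> (nat \<Rightarrow> complex) \<Rightarrow> complex \<Rightarrow> (nat \<Rightarrow> complex) \<Rightarrow> (nat \<Rightarrow> complex) \<Rightarrow> complex" where
  "pairing m a b c r \<rho> = 2 * of_real pi * \<i> *
     ((\<Sum>i\<in>{0..m + 1}. r i * \<rho> i / expo m a b c i) + (\<Sum>i\<in>{0..m + 1}. r i) * (\<Sum>i\<in>{0..m + 1}. \<rho> i) / a)"

lemma sum_expo: "(\<Sum>i\<in>{0..m + 1}. expo m a b c i) = - a"
proof -
  have "(\<Sum>i\<in>{0..m + 1}. expo m a b c i) = expo m a b c 0 + (\<Sum>i\<in>{1..m}. expo m a b c i) + expo m a b c (m + 1)"
    by (simp add: sum.atLeast0_atMost_Suc sum.atLeast_Suc_atMost)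
  also have "(\<Sum>i\<in>{1..m}. expo m a b c i) = (\<Sum>i\<in>{1..m}. - b i)"
    by (intro sum.cong) (auto simp: expo_def)
  finally show ?thesis by (simp add: expo_def sum_negf)
qed

lemma expo_not_Ints:
  assumes "generic m a b c" "i \<le> m + 1"
  shows "expo m a b c i \<notin> \<int>"
proof -
  have *: "- z \<notin> \<int>" if "z \<notin> \<int>" for z :: complex
    using Ints_minus[of "- z"] that by auto
  have "- (c - (\<Sum>l\<in>{1..m}. b l)) \<notin> \<int>" by (rule *) (use assms(1) in \<open>simp add: generic_def\<close>)
  moreover have "- (c - (\<Sum>l\<in>{1..m}. b l)) = - c + (\<Sum>l\<in>{1..m}. b l)" by simp
  ultimately have "- c + (\<Sum>l\<in>{1..m}. b l) \<notin> \<int>" by argo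
  then show ?thesis using assms * by (auto simp: expo_def generic_def)
qed

section \<open>Intersection numbers in terms of indexed points\<close>

locale configuration =
  fixes m :: nat and a :: complex and b :: "nat \<Rightarrow> complex" and c :: complex and x :: "nat \<Rightarrow> complex"
  assumes generic: "generic m a b c"
    and distinct: "inj_on (pt m x) {0..m + 1}"
begin

text \<open>Exponents and residues are indexed by numbers here, but by the points themselves in
  \<open>twisted_plane\<close>; this translates between the two.\<close>

definition idx :: "complex \<Rightarrow> nat" where
  "idx = inv_into {0..m + 1} (pt m x)"

abbreviation "P \<equiv> pt m x ` {0..m + 1}"
abbreviation "w \<equiv> omega_x m a b c x"

lemma idx: "i \<in> {0..m + 1} \<Longrightarrow> idx (pt m x i) = i"
  unfolding idx_def by (rule inv_into_f_f[OF distinct])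

lemma sum_P: "(\<Sum>p\<in>P. f p) = (\<Sum>i\<in>{0..m + 1}. f (pt m x i))"
  by (rule sum.reindex_cong[OF distinct]) auto

lemma logf_idx: "logf P (\<lambda>p. r (idx p)) = lin m x r"
  unfolding logf_def lin_def sum_P by (intro ext sum.cong) (simp_all only: idx)

lemma w_eq: "w = logf P (\<lambda>p. expo m a b c (idx p))"
  unfolding logf_idx by (simp add: omega_x_def lin_def fun_eq_iff)

lemma minus_w: "(\<lambda>t. - w t) = (\<lambda>t. - logf P (\<lambda>p. expo m a b c (idx p)) t)"
  by (simp only: w_eq)

lemma sum_idx: "(\<Sum>p\<in>P. f (idx p)) = (\<Sum>i\<in>{0..m + 1}. f i)"
  unfolding sum_P by (intro sum.cong) (simp_all only: idx)

sublocale plane: twisted_plane P "\<lambda>p. expo m a b c (idx p)"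
proof
  show "expo m a b c (idx p) \<notin> \<int>" if "p \<in> P" for p
  proof -
    from that obtain i where i: "p = pt m x i" "i \<in> {0..m + 1}" by (rule imageE)
    have "i \<le> m + 1" using i(2) by simp
    from expo_not_Ints[OF generic this] show ?thesis unfolding i(1) idx[OF i(2)] .
  qed
  have "- a \<notin> \<int>" using generic Ints_minus[of "- a"] by (auto simp: generic_def)
  then show "(\<Sum>p\<in>P. expo m a b c (idx p)) \<notin> \<int>"
    by (simp only: sum_idx[of "expo m a b c"] sum_expo not_False_eq_True)
  show "finite P" by (rule finite_imageI) simp
qed

lemma Tx_eq: "Tx m x = - P" by (simp add: Tx_def)

lemma Ic_lin: "Ic m a b c x (lin m x r) (lin m x \<rho>) = pairing m a b c r \<rho>"
  using plane.intersection_form_logf[of "\<lambda>p. r (idx p)" "\<lambda>p. \<rho> (idx p)"]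
  unfolding Ic_def Tx_eq minus_w unfolding w_eq
  unfolding logf_idx[of r] logf_idx[of \<rho>]
    sum_idx[of "\<lambda>i. r i * \<rho> i / expo m a b c i"] sum_idx[of r] sum_idx[of \<rho>] sum_idx[of "expo m a b c"] sum_expo pairing_def
  by (simp only: minus_divide_right[symmetric] diff_minus_eq_add)

text \<open>The right side of the second assumption is the twisted differential of the function s t,
  so both forms lie in the same class.\<close>

lemma Ic_cohom:
  assumes g: "g holomorphic_on - P" and r: "\<And>t. t \<notin> P \<Longrightarrow> g t - lin m x r t = s * (1 + w t * t)"
  shows "Ic m a b c x g h = Ic m a b c x (lin m x r) h"
proof -
  have "(times_dt g, times_dt (lin m x r)) \<in> cohom (- P) w"
  proof -
    have hw: "w holomorphic_on - P" unfolding w_eq by (rule plane.holomorphic_w)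
    have hl: "lin m x r holomorphic_on - P" unfolding logf_idx[symmetric] by (rule holomorphic_logf) simp
    have "times_dt g z v - times_dt (lin m x r) z v = nabla0 w (\<lambda>t. s * t) z v" if "z \<in> - P" for z v
    proof -
      have "((\<lambda>t. s * t) has_derivative (\<lambda>v. s * v)) (at z)" by (auto intro!: derivative_eq_intros)
      from frechet_derivative_unique[OF this]
      have "nabla0 w (\<lambda>t. s * t) z v = s * (1 + w z * z) * v" by (simp add: nabla0_def times_dt_def algebra_simps)
      also have "\<dots> = times_dt g z v - times_dt (lin m x r) z v"
        using r[of z] that by (simp add: times_dt_def left_diff_distrib[symmetric])
      finally show ?thesis by simp
    qed
    moreover have "smooth_on (- P) (\<lambda>t. s * t)"
      by (intro smooth_on_holomorphic plane.open_T holomorphic_intros)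
    ultimately show ?thesis
      unfolding cohom_def using times_dt_in_Z1[OF plane.open_T g hw] times_dt_in_Z1[OF plane.open_T hl hw]
      by (auto simp: E0_def intro!: exI[of _ "\<lambda>t. s * t"])
  qed
  from cohom_class_eq[OF plane.open_T this] show ?thesis by (simp only: Ic_def Tx_eq)
qed

text \<open>Each summand uses t/(t - p) = 1 + p/(t - p). The constant - a makes 1 + t w equal to 1 -
  a plus a logarithmic coefficient.\<close>

lemma w_mult: "t \<notin> P \<Longrightarrow> w t * t = - a + (\<Sum>i\<in>{0..m + 1}. expo m a b c i * pt m x i / (t - pt m x i))"
proof -
  assume t: "t \<notin> P"
  have "w t * t = (\<Sum>i\<in>{0..m + 1}. expo m a b c i + expo m a b c i * pt m x i / (t - pt m x i))"
    unfolding omega_x_def sum_distrib_right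
  proof (rule sum.cong[OF refl])
    fix i assume "i \<in> {0..m + 1}"
    then have "t - pt m x i \<noteq> 0" using t by auto
    then show "expo m a b c i / (t - pt m x i) * t = expo m a b c i + expo m a b c i * pt m x i / (t - pt m x i)"
      by (simp add: field_simps)
  qed
  then show ?thesis by (simp only: sum.distrib sum_expo)
qed

end

text \<open>The residue of \<phi>_i at the point with index s.\<close>

definition basis_coeff :: "nat \<Rightarrow> nat \<Rightarrow> nat \<Rightarrow> complex" where
  "basis_coeff m i s = (if s = m + 1 then 1 else if s = i \<and> i \<noteq> 0 then -1 else 0)"

text \<open>Row \<open>i\<close> expresses the class of \<open>(t - x\<^sub>l) \<phi>\<^sub>i\<close> in the basis \<open>\<phi>\<^sub>0, \<dots>, \<phi>\<^sub>m\<close>.\<close>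

definition mult_coeff ::
  "nat \<Rightarrow> nat \<Rightarrow> complex \<Rightarrow> (nat \<Rightarrow> complex) \<Rightarrow> complex \<Rightarrow> (nat \<Rightarrow> complex) \<Rightarrow> nat \<Rightarrow> nat \<Rightarrow> complex" where
  "mult_coeff m l a b c x i j =
     (if i = 0 then
        (if j = 0 then (1 - pt m x l) - ((c - a) - (\<Sum>s\<in>{1..m}. b s * x s)) / (1 - a) else - (b j * x j) / (1 - a))
      else (if j = 0 then 1 - x i else if j = i then x i - pt m x l else 0))"

definition mult_mat ::
  "nat \<Rightarrow> nat \<Rightarrow> complex \<Rightarrow> (nat \<Rightarrow> complex) \<Rightarrow> complex \<Rightarrow> (nat \<Rightarrow> complex) \<Rightarrow> complex mat" where
  "mult_mat m l a b c x = mat (m + 1) (m + 1) (\<lambda>(i, j). mult_coeff m l a b c x i j)"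

lemma sum_split_ends:
  fixes f :: "nat \<Rightarrow> complex"
  shows "(\<Sum>i\<in>{0..m + 1}. f i) = f 0 + (\<Sum>i\<in>{1..m}. f i) + f (m + 1)"
  by (simp add: sum.atLeast0_atMost_Suc sum.atLeast_Suc_atMost)

lemma sum_split_first:
  fixes f :: "nat \<Rightarrow> complex"
  shows "(\<Sum>i\<in>{0..<m + 1}. f i) = f 0 + (\<Sum>i\<in>{1..m}. f i)"
  by (simp add: atLeastLessThanSuc_atLeastAtMost sum.atLeast_Suc_atMost)

lemma phi_eq_lin:
  assumes "j \<le> m"
  shows "phi x j = lin m x (basis_coeff m j)"
proof
  fix t
  have "(\<Sum>i\<in>{1..m}. basis_coeff m j i / (t - pt m x i)) = (\<Sum>i\<in>{1..m}. if i = j then - 1 / (t - x j) else 0)"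
    by (intro sum.cong) (auto simp: basis_coeff_def pt_def)
  also have "\<dots> = (if j = 0 then 0 else - 1 / (t - x j))" using assms by (auto simp: sum.delta)
  finally show "phi x j t = lin m x (basis_coeff m j) t"
    unfolding lin_def sum_split_ends by (simp add: phi_def basis_coeff_def pt_def)
qed

text \<open>The residue at the point with index s of the combination in row i. For i > 0 it is that
  of (t - x_l) \<phi>_i; for i = 0 the exact correction contributes the terms with 1 - a.\<close>

lemma mult_coeff_row:
  assumes i: "i \<le> m" and s: "s \<le> m + 1"
  shows "(\<Sum>j\<in>{0..<m + 1}. mult_coeff m l a b c x i j * basis_coeff m j s) =
    (if i = 0 then - expo m a b c s * pt m x s / (1 - a) + (if s = m + 1 then 1 - pt m x l else 0)
     else (if s = m + 1 then 1 - pt m x l else if s = i then pt m x l - x i else 0))"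
proof -
  consider "s = 0" | "1 \<le> s" "s \<le> m" | "s = m + 1" using s by linarith
  then show ?thesis
  proof cases
    case 1
    have "basis_coeff m j 0 = 0" for j by (auto simp: basis_coeff_def)
    then show ?thesis using 1 i by (simp add: pt_def)
  next
    case 2
    have "(\<Sum>j\<in>{0..<m + 1}. mult_coeff m l a b c x i j * basis_coeff m j s) = (\<Sum>j\<in>{0..<m + 1}. if j = s then - mult_coeff m l a b c x i s else 0)"
      by (intro sum.cong) (use 2 in \<open>auto simp: basis_coeff_def\<close>)
    also have "\<dots> = - mult_coeff m l a b c x i s" using 2 by (simp add: sum.delta)
    finally show ?thesis using 2 i by (auto simp: mult_coeff_def expo_def pt_def)
  next
    case 3
    have "(\<Sum>j\<in>{0..<m + 1}. mult_coeff m l a b c x i j * basis_coeff m j s) = mult_coeff m l a b c x i 0 + (\<Sum>j\<in>{1..m}. mult_coeff m l a b c x i j)"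
      unfolding sum_split_first using 3 by (simp add: basis_coeff_def)
    also have "(\<Sum>j\<in>{1..m}. mult_coeff m l a b c x i j) =
       (if i = 0 then - (\<Sum>s\<in>{1..m}. b s * x s) / (1 - a) else x i - pt m x l)"
    proof (cases "i = 0")
      case True
      then show ?thesis by (simp add: mult_coeff_def sum_negf sum_divide_distrib)
    next
      case False
      have "(\<Sum>j\<in>{1..m}. mult_coeff m l a b c x i j) = (\<Sum>j\<in>{1..m}. if j = i then x i - pt m x l else 0)"
        by (intro sum.cong) (use False in \<open>auto simp: mult_coeff_def\<close>)
      then show ?thesis using False i by (simp add: sum.delta)
    qed
    finally show ?thesis using 3 i by (simp add: mult_coeff_def expo_def pt_def diff_divide_distrib)
  qed
qed

lemma pairing_sum:
  "pairing m a b c (\<lambda>s. \<Sum>j\<in>J. f j * r j s) \<rho> = (\<Sum>j\<in>J. f j * pairing m a b c (r j) \<rho>)"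
proof -
  have 1: "(\<Sum>i\<in>{0..m + 1}. (\<Sum>j\<in>J. f j * r j i) * \<rho> i / expo m a b c i) = (\<Sum>j\<in>J. f j * (\<Sum>i\<in>{0..m + 1}. r j i * \<rho> i / expo m a b c i))"
    unfolding sum_distrib_left sum_distrib_right sum_divide_distrib by (subst sum.swap) (simp add: mult_ac)
  have 2: "(\<Sum>i\<in>{0..m + 1}. \<Sum>j\<in>J. f j * r j i) = (\<Sum>j\<in>J. f j * (\<Sum>i\<in>{0..m + 1}. r j i))"
    unfolding sum_distrib_left by (rule sum.swap)
  have 3: "(\<Sum>j\<in>J. f j * R j) * S / a = (\<Sum>j\<in>J. f j * (R j * S / a))" for R :: "'a \<Rightarrow> complex" and S
    by (simp add: sum_distrib_right sum_divide_distrib mult.assoc)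
  have 4: "k * ((\<Sum>j\<in>J. f j * A j) + (\<Sum>j\<in>J. f j * B j)) = (\<Sum>j\<in>J. f j * (k * (A j + B j)))" for k and A B :: "'a \<Rightarrow> complex"
    by (simp add: sum_distrib_left sum.distrib algebra_simps)
  show ?thesis unfolding pairing_def 1 2 3 by (rule 4)
qed

context configuration
begin

lemma nonzero_parameters:
  "a \<noteq> 0" "c - a \<noteq> 0" "\<And>i. i \<in> {1..m} \<Longrightarrow> b i \<noteq> 0"
  "c - (\<Sum>l\<in>{1..m}. b l) \<noteq> 0" "c - (\<Sum>l\<in>{1..m}. b l) \<noteq> 1"
proof -
  have "z \<noteq> 0 \<and> z \<noteq> 1" if "z \<notin> \<int>" for z :: complex using that by auto
  then show "a \<noteq> 0" "c - a \<noteq> 0" "\<And>i. i \<in> {1..m} \<Longrightarrow> b i \<noteq> 0"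
    "c - (\<Sum>l\<in>{1..m}. b l) \<noteq> 0" "c - (\<Sum>l\<in>{1..m}. b l) \<noteq> 1"
    using generic unfolding generic_def by blast+
qed

lemma a_ne_1: "1 - a \<noteq> 0"
proof
  assume "1 - a = 0"
  then have "a = 1" by simp
  then show False using generic by (simp add: generic_def)
qed

lemma Ic_mult:
  assumes i: "i \<le> m" and l: "l \<le> m + 1"
  shows "Ic m a b c x (\<lambda>t. (t - pt m x l) * phi x i t) h
    = Ic m a b c x (lin m x (\<lambda>s. \<Sum>j\<in>{0..<m + 1}. mult_coeff m l a b c x i j * basis_coeff m j s)) h"
\<comment> \<open>For i > 0 the two forms coincide. For i = 0 the product (t - x_l)/(t - 1) has
  polynomial part 1, removed by the twisted differential of t/(1 - a).\<close>
proof (rule Ic_cohom[where s = "if i = 0 then 1 / (1 - a) else 0"])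
  have "phi x i holomorphic_on - P"
    unfolding phi_eq_lin[OF i] logf_idx[symmetric] by (rule holomorphic_logf) simp
  then show "(\<lambda>t. (t - pt m x l) * phi x i t) holomorphic_on - P" by (intro holomorphic_intros)
  fix t assume t: "t \<notin> P"
  have nz: "t - pt m x s \<noteq> 0" if "s \<le> m + 1" for s using t that by auto
  have t1: "t - 1 \<noteq> 0" using nz[of "m + 1"] by (simp add: pt_def)
  let ?L = "lin m x (\<lambda>s. \<Sum>j\<in>{0..<m + 1}. mult_coeff m l a b c x i j * basis_coeff m j s) t"
  show "(t - pt m x l) * phi x i t - ?L = (if i = 0 then 1 / (1 - a) else 0) * (1 + w t * t)"
  proof (cases "i = 0")
    case True
    have "?L = (\<Sum>s\<in>{0..m + 1}. - 1 / (1 - a) * (expo m a b c s * pt m x s / (t - pt m x s)) + (if s = m + 1 then (1 - pt m x l) / (t - 1) else 0))"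
      unfolding lin_def
    proof (rule sum.cong[OF refl])
      fix s assume "s \<in> {0..m + 1}"
      then have s: "s \<le> m + 1" by simp
      show "(\<Sum>j\<in>{0..<m + 1}. mult_coeff m l a b c x i j * basis_coeff m j s) / (t - pt m x s)
        = - 1 / (1 - a) * (expo m a b c s * pt m x s / (t - pt m x s)) + (if s = m + 1 then (1 - pt m x l) / (t - 1) else 0)"
        unfolding mult_coeff_row[OF i s] using True by (auto simp: add_divide_distrib diff_divide_distrib pt_def)
    qed
    also have "\<dots> = - 1 / (1 - a) * (\<Sum>s\<in>{0..m + 1}. expo m a b c s * pt m x s / (t - pt m x s)) + (1 - pt m x l) / (t - 1)"
      by (simp only: sum.distrib sum_distrib_left[symmetric] sum.delta finite_atLeastAtMost) simp
    also have "\<dots> = - 1 / (1 - a) * (w t * t + a) + (1 - pt m x l) / (t - 1)"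
      using w_mult[OF t] by simp
    finally have L: "?L = - 1 / (1 - a) * (w t * t + a) + (1 - pt m x l) / (t - 1)" .
    have "(t - pt m x l) * phi x i t = 1 + (1 - pt m x l) / (t - 1)"
      using True t1 by (simp add: phi_def field_simps)
    then have "(t - pt m x l) * phi x i t - ?L = 1 + 1 / (1 - a) * (w t * t + a)" unfolding L by simp
    also have "\<dots> = 1 / (1 - a) * (1 + w t * t)" using a_ne_1 by (simp add: field_simps)
    finally show ?thesis using True by simp
  next
    case False
    have ti: "t - x i \<noteq> 0" using nz[of i] i False by (simp add: pt_def)
    have "?L = (\<Sum>s\<in>{0..m + 1}. (if s = m + 1 then (1 - pt m x l) / (t - 1) else 0) + (if s = i then (pt m x l - x i) / (t - x i) else 0))"
      unfolding lin_def
    proof (rule sum.cong[OF refl])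
      fix s assume "s \<in> {0..m + 1}"
      then have s: "s \<le> m + 1" by simp
      show "(\<Sum>j\<in>{0..<m + 1}. mult_coeff m l a b c x i j * basis_coeff m j s) / (t - pt m x s)
        = (if s = m + 1 then (1 - pt m x l) / (t - 1) else 0) + (if s = i then (pt m x l - x i) / (t - x i) else 0)"
        unfolding mult_coeff_row[OF i s] using False i by (auto simp: pt_def)
    qed
    also have "\<dots> = (1 - pt m x l) / (t - 1) + (pt m x l - x i) / (t - x i)"
      using i by (simp only: sum.distrib sum.delta finite_atLeastAtMost) simp
    finally have L: "?L = (1 - pt m x l) / (t - 1) + (pt m x l - x i) / (t - x i)" .
    have "(t - pt m x l) * phi x i t = (1 - pt m x l) / (t - 1) + (pt m x l - x i) / (t - x i)"
      using False t1 ti by (simp add: phi_def field_simps)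
    then show ?thesis unfolding L using False by simp
  qed
qed

lemma Q_mat_eq:
  assumes "l \<le> m + 1"
  shows "Q_mat m l a b c x = mult_mat m l a b c x * C_mat m a b c x"
proof (rule eq_matI)
  fix i j assume "i < dim_row (mult_mat m l a b c x * C_mat m a b c x)" "j < dim_col (mult_mat m l a b c x * C_mat m a b c x)"
  then have ij: "i \<le> m" "j \<le> m" by (auto simp: mult_mat_def C_mat_def)
  have "Q_mat m l a b c x $$ (i, j) = (\<Sum>s\<in>{0..<m + 1}. mult_coeff m l a b c x i s * Ic m a b c x (phi x s) (phi x j))"
  proof -
    have "Q_mat m l a b c x $$ (i, j) = Ic m a b c x (\<lambda>t. (t - pt m x l) * phi x i t) (phi x j)"
      using ij by (simp add: Q_mat_def)
    also have "\<dots> = (\<Sum>s\<in>{0..<m + 1}. mult_coeff m l a b c x i s * pairing m a b c (basis_coeff m s) (basis_coeff m j))"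
      unfolding Ic_mult[OF ij(1) assms] phi_eq_lin[OF ij(2)] Ic_lin by (rule pairing_sum)
    also have "\<dots> = (\<Sum>s\<in>{0..<m + 1}. mult_coeff m l a b c x i s * Ic m a b c x (phi x s) (phi x j))"
      by (intro sum.cong) (use ij in \<open>auto simp: phi_eq_lin Ic_lin less_Suc_eq_le\<close>)
    finally show ?thesis .
  qed
  then show "Q_mat m l a b c x $$ (i, j) = (mult_mat m l a b c x * C_mat m a b c x) $$ (i, j)"
    using ij by (simp add: mult_mat_def C_mat_def scalar_prod_def)
qed (auto simp: Q_mat_def mult_mat_def C_mat_def)

text \<open>Apart from \<phi>_0 the basis forms have total residue 0, so infinity contributes only
  at (0, 0). The common residue 1 at the point 1 gives a constant matrix, to which a diagonal one is
  added.\<close>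

lemma C_mat_entry:
  assumes "i \<le> m" "j \<le> m"
  shows "C_mat m a b c x $$ (i, j) = 2 * of_real pi * \<i> *
    (1 / (c - a) + (if i = j then (if i = 0 then 1 / a else - 1 / b i) else 0))"
proof -
  have s: "(\<Sum>i\<in>{0..m + 1}. basis_coeff m j i) = (if j = 0 then 1 else 0)" if "j \<le> m" for j
  proof -
    have "(\<Sum>i\<in>{0..m + 1}. basis_coeff m j i) = (\<Sum>i\<in>{0..m + 1}. (if i = m + 1 then 1 else 0) + (if i = j then (if j = 0 then 0 else -1) else 0))"
      by (intro sum.cong) (use that in \<open>auto simp: basis_coeff_def\<close>)
    also have "\<dots> = (if j = 0 then 1 else 0)"
      using that by (simp only: sum.distrib sum.delta finite_atLeastAtMost) auto
    finally show ?thesis .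
  qed
  have "(\<Sum>s\<in>{0..m + 1}. basis_coeff m i s * basis_coeff m j s / expo m a b c s)
      = (\<Sum>s\<in>{0..m + 1}. (if s = m + 1 then 1 / (c - a) else 0) + (if s = i then (if i = j \<and> i \<noteq> 0 then - 1 / b i else 0) else 0))"
    by (intro sum.cong) (use assms in \<open>auto simp: basis_coeff_def expo_def\<close>)
  also have "\<dots> = 1 / (c - a) + (if i = j \<and> i \<noteq> 0 then - 1 / b i else 0)"
    using assms by (simp only: sum.distrib sum.delta finite_atLeastAtMost) auto
  finally have q: "(\<Sum>s\<in>{0..m + 1}. basis_coeff m i s * basis_coeff m j s / expo m a b c s)
     = 1 / (c - a) + (if i = j \<and> i \<noteq> 0 then - 1 / b i else 0)" .
  have "C_mat m a b c x $$ (i, j) = pairing m a b c (basis_coeff m i) (basis_coeff m j)"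
    using assms by (simp add: C_mat_def phi_eq_lin Ic_lin)
  also have "\<dots> = 2 * of_real pi * \<i> * (1 / (c - a) + (if i = j then (if i = 0 then 1 / a else - 1 / b i) else 0))"
    unfolding pairing_def q s[OF assms(1)] s[OF assms(2)] by auto
  finally show ?thesis .
qed

end

section \<open>Invertibility of the matrices\<close>

lemma det_nonzero_if_kernel_trivial:
  fixes A :: "complex mat"
  assumes A: "A \<in> carrier_mat n n" and ker: "\<And>v. v \<in> carrier_vec n \<Longrightarrow> A *\<^sub>v v = 0\<^sub>v n \<Longrightarrow> v = 0\<^sub>v n"
  shows "det A \<noteq> 0"
  using det_0_iff_vec_prod_zero_field[OF A] ker by blast

lemma inv_mat_if_det_nonzero:
  fixes A :: "complex mat"
  assumes A: "A \<in> carrier_mat n n" and det: "det A \<noteq> 0"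
  shows "invertible_mat A" "inv_mat A \<in> carrier_mat n n" "A * inv_mat A = 1\<^sub>m n" "inv_mat A * A = 1\<^sub>m n"
proof -
  have "A \<in> Units (ring_mat TYPE(complex) n ())" by (rule det_non_zero_imp_unit[OF A det])
  then obtain B where B: "mat_inverse A = Some B" using mat_inverse(1)[OF A, of "()"] by (cases "mat_inverse A") auto
  then have "inv_mat A = B" by (simp add: inv_mat_def)
  with mat_inverse(2)[OF A B] show i: "inv_mat A \<in> carrier_mat n n" "A * inv_mat A = 1\<^sub>m n" "inv_mat A * A = 1\<^sub>m n" by auto
  show "invertible_mat A"
    unfolding invertible_mat_def inverts_mat_def using A i by (auto simp: square_mat.simps)
qed

context configuration
begin

lemma C_mat_carrier: "C_mat m a b c x \<in> carrier_mat (m + 1) (m + 1)" by (simp add: C_mat_def)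
lemma mult_mat_carrier: "mult_mat m l a b c x \<in> carrier_mat (m + 1) (m + 1)" by (simp add: mult_mat_def)

text \<open>The matrix is constant plus diagonal, so a kernel vector is determined by the sum S of
  its entries, and summing the entries gives S (c - \<Sum>b_l) = 0.\<close>

lemma det_C_mat: "det (C_mat m a b c x) \<noteq> 0"
proof (rule det_nonzero_if_kernel_trivial[OF C_mat_carrier])
  fix v :: "complex vec" assume v: "v \<in> carrier_vec (m + 1)" and z: "C_mat m a b c x *\<^sub>v v = 0\<^sub>v (m + 1)"
  note nz = nonzero_parameters
  define S where "S = (\<Sum>j\<in>{0..<m + 1}. vec_index v j)"
  define d where "d = (\<lambda>i. if i = 0 then 1 / a else - 1 / b i)"
  have row: "S / (c - a) + d i * vec_index v i = 0" if "i \<le> m" for i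
  proof -
    have "0 = vec_index (C_mat m a b c x *\<^sub>v v) i" unfolding z using that by simp
    also have "\<dots> = (\<Sum>j\<in>{0..<m + 1}. C_mat m a b c x $$ (i, j) * vec_index v j)"
      using that v by (simp add: C_mat_def scalar_prod_def)
    also have "\<dots> = (\<Sum>j\<in>{0..<m + 1}. 2 * of_real pi * \<i> * (1 / (c - a) * vec_index v j + (if j = i then d i * vec_index v i else 0)))"
      by (intro sum.cong) (use that in \<open>auto simp: C_mat_entry d_def algebra_simps\<close>)
    also have "\<dots> = 2 * of_real pi * \<i> * (1 / (c - a) * S + d i * vec_index v i)"
      using that by (simp only: sum_distrib_left[symmetric] sum.distrib sum.delta finite_atLeastLessThan) (simp add: S_def)
    finally show ?thesis by simp
  qed
  have v0: "vec_index v 0 = - a * (S / (c - a))" using row[of 0] nz by (simp add: d_def field_simps)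
  have vi: "vec_index v i = b i * (S / (c - a))" if "i \<in> {1..m}" for i
    using row[of i] nz(3)[OF that] that by (simp add: d_def field_simps)
  have "S = vec_index v 0 + (\<Sum>i\<in>{1..m}. vec_index v i)" unfolding S_def by (rule sum_split_first)
  also have "(\<Sum>i\<in>{1..m}. vec_index v i) = (\<Sum>l\<in>{1..m}. b l) * (S / (c - a))" by (simp add: vi sum_distrib_right sum_divide_distrib)
  finally have "S * (c - (\<Sum>l\<in>{1..m}. b l)) = 0" unfolding v0 using nz(2) by (simp add: field_simps)
  then have S0: "S = 0" using nz by simp
  show "v = 0\<^sub>v (m + 1)"
  proof (rule eq_vecI)
    fix i assume "i < dim_vec (0\<^sub>v (m + 1) :: complex vec)"
    then show "vec_index v i = vec_index (0\<^sub>v (m + 1)) i" using v0 vi[of i] S0 by (cases "i = 0") auto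
  qed (use v in auto)
qed

text \<open>Written in the differences v_0 - v_s because for \<open>F_vec\<close> these are
  derivatives of the series at a - 1, up to the factor (a - c)/b_s.\<close>

lemma mult_mat_row:
  assumes "v \<in> carrier_vec (m + 1)" "i \<le> m"
  shows "vec_index (mult_mat m l a b c x *\<^sub>v v) i =
    (if i = 0 then (1 - pt m x l) * vec_index v 0 - ((c - a) * vec_index v 0 - (\<Sum>s\<in>{1..m}. b s * x s * (vec_index v 0 - vec_index v s))) / (1 - a)
     else vec_index v 0 - x i * (vec_index v 0 - vec_index v i) - pt m x l * vec_index v i)"
proof -
  have "vec_index (mult_mat m l a b c x *\<^sub>v v) i = (\<Sum>j\<in>{0..<m + 1}. mult_coeff m l a b c x i j * vec_index v j)"
    using assms by (simp add: mult_mat_def scalar_prod_def)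
  also have "\<dots> = mult_coeff m l a b c x i 0 * vec_index v 0 + (\<Sum>j\<in>{1..m}. mult_coeff m l a b c x i j * vec_index v j)" by (rule sum_split_first)
  finally have e: "vec_index (mult_mat m l a b c x *\<^sub>v v) i = mult_coeff m l a b c x i 0 * vec_index v 0 + (\<Sum>j\<in>{1..m}. mult_coeff m l a b c x i j * vec_index v j)" .
  show ?thesis
  proof (cases "i = 0")
    case True
    have "(\<Sum>j\<in>{1..m}. mult_coeff m l a b c x i j * vec_index v j) = (\<Sum>j\<in>{1..m}. - (b j * x j * vec_index v j)) / (1 - a)"
      unfolding sum_divide_distrib by (intro sum.cong) (use True in \<open>auto simp: mult_coeff_def\<close>)
    moreover have "(\<Sum>s\<in>{1..m}. b s * x s * (vec_index v 0 - vec_index v s)) = (\<Sum>s\<in>{1..m}. b s * x s) * vec_index v 0 + (\<Sum>j\<in>{1..m}. - (b j * x j * vec_index v j))"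
      unfolding sum_distrib_right sum.distrib[symmetric] by (intro sum.cong refl) (simp add: algebra_simps)
    ultimately show ?thesis unfolding e using True by (simp add: mult_coeff_def diff_divide_distrib add_divide_distrib algebra_simps)
  next
    case False
    have "(\<Sum>j\<in>{1..m}. mult_coeff m l a b c x i j * vec_index v j) = (\<Sum>j\<in>{1..m}. if j = i then (x i - pt m x l) * vec_index v i else 0)"
      by (intro sum.cong) (use False in \<open>auto simp: mult_coeff_def\<close>)
    also have "\<dots> = (x i - pt m x l) * vec_index v i" using False assms(2) by (simp add: sum.delta)
    finally show ?thesis unfolding e using False by (simp add: mult_coeff_def algebra_simps)
  qed
qed

lemma x_ne:
  assumes "i \<in> {1..m}"
  shows "x i \<noteq> 0" "x i \<noteq> 1"
proof -
  have "pt m x i \<noteq> pt m x 0" "pt m x i \<noteq> pt m x (m + 1)"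
    using inj_on_eq_iff[OF distinct, of i] assms by auto
  then show "x i \<noteq> 0" "x i \<noteq> 1" using assms by (auto simp: pt_def)
qed

text \<open>For a kernel vector the rows i > 0 give v_i = v_0, as x_i \<noteq> 1; then row 0 reduces
  to (c - a) v_0 = 0.\<close>

lemma det_mult_mat_last: "det (mult_mat m (m + 1) a b c x) \<noteq> 0"
proof (rule det_nonzero_if_kernel_trivial[OF mult_mat_carrier])
  fix v :: "complex vec" assume v: "v \<in> carrier_vec (m + 1)" and z: "mult_mat m (m + 1) a b c x *\<^sub>v v = 0\<^sub>v (m + 1)"
  note nz = nonzero_parameters(2)
  have row: "vec_index (mult_mat m (m + 1) a b c x *\<^sub>v v) i = 0" if "i \<le> m" for i unfolding z using that by simp
  have vi: "vec_index v i = vec_index v 0" if "i \<in> {1..m}" for i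
  proof -
    have "(1 - x i) * (vec_index v 0 - vec_index v i) = 0"
      using row[of i] mult_mat_row[OF v, of i "m + 1"] that by (simp add: pt_def algebra_simps)
    then show ?thesis using x_ne[OF that] by auto
  qed
  have "(c - a) * vec_index v 0 / (1 - a) = 0"
    using row[of 0] mult_mat_row[OF v, of 0 "m + 1"] vi by (simp add: pt_def)
  then have v0: "vec_index v 0 = 0" using nz a_ne_1 by auto
  show "v = 0\<^sub>v (m + 1)"
  proof (rule eq_vecI)
    fix i assume "i < dim_vec (0\<^sub>v (m + 1) :: complex vec)"
    then show "vec_index v i = vec_index (0\<^sub>v (m + 1)) i" using v0 vi[of i] by (cases "i = 0") auto
  qed (use v in auto)
qed

text \<open>For a kernel vector the rows i > 0 give x_i (v_0 - v_i) = v_0, and row 0 becomes (1 - c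
  + \<Sum>b_l) v_0 = 0. Then every v_i vanishes, as x_i \<noteq> 0.\<close>

lemma det_mult_mat_0: "det (mult_mat m 0 a b c x) \<noteq> 0"
proof (rule det_nonzero_if_kernel_trivial[OF mult_mat_carrier])
  fix v :: "complex vec" assume v: "v \<in> carrier_vec (m + 1)" and z: "mult_mat m 0 a b c x *\<^sub>v v = 0\<^sub>v (m + 1)"
  have nz: "1 - (c - (\<Sum>l\<in>{1..m}. b l)) \<noteq> 0" using nonzero_parameters(5) by (metis eq_iff_diff_eq_0)
  have row: "vec_index (mult_mat m 0 a b c x *\<^sub>v v) i = 0" if "i \<le> m" for i unfolding z using that by simp
  have vi: "x i * (vec_index v 0 - vec_index v i) = vec_index v 0" if "i \<in> {1..m}" for i
    using row[of i] mult_mat_row[OF v, of i 0] that by (simp add: pt_def)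
  have "(\<Sum>s\<in>{1..m}. b s * x s * (vec_index v 0 - vec_index v s)) = (\<Sum>l\<in>{1..m}. b l) * vec_index v 0"
    unfolding sum_distrib_right by (intro sum.cong) (auto simp: vi mult.assoc)
  then have "vec_index v 0 - ((c - a) * vec_index v 0 - (\<Sum>l\<in>{1..m}. b l) * vec_index v 0) / (1 - a) = 0"
    using row[of 0] mult_mat_row[OF v, of 0 0] by (simp add: pt_def)
  then have "(1 - a) * vec_index v 0 - ((c - a) * vec_index v 0 - (\<Sum>l\<in>{1..m}. b l) * vec_index v 0) = 0"
    using a_ne_1 by (simp add: field_simps)
  then have "(1 - (c - (\<Sum>l\<in>{1..m}. b l))) * vec_index v 0 = 0" by (simp add: algebra_simps)
  then have v0: "vec_index v 0 = 0" using nz by auto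
  show "v = 0\<^sub>v (m + 1)"
  proof (rule eq_vecI)
    fix i assume "i < dim_vec (0\<^sub>v (m + 1) :: complex vec)"
    then show "vec_index v i = vec_index (0\<^sub>v (m + 1)) i" using v0 vi[of i] x_ne[of i] by (cases "i = 0") auto
  qed (use v in auto)
qed

lemma det_Q_mat: "det (Q_mat m (m + 1) a b c x) \<noteq> 0" "det (Q_mat m 0 a b c x) \<noteq> 0"
  using det_C_mat det_mult_mat_last det_mult_mat_0
  by (simp_all add: Q_mat_eq det_mult[OF mult_mat_carrier C_mat_carrier])

lemma Q_mat_carrier: "Q_mat m l a b c x \<in> carrier_mat (m + 1) (m + 1)" by (simp add: Q_mat_def)

lemma Q_C_inverse:
  assumes "l \<le> m + 1"
  shows "Q_mat m l a b c x * inv_mat (C_mat m a b c x) = mult_mat m l a b c x"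
proof -
  note C = inv_mat_if_det_nonzero[OF C_mat_carrier det_C_mat]
  have "Q_mat m l a b c x * inv_mat (C_mat m a b c x) = mult_mat m l a b c x * (C_mat m a b c x * inv_mat (C_mat m a b c x))"
    unfolding Q_mat_eq[OF assms] by (rule assoc_mult_mat[OF mult_mat_carrier C_mat_carrier C(2)])
  also have "\<dots> = mult_mat m l a b c x" unfolding C(3) by (rule right_mult_one_mat[OF mult_mat_carrier])
  finally show ?thesis .
qed

text \<open>With u = C^(-1) v one has Q_l u = N_l v for every l, so the quotient carries N_l' v to
  N_l v without an inverse of N_l'.\<close>

lemma Q_Q_inverse:
  assumes l: "l \<le> m + 1" "l' \<le> m + 1" and det: "det (Q_mat m l' a b c x) \<noteq> 0" and v: "v \<in> carrier_vec (m + 1)"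
  shows "(Q_mat m l a b c x * inv_mat (Q_mat m l' a b c x)) *\<^sub>v (mult_mat m l' a b c x *\<^sub>v v) = mult_mat m l a b c x *\<^sub>v v"
proof -
  note C = inv_mat_if_det_nonzero[OF C_mat_carrier det_C_mat]
  note Q = inv_mat_if_det_nonzero[OF Q_mat_carrier det]
  define u where "u = inv_mat (C_mat m a b c x) *\<^sub>v v"
  have u: "u \<in> carrier_vec (m + 1)" unfolding u_def by (rule mult_mat_vec_carrier[OF C(2) v])
  have Qu: "Q_mat m l a b c x *\<^sub>v u = mult_mat m l a b c x *\<^sub>v v" if "l \<le> m + 1" for l
    unfolding u_def assoc_mult_mat_vec[OF Q_mat_carrier C(2) v, symmetric] Q_C_inverse[OF that] ..
  have "(Q_mat m l a b c x * inv_mat (Q_mat m l' a b c x)) *\<^sub>v (Q_mat m l' a b c x *\<^sub>v u)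
      = Q_mat m l a b c x *\<^sub>v (inv_mat (Q_mat m l' a b c x) *\<^sub>v (Q_mat m l' a b c x *\<^sub>v u))"
    by (rule assoc_mult_mat_vec[OF Q_mat_carrier Q(2) mult_mat_vec_carrier[OF Q_mat_carrier u]])
  also have "inv_mat (Q_mat m l' a b c x) *\<^sub>v (Q_mat m l' a b c x *\<^sub>v u) = u"
    unfolding assoc_mult_mat_vec[OF Q(2) Q_mat_carrier u, symmetric] Q(4) by (rule one_mult_mat_vec[OF u])
  finally show ?thesis unfolding Qu[OF l(1)] Qu[OF l(2)] .
qed

end

section \<open>Contiguity matrices\<close>

locale contiguity = near_base m k \<xi> + configuration m a b c x
  for m k :: nat and \<xi> :: real and a :: complex and b :: "nat \<Rightarrow> complex" and c :: complex and x :: "nat \<Rightarrow> complex" +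
  assumes x: "x \<in> polydisc m k \<xi>"
begin

lemma F_vec_0: "vec_index (F_vec m k a' b' c' x) 0 = f_ser m k a' b' c' x"
  by (simp add: F_vec_def)

lemma F_vec_pos: "i \<in> {1..m} \<Longrightarrow> vec_index (F_vec m k a' b' c' x) i = (x i - 1) / (- b' i) * partial i a' b' c' x"
  by (simp add: F_vec_def partial_def)

lemma F_vec_carrier: "F_vec m k a' b' c' x \<in> carrier_vec (m + 1)"
  by (simp add: F_vec_def)

lemma F_vec_difference:
  assumes i: "i \<in> {1..m}"
  shows "b i * (vec_index (F_vec m k a b c x) 0 - vec_index (F_vec m k a b c x) i) = (a - c) * partial i (a - 1) b c x"
  unfolding relation_derivative[OF x i] F_vec_0 F_vec_pos[OF i]
  using nonzero_parameters(3)[OF i] by (simp add: field_simps)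

text \<open>The sum in row 0 becomes a - c times the Euler operator applied to the series at a - 1.
  \<open>relation_euler\<close> evaluates it, and the factor 1 - a cancels.\<close>

lemma mult_mat_row_0:
  "vec_index (mult_mat m l a b c x *\<^sub>v F_vec m k a b c x) 0
    = (1 - pt m x l) * f_ser m k a b c x + (a - c) * f_ser m k (a - 1) b c x"
proof -
  have "(\<Sum>s\<in>{1..m}. b s * x s * (vec_index (F_vec m k a b c x) 0 - vec_index (F_vec m k a b c x) s))
      = (\<Sum>s\<in>{1..m}. (a - c) * (x s * partial s (a - 1) b c x))"
    by (intro sum.cong refl) (simp add: F_vec_difference[symmetric] mult_ac)
  also have "\<dots> = (a - c) * ((1 - a) * f_ser m k (a - 1) b c x - f_ser m k a b c x)"
    unfolding sum_distrib_left[symmetric] relation_euler[OF x, of a b c] by simp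
  finally have S: "(\<Sum>s\<in>{1..m}. b s * x s * (vec_index (F_vec m k a b c x) 0 - vec_index (F_vec m k a b c x) s))
      = (a - c) * ((1 - a) * f_ser m k (a - 1) b c x - f_ser m k a b c x)" .
  have "vec_index (mult_mat m l a b c x *\<^sub>v F_vec m k a b c x) 0 = (1 - pt m x l) * f_ser m k a b c x
      - ((c - a) * f_ser m k a b c x - (a - c) * ((1 - a) * f_ser m k (a - 1) b c x - f_ser m k a b c x)) / (1 - a)"
    using mult_mat_row[OF F_vec_carrier, of 0 l a b c] unfolding S by (simp add: F_vec_0)
  also have "(c - a) * f_ser m k a b c x - (a - c) * ((1 - a) * f_ser m k (a - 1) b c x - f_ser m k a b c x)
      = (1 - a) * (- (a - c) * f_ser m k (a - 1) b c x)" by (simp add: algebra_simps)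
  finally have "vec_index (mult_mat m l a b c x *\<^sub>v F_vec m k a b c x) 0 = (1 - pt m x l) * f_ser m k a b c x
      - (1 - a) * (- (a - c) * f_ser m k (a - 1) b c x) / (1 - a)" .
  moreover have "(1 - a) * (- (a - c) * f_ser m k (a - 1) b c x) / (1 - a) = - (a - c) * f_ser m k (a - 1) b c x"
    using a_ne_1 by (intro nonzero_mult_div_cancel_left) simp
  ultimately show ?thesis by (metis diff_minus_eq_add mult_minus_left)
qed

lemma mult_mat_row_pos:
  assumes i: "i \<in> {1..m}"
  shows "b i * vec_index (mult_mat m l a b c x *\<^sub>v F_vec m k a b c x) i
    = b i * vec_index (F_vec m k a b c x) 0 - x i * ((a - c) * partial i (a - 1) b c x) - pt m x l * (b i * vec_index (F_vec m k a b c x) i)"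
proof -
  have E: "vec_index (mult_mat m l a b c x *\<^sub>v F_vec m k a b c x) i =
      vec_index (F_vec m k a b c x) 0 - x i * (vec_index (F_vec m k a b c x) 0 - vec_index (F_vec m k a b c x) i) - pt m x l * vec_index (F_vec m k a b c x) i"
    using mult_mat_row[OF F_vec_carrier, of i l a b c] i by simp
  show ?thesis unfolding E F_vec_difference[OF i, symmetric] by (simp add: algebra_simps)
qed

lemma vec_eqI:
  assumes "u \<in> carrier_vec (m + 1)" "v \<in> carrier_vec (m + 1)" "vec_index u 0 = vec_index v 0"
    and "\<And>i. i \<in> {1..m} \<Longrightarrow> b i * vec_index u i = b i * vec_index v i"
  shows "u = v"
proof (rule eq_vecI)
  fix i assume "i < dim_vec v"
  then have "i = 0 \<or> i \<in> {1..m}" using assms(2) by auto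
  then show "vec_index u i = vec_index v i"
    using assms(3) assms(4)[of i] nonzero_parameters(3)[of i] by auto
qed (use assms in auto)

lemma contiguity_a: "mult_mat m (m + 1) a b c x *\<^sub>v F_vec m k a b c x = (a - c) \<cdot>\<^sub>v F_vec m k (a - 1) b c x"
proof (rule vec_eqI)
  fix i assume i: "i \<in> {1..m}"
  have "b i * vec_index (mult_mat m (m + 1) a b c x *\<^sub>v F_vec m k a b c x) i
     = b i * (vec_index (F_vec m k a b c x) 0 - vec_index (F_vec m k a b c x) i) - x i * ((a - c) * partial i (a - 1) b c x)"
    unfolding mult_mat_row_pos[OF i] by (simp add: pt_def algebra_simps)
  also have "\<dots> = (a - c) * ((1 - x i) * partial i (a - 1) b c x)"
    unfolding F_vec_difference[OF i] by (simp add: algebra_simps)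
  also have "(1 - x i) * partial i (a - 1) b c x = b i * vec_index (F_vec m k (a - 1) b c x) i"
    unfolding F_vec_pos[OF i] using nonzero_parameters(3)[OF i] by (simp add: field_simps)
  finally show "b i * vec_index (mult_mat m (m + 1) a b c x *\<^sub>v F_vec m k a b c x) i = b i * vec_index ((a - c) \<cdot>\<^sub>v F_vec m k (a - 1) b c x) i"
    using i F_vec_carrier[of "a - 1" b c] by (simp add: mult_ac)
qed (use mult_mat_row_0[of "m + 1"] F_vec_carrier[of "a - 1" b c] mult_mat_vec_carrier[OF mult_mat_carrier F_vec_carrier] in
    \<open>auto simp: pt_def F_vec_0\<close>)

lemma contiguity_c: "mult_mat m 0 a b c x *\<^sub>v F_vec m k a b c x = (-1) \<cdot>\<^sub>v F_vec m k (a - 1) b (c - 1) x"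
proof (rule vec_eqI)
  fix i assume i: "i \<in> {1..m}"
  have "b i * vec_index (mult_mat m 0 a b c x *\<^sub>v F_vec m k a b c x) i
     = b i * f_ser m k a b c x - x i * ((a - c) * partial i (a - 1) b c x)"
    unfolding mult_mat_row_pos[OF i] by (simp add: pt_def F_vec_0)
  also have "\<dots> = (x i - 1) * (- partial i a b c x - (a - c) * partial i (a - 1) b c x)"
    unfolding relation_derivative[OF x i] by (simp add: algebra_simps)
  also have "\<dots> = b i * (- vec_index (F_vec m k (a - 1) b (c - 1) x) i)"
    unfolding relation_c_derivative[OF x i, symmetric] F_vec_pos[OF i] using nonzero_parameters(3)[OF i] by simp
  finally show "b i * vec_index (mult_mat m 0 a b c x *\<^sub>v F_vec m k a b c x) i = b i * vec_index ((-1) \<cdot>\<^sub>v F_vec m k (a - 1) b (c - 1) x) i"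
    using i F_vec_carrier[of "a - 1" b "c - 1"] by simp
qed (use mult_mat_row_0[of 0] relation_c[OF x, of a b c] F_vec_carrier[of "a - 1" b "c - 1"] mult_mat_vec_carrier[OF mult_mat_carrier F_vec_carrier] in
    \<open>auto simp: pt_def F_vec_0\<close>)

lemma contiguity_b:
  assumes l: "l \<in> {1..m}"
  shows "mult_mat m l a b c x *\<^sub>v F_vec m k a b c x = (- (1 - b l)) \<cdot>\<^sub>v F_vec m k (a - 1) (b(l := b l - 1)) (c - 1) x"
proof (rule vec_eqI)
  have nl: "pt m x l = x l" using l by (simp add: pt_def)
  fix i assume i: "i \<in> {1..m}"
  let ?d = "partial i (a - 1) b (c - 1) x + x l * partial i a b c x"
  have b0: "b i \<noteq> 0" by (rule nonzero_parameters(3)[OF i])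
  have b1: "b l - 1 \<noteq> 0"
    using generic l Ints_1 unfolding generic_def by (metis eq_iff_diff_eq_0)
  have "b i * vec_index (mult_mat m l a b c x *\<^sub>v F_vec m k a b c x) i
     = b i * vec_index (mult_mat m 0 a b c x *\<^sub>v F_vec m k a b c x) i - x l * (b i * vec_index (F_vec m k a b c x) i)"
    unfolding mult_mat_row_pos[OF i] nl by (simp add: pt_def)
  also have "\<dots> = (x i - 1) * ?d"
    unfolding contiguity_c using i F_vec_carrier[of "a - 1" b "c - 1"] b0 by (simp add: F_vec_pos field_simps)
  also have "\<dots> = b i * (- (1 - b l) * vec_index (F_vec m k (a - 1) (b(l := b l - 1)) (c - 1) x) i)"
  proof (cases "i = l")
    case False
    then have d: "?d = (1 - b l) * partial i (a - 1) (b(l := b l - 1)) (c - 1) x"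
      using relation_b_derivative[OF x i l, of b a c] by simp
    show ?thesis unfolding d F_vec_pos[OF i] using False b0 by (simp add: field_simps)
  next
    case True
    have D: "(1 - b l) * partial i (a - 1) (b(l := b l - 1)) (c - 1) x = ?d + f_ser m k a b c x"
      using relation_b_derivative[OF x i l, of b a c] True by simp
    \<comment> \<open>For i = l the product rule adds f, so (1 - b_l) times the derivative of the
      fully shifted series is (1 - b_l) f. That derivative is thus f itself, which absorbs the
      change of the normalization from b_l to b_l - 1.\<close>
    have d: "?d = - (b i * f_ser m k a b c x)"
      unfolding relation_c_derivative[OF x i] relation_derivative[OF x i] using True by (simp add: algebra_simps)
    have "b i * (- (1 - b l) * vec_index (F_vec m k (a - 1) (b(l := b l - 1)) (c - 1) x) i)
        = b l * (x l - 1) * (- partial i (a - 1) (b(l := b l - 1)) (c - 1) x)"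
      unfolding F_vec_pos[OF i] using True b1 by (simp add: field_simps)
    moreover have "(1 - b l) * (b l * (- partial i (a - 1) (b(l := b l - 1)) (c - 1) x)) = (1 - b l) * ?d"
    proof -
      have "(1 - b l) * (b l * (- partial i (a - 1) (b(l := b l - 1)) (c - 1) x)) = - b l * ((1 - b l) * partial i (a - 1) (b(l := b l - 1)) (c - 1) x)"
        by (simp add: algebra_simps)
      also have "\<dots> = (1 - b l) * ?d" unfolding D unfolding d using True by (simp add: algebra_simps)
      finally show ?thesis .
    qed
    then have "b l * (- partial i (a - 1) (b(l := b l - 1)) (c - 1) x) = ?d"
      using b1 by (simp only: mult_cancel_left) auto
    ultimately show ?thesis using True by (metis mult.assoc mult.commute)
  qed
  finally show "b i * vec_index (mult_mat m l a b c x *\<^sub>v F_vec m k a b c x) i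
     = b i * vec_index ((- (1 - b l)) \<cdot>\<^sub>v F_vec m k (a - 1) (b(l := b l - 1)) (c - 1) x) i"
    using i F_vec_carrier[of "a - 1" "b(l := b l - 1)" "c - 1"] by simp
next
  have nl: "pt m x l = x l" using l by (simp add: pt_def)
  have "(1 - pt m x l) * f_ser m k a b c x + (a - c) * f_ser m k (a - 1) b c x
      = - ((1 - b l) * f_ser m k (a - 1) (b(l := b l - 1)) (c - 1) x)"
    using relation_b[OF x l, of b a c] relation_c[OF x, of a b c] unfolding nl by (simp add: algebra_simps)
  then show "vec_index (mult_mat m l a b c x *\<^sub>v F_vec m k a b c x) 0
      = vec_index ((- (1 - b l)) \<cdot>\<^sub>v F_vec m k (a - 1) (b(l := b l - 1)) (c - 1) x) 0"
    unfolding mult_mat_row_0 using F_vec_carrier[of "a - 1" "b(l := b l - 1)" "c - 1"] by (simp add: F_vec_0 algebra_simps)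
qed (use F_vec_carrier mult_mat_vec_carrier[OF mult_mat_carrier F_vec_carrier] in auto)

end

section \<open>Assembling the three contiguity formulas\<close>

lemma smult_mat_vec:
  assumes "A \<in> carrier_mat n n" "v \<in> carrier_vec n"
  shows "(s \<cdot>\<^sub>m A) *\<^sub>v v = s \<cdot>\<^sub>v (A *\<^sub>v v :: complex vec)"
  using assms by (intro eq_vecI) (auto simp: scalar_prod_def sum_distrib_left mult.assoc)

lemma mat_smult_vec:
  assumes "A \<in> carrier_mat n n" "v \<in> carrier_vec n"
  shows "A *\<^sub>v (s \<cdot>\<^sub>v v) = s \<cdot>\<^sub>v (A *\<^sub>v v :: complex vec)"
  using assms by (intro eq_vecI) (auto simp: scalar_prod_def sum_distrib_left mult_ac)

lemma not_Ints_shift: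
  fixes z :: complex
  assumes "z \<notin> \<int>"
  shows "z + 1 \<notin> \<int>" "z - 1 \<notin> \<int>"
  using assms Ints_diff[of "z + 1" 1] Ints_add[of "z - 1" 1] by auto

text \<open>One neighbourhood serves all parameters, as \<delta> is chosen before them.
  Invertibility is part of the conclusion because \<open>inv_mat\<close> is unspecified for singular
  matrices.\<close>

theorem corollary13:
  fixes m k :: nat and \<epsilon> \<xi> :: real
  assumes "1 \<le> m" and "1 \<le> k" and "k \<le> m"
    and "0 < \<epsilon>" and "\<epsilon> < 1 / 2"
    and "0 < \<xi>" and "\<xi> < min \<epsilon> (1 / (1 + \<epsilon>))"
  shows "\<exists>\<delta>>0. \<forall>(a :: complex) (c :: complex) (b :: nat \<Rightarrow> complex) (x :: nat \<Rightarrow> complex).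
    a \<notin> \<int> \<longrightarrow> c - a \<notin> \<int> \<longrightarrow> (\<forall>l\<in>{1..m}. b l \<notin> \<int>) \<longrightarrow>
    c - (\<Sum>l\<in>{1..m}. b l) \<notin> \<int> \<longrightarrow> c - (\<Sum>l\<in>{1..<k}. b l) \<notin> \<int> \<longrightarrow>
    (\<forall>l\<in>{1..m}. dist (x l) (base_point k \<xi> l) < \<delta>) \<longrightarrow>
      invertible_mat (C_mat m a b c x) \<and>
      invertible_mat (Q_mat m (m + 1) (a + 1) b c x) \<and>
      invertible_mat (Q_mat m 0 (a + 1) b (c + 1) x) \<and>
      F_vec m k (a - 1) b c x = D_a m a b c x *\<^sub>v F_vec m k a b c x \<and>
      F_vec m k a b (c - 1) x = D_c m a b c x *\<^sub>v F_vec m k a b c x \<and>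
      (\<forall>l\<in>{1..m}. F_vec m k a (b(l := b l - 1)) c x = D_b m l a b c x *\<^sub>v F_vec m k a b c x)"
proof (intro exI[of _ "radius m \<xi>"] conjI[of "radius m \<xi> > 0"] allI impI)
  interpret near_base m k \<xi> by unfold_locales (use assms in auto)
  show "radius m \<xi> > 0" by (rule radius_pos)
  fix a c :: complex and b x :: "nat \<Rightarrow> complex"
  assume a: "a \<notin> \<int>" and ca: "c - a \<notin> \<int>" and b: "\<forall>l\<in>{1..m}. b l \<notin> \<int>"
    and cb: "c - (\<Sum>l\<in>{1..m}. b l) \<notin> \<int>" and "\<forall>l\<in>{1..m}. dist (x l) (base_point k \<xi> l) < radius m \<xi>"
  then have x: "x \<in> polydisc m k \<xi>" by (simp add: polydisc_def)
  have inj: "inj_on (pt m x) {0..m + 1}" using polydisc_distinct[OF x] unfolding pt_def [abs_def] .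
  have g1: "generic m a b c" using a ca b cb by (simp add: generic_def)
  have ca': "c - (a + 1) \<notin> \<int>" using not_Ints_shift(2)[OF ca] by (simp add: diff_diff_eq)
  have g2: "generic m (a + 1) b c"
    using not_Ints_shift(1)[OF a] ca' b cb by (simp add: generic_def)
  have cb': "c + 1 - (\<Sum>l\<in>{1..m}. b l) \<notin> \<int>" using not_Ints_shift(1)[OF cb] by (simp add: diff_add_eq)
  have g3: "generic m (a + 1) b (c + 1)"
    using not_Ints_shift(1)[OF a] ca b cb' by (simp add: generic_def)
  \<comment> \<open>One instance per formula: \<open>A\<close> lowers a from a itself,
    \<open>C\<close> and \<open>B\<close> start at a + 1 so that the lowered value is a, and
    \<open>B\<close> starts at c + 1 for the same reason.\<close>
  interpret A: contiguity m k \<xi> a b c x by unfold_locales (use g1 inj x in auto)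
  interpret C: contiguity m k \<xi> "a + 1" b c x by unfold_locales (use g2 inj x in auto)
  interpret B: contiguity m k \<xi> "a + 1" b "c + 1" x by unfold_locales (use g3 inj x in auto)
  note F = A.F_vec_carrier
  have QQ: "Q * inv_mat Q' \<in> carrier_mat (m + 1) (m + 1)"
    if "Q \<in> carrier_mat (m + 1) (m + 1)" "inv_mat Q' \<in> carrier_mat (m + 1) (m + 1)" for Q Q'
    by (rule mult_carrier_mat[OF that])
  note iA = inv_mat_if_det_nonzero[OF A.C_mat_carrier A.det_C_mat]
  note iC = inv_mat_if_det_nonzero[OF C.Q_mat_carrier C.det_Q_mat(1)]
  note iB = inv_mat_if_det_nonzero[OF B.Q_mat_carrier B.det_Q_mat(2)]
  have Da: "F_vec m k (a - 1) b c x = D_a m a b c x *\<^sub>v F_vec m k a b c x"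
  proof -
    have "a - c \<noteq> 0" using A.nonzero_parameters(2) by auto
    then show ?thesis
      unfolding D_a_def A.Q_C_inverse[OF order_refl] smult_mat_vec[OF A.mult_mat_carrier F] A.contiguity_a
      by (simp add: smult_smult_assoc)
  qed
  have Dc: "F_vec m k a b (c - 1) x = D_c m a b c x *\<^sub>v F_vec m k a b c x"
  proof -
    let ?Q = "Q_mat m 0 (a + 1) b c x * inv_mat (Q_mat m (m + 1) (a + 1) b c x)"
    \<comment> \<open>At a + 1 the vector N_{m+1} F is (a + 1 - c) F(a, b, c) and N_0 F is - F(a, b,
      c-1); this produces the factor c - a - 1.\<close>
    have "?Q *\<^sub>v ((a + 1 - c) \<cdot>\<^sub>v F_vec m k a b c x) = (-1) \<cdot>\<^sub>v F_vec m k a b (c - 1) x"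
      using C.Q_Q_inverse[OF _ order_refl C.det_Q_mat(1) F, of 0 "a + 1" b c]
      unfolding C.contiguity_a C.contiguity_c by simp
    then have "(-1) \<cdot>\<^sub>v ((a + 1 - c) \<cdot>\<^sub>v (?Q *\<^sub>v F_vec m k a b c x)) = (-1) \<cdot>\<^sub>v ((-1) \<cdot>\<^sub>v F_vec m k a b (c - 1) x)"
      unfolding mat_smult_vec[OF QQ[OF C.Q_mat_carrier iC(2)] F] by simp
    then show ?thesis
      unfolding D_c_def smult_mat_vec[OF QQ[OF C.Q_mat_carrier iC(2)] F] smult_smult_assoc by (simp add: diff_diff_eq)
  qed
  have Db: "F_vec m k a (b(l := b l - 1)) c x = D_b m l a b c x *\<^sub>v F_vec m k a b c x" if l: "l \<in> {1..m}" for l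
  proof -
    let ?Q = "Q_mat m l (a + 1) b (c + 1) x * inv_mat (Q_mat m 0 (a + 1) b (c + 1) x)"
    \<comment> \<open>At (a + 1, b, c + 1) the vector N_0 F is - F(a, b, c) and N_l F is - (1 - b_l)
      F(a, b - e_l, c); this produces the factor 1/(1 - b_l).\<close>
    have "?Q *\<^sub>v ((-1) \<cdot>\<^sub>v F_vec m k a b c x) = (- (1 - b l)) \<cdot>\<^sub>v F_vec m k a (b(l := b l - 1)) c x"
      using B.Q_Q_inverse[OF _ _ B.det_Q_mat(2) F, of l "a + 1" b "c + 1"] l
      unfolding B.contiguity_c B.contiguity_b[OF l] by simp
    then have "(- (1 / (1 - b l))) \<cdot>\<^sub>v ((-1) \<cdot>\<^sub>v (?Q *\<^sub>v F_vec m k a b c x)) = (- (1 / (1 - b l))) \<cdot>\<^sub>v ((- (1 - b l)) \<cdot>\<^sub>v F_vec m k a (b(l := b l - 1)) c x)"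
      unfolding mat_smult_vec[OF QQ[OF B.Q_mat_carrier iB(2)] F] by simp
    moreover have "- (1 / (1 - b l)) * - (1 - b l) = 1" "- (1 / (1 - b l)) * - 1 = 1 / (1 - b l)"
    proof -
      have "1 - b l \<noteq> 0" using b l by (metis Ints_1 eq_iff_diff_eq_0)
      then show "- (1 / (1 - b l)) * - (1 - b l) = 1" "- (1 / (1 - b l)) * - 1 = 1 / (1 - b l)"
        by (simp_all only: minus_mult_minus) simp_all
    qed
    ultimately show ?thesis
      unfolding D_b_def smult_mat_vec[OF QQ[OF B.Q_mat_carrier iB(2)] F] smult_smult_assoc by simp
  qed
  show "invertible_mat (C_mat m a b c x) \<and>
      invertible_mat (Q_mat m (m + 1) (a + 1) b c x) \<and>
      invertible_mat (Q_mat m 0 (a + 1) b (c + 1) x) \<and>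
      F_vec m k (a - 1) b c x = D_a m a b c x *\<^sub>v F_vec m k a b c x \<and>
      F_vec m k a b (c - 1) x = D_c m a b c x *\<^sub>v F_vec m k a b c x \<and>
      (\<forall>l\<in>{1..m}. F_vec m k a (b(l := b l - 1)) c x = D_b m l a b c x *\<^sub>v F_vec m k a b c x)"
    using iA(1) iC(1) iB(1) Da Dc Db by blast
qed

end
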